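(* Let $u_{a,\gamma,p}$ be the family described in the context. There exist $\varepsilon>0$ and a unique function $p\in C^\infty([0,\varepsilon))$ with $$p(0)=4,\qquad \frac{dp}{da}(0)=\frac{\|Q_4\|_{L^1}^2}{\|Q_4\|_{L^2}^2}=\frac{\Gamma(1/4)^4}{4\pi^2}\ (\approx 4.3768)$$ such that, for every $a\in[0,\varepsilon)$, the function $x\mapsto u(x)=u_{a,\frac{2}{p(a)}-1,p(a)}(x)$ is a solution of $$a\Big(\frac{2}{p}u+xu_x\Big)-u_{xxx}+u_x-(|u|^pu)_x=0,\qquad p=p(a),$$ with $$\partial_xu_{a,\frac2{p(a)}-1,p(a)}\in L^2(\mathbb{R}),\qquad \sup_{0\le a<\varepsilon,\;x\in\mathbb{R}}(1+a|x|)^{2/p(a)}\,\big|u_{a,\frac2{p(a)}-1,p(a)}(x)\big|<\infty,$$ and vanishing energy $$\int_{\mathbb{R}}\frac12\Big(\partial_xu_{a,\frac2{p(a)}-1,p(a)}\Big)^2-\frac1{p(a)+2}\Big|u_{a,\frac2{p(a)}-1,p(a)}\Big|^{p(a)+2}\,dx=0 .$$ (Here it is part of the assertion that the parameters $(a,\frac{2}{p(a)}-1,p(a))$ lie in the domain of the family.)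
   Context: $Q_p(x)=\left(\frac{p+2}{2}\right)^{1/p}\operatorname{sech}^{2/p}\left(\frac{px}{2}\right)$ is the soliton, the even positive solution of $-Q''+Q-Q^{p+1}=0$; $\langle f,g\rangle=\int_{\mathbb{R}}fg\,dx$; $x_+=\max\{x,0\}$; $\Gamma$ is the Gamma function. Fix $q>4$. The family $u_{a,\gamma,p}$: there is $\varepsilon_0>0$ and a unique map $(a,\gamma,p,x)\mapsto u_{a,\gamma,p}(x)$, smooth (up to $a=0$) on $0\le a<\varepsilon_0$, $|\gamma+\frac12|<\varepsilon_0$, $3\le p\le q$, $x\in\mathbb{R}$, such that (1) $u=u_{a,\gamma,p}$ solves $a((1+\gamma)u+xu_x)-u_{xxx}+u_x-(|u|^pu)_x+\langle Q_p',u\rangle Q_p''=0$; (2) $\sup_{a,\gamma,p,x}(1+a|x|)^{1+\gamma}|u_{a,\gamma,p}(x)|<\infty$; (3) $\sup_{a,\gamma,p,x}(1+x_+)^{1-k}|\partial_\gamma^n\partial_p^m\partial_a^ku_{a,\gamma,p}(x)|<\infty$ for all $k\ge1$, $n,m\ge0$; (4) $u_{0,\gamma,p}=Q_p$; (5) $u_{a,\gamma,p}>0$ and $\partial_xu_{a,\gamma,p}\in L^2(\mathbb{R})$. $u_{a,\gamma,p}$ denotes this family. *)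

theory Defs
  imports "HOL-Analysis.Analysis"
begin

definition dir_deriv ::
  "'a::real_normed_vector set \<Rightarrow> 'a \<Rightarrow> ('a \<Rightarrow> 'b::real_normed_vector) \<Rightarrow> 'a \<Rightarrow> 'b" where
  "dir_deriv S v f z = frechet_derivative f (at z within S) v"

(* Derivatives are taken within S.  For the product of nondegenerate intervals to which this is
   applied below they are unique, and at boundary points they are one-sided, so smooth_on means
   smoothness up to the part of the boundary that belongs to S. *)
primrec Ck_on ::
  "nat \<Rightarrow> 'a::real_normed_vector set \<Rightarrow> ('a \<Rightarrow> 'b::real_normed_vector) \<Rightarrow> bool" where
  "Ck_on 0 S f \<longleftrightarrow> continuous_on S f"
| "Ck_on (Suc k) S f \<longleftrightarrow>
     continuous_on S f \<and> f differentiable_on S \<and> (\<forall>v. Ck_on k S (dir_deriv S v f))"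

definition smooth_on ::
  "'a::real_normed_vector set \<Rightarrow> ('a \<Rightarrow> 'b::real_normed_vector) \<Rightarrow> bool" where
  "smooth_on S f \<longleftrightarrow> (\<forall>k. Ck_on k S f)"

definition in_L2 :: "(real \<Rightarrow> real) \<Rightarrow> bool" where
  "in_L2 f \<longleftrightarrow> f \<in> borel_measurable lborel \<and> integrable lborel (\<lambda>x. (f x)\<^sup>2)"

definition L1_norm :: "(real \<Rightarrow> real) \<Rightarrow> real" where
  "L1_norm f = (LINT x|lborel. \<bar>f x\<bar>)"

definition L2_norm :: "(real \<Rightarrow> real) \<Rightarrow> real" where
  "L2_norm f = sqrt (LINT x|lborel. (f x)\<^sup>2)"

definition L2_inner :: "(real \<Rightarrow> real) \<Rightarrow> (real \<Rightarrow> real) \<Rightarrow> real" where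
  "L2_inner f g = (LINT x|lborel. f x * g x)"

definition soliton :: "real \<Rightarrow> real \<Rightarrow> real" where
  "soliton p x = ((p + 2) / 2) powr (1 / p) * (1 / cosh (p * x / 2)) powr (2 / p)"

definition param_dom :: "real \<Rightarrow> real \<Rightarrow> (real \<times> real \<times> real) set" where
  "param_dom q \<epsilon>0 = {(a, \<gamma>, p). 0 \<le> a \<and> a < \<epsilon>0 \<and> \<bar>\<gamma> + 1/2\<bar> < \<epsilon>0 \<and> 3 \<le> p \<and> p \<le> q}"

definition family_dom :: "real \<Rightarrow> real \<Rightarrow> (real \<times> real \<times> real \<times> real) set" where
  "family_dom q \<epsilon>0 = {(a, \<gamma>, p, x). (a, \<gamma>, p) \<in> param_dom q \<epsilon>0}"

(* Points are ordered (a, gamma, p, x); n, m, k count derivatives in gamma, p, a respectively. *)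
definition mixed_deriv ::
  "(real \<times> real \<times> real \<times> real) set \<Rightarrow> nat \<Rightarrow> nat \<Rightarrow> nat
    \<Rightarrow> (real \<times> real \<times> real \<times> real \<Rightarrow> real) \<Rightarrow> real \<times> real \<times> real \<times> real \<Rightarrow> real" where
  "mixed_deriv S n m k f =
     (dir_deriv S (0, 1, 0, 0) ^^ n) ((dir_deriv S (0, 0, 1, 0) ^^ m)
       ((dir_deriv S (1, 0, 0, 0) ^^ k) f))"

definition solves_forced_eq :: "real \<Rightarrow> real \<Rightarrow> real \<Rightarrow> (real \<Rightarrow> real) \<Rightarrow> bool" where
  "solves_forced_eq a \<gamma> p v \<longleftrightarrow> Ck_on 3 UNIV v \<and>
     (\<forall>x. a * ((1 + \<gamma>) * v x + x * deriv v x) - (deriv ^^ 3) v x + deriv v x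
          - deriv (\<lambda>y. \<bar>v y\<bar> powr p * v y) x
          + L2_inner (deriv (soliton p)) v * (deriv ^^ 2) (soliton p) x = 0)"

definition solves_profile_eq :: "real \<Rightarrow> real \<Rightarrow> (real \<Rightarrow> real) \<Rightarrow> bool" where
  "solves_profile_eq a p v \<longleftrightarrow> Ck_on 3 UNIV v \<and>
     (\<forall>x. a * (2 / p * v x + x * deriv v x) - (deriv ^^ 3) v x + deriv v x
          - deriv (\<lambda>y. \<bar>v y\<bar> powr p * v y) x = 0)"

definition profile_family ::
  "real \<Rightarrow> real \<Rightarrow> (real \<Rightarrow> real \<Rightarrow> real \<Rightarrow> real \<Rightarrow> real) \<Rightarrow> bool" where
  "profile_family q \<epsilon>0 u \<longleftrightarrow>
     smooth_on (family_dom q \<epsilon>0) (\<lambda>(a, \<gamma>, p, x). u a \<gamma> p x) \<and>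
     (\<forall>(a, \<gamma>, p) \<in> param_dom q \<epsilon>0. solves_forced_eq a \<gamma> p (u a \<gamma> p)) \<and>
     bdd_above ((\<lambda>(a, \<gamma>, p, x). (1 + a * \<bar>x\<bar>) powr (1 + \<gamma>) * \<bar>u a \<gamma> p x\<bar>) ` family_dom q \<epsilon>0) \<and>
     (\<forall>k n m. k \<ge> 1 \<longrightarrow>
        bdd_above ((\<lambda>(a, \<gamma>, p, x). (1 + max x 0) powr (1 - real k) *
            \<bar>mixed_deriv (family_dom q \<epsilon>0) n m k (\<lambda>(a, \<gamma>, p, x). u a \<gamma> p x) (a, \<gamma>, p, x)\<bar>)
          ` family_dom q \<epsilon>0)) \<and>
     (\<forall>\<gamma> p. (0, \<gamma>, p) \<in> param_dom q \<epsilon>0 \<longrightarrow> u 0 \<gamma> p = soliton p) \<and>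
     (\<forall>(a, \<gamma>, p) \<in> param_dom q \<epsilon>0. (\<forall>x. u a \<gamma> p x > 0) \<and> in_L2 (deriv (u a \<gamma> p)))"

definition energy_density :: "real \<Rightarrow> (real \<Rightarrow> real) \<Rightarrow> real \<Rightarrow> real" where
  "energy_density p v x = 1/2 * (deriv v x)\<^sup>2 - 1 / (p + 2) * \<bar>v x\<bar> powr (p + 2)"

(* has_bochner_integral asserts that the energy integral converges, besides giving its value. *)
definition zero_energy_curve ::
  "real \<Rightarrow> real \<Rightarrow> (real \<Rightarrow> real \<Rightarrow> real \<Rightarrow> real \<Rightarrow> real) \<Rightarrow> real \<Rightarrow> (real \<Rightarrow> real) \<Rightarrow> bool" where
  "zero_energy_curve q \<epsilon>0 u \<epsilon> p \<longleftrightarrow>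
     smooth_on {0..<\<epsilon>} p \<and>
     p 0 = 4 \<and>
     (p has_real_derivative (L1_norm (soliton 4))\<^sup>2 / (L2_norm (soliton 4))\<^sup>2) (at 0 within {0..<\<epsilon>}) \<and>
     (\<forall>a\<in>{0..<\<epsilon>}. (a, 2 / p a - 1, p a) \<in> param_dom q \<epsilon>0) \<and>
     (\<forall>a\<in>{0..<\<epsilon>}. solves_profile_eq a (p a) (u a (2 / p a - 1) (p a))) \<and>
     (\<forall>a\<in>{0..<\<epsilon>}. in_L2 (deriv (u a (2 / p a - 1) (p a)))) \<and>
     bdd_above ((\<lambda>(a, x). (1 + a * \<bar>x\<bar>) powr (2 / p a) * \<bar>u a (2 / p a - 1) (p a) x\<bar>)
       ` ({0..<\<epsilon>} \<times> UNIV)) \<and>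
     (\<forall>a\<in>{0..<\<epsilon>}. has_bochner_integral lborel
        (energy_density (p a) (u a (2 / p a - 1) (p a))) 0)"

end

theory Submission
  imports Defs "HOL-Real_Asymp.Real_Asymp"
begin

text \<open>
  Tie \<gamma> to p by \<gamma> = 2/p - 1 and write Q for the soliton of exponent p. The member
  u of the family with parameters (a, 2/p - 1, p) then solves the profile equation exactly when the
  number c = \<langle>Q', u\<rangle> vanishes, because the forcing term of its equation is c Q'' and
  Q''(0) < 0. So the curve is the zero set of c near (a, p) = (0, 4), and the theorem is an implicit
  function theorem fed by two asymptotic computations.

  Smoothness of c needs no integral: at x = 0 the forced equation expresses c Q''(0) through u and
  its x-derivatives at the origin. The resulting function of (a, p), called residual below, is
  smooth and vanishes for a = 0, so it equals a F with F smooth up to a = 0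
  (\<open>ray_mean_factor\<close>), and the curve is F = 0. It is obtained from
  \<open>smooth_implicit_function_at_boundary\<close>, which needs F(0, p) for p near 4 and the
  a-derivative of F at (0, 4).

  Both come from multiplying the forced equation by u and integrating over [-X, X]:
  a (\<gamma> + 1/2) \<integral>u^2 + c \<integral>Q'' u plus boundary terms is zero. Let a \<rightarrow> 0 and let
  X \<rightarrow> \<infinity> so slowly that a X \<rightarrow> 0, yet so fast that the soliton at X is negligible
  against a. The boundary terms are then of order a^2, so that
  c \<approx> a (\<gamma> + 1/2) |Q|^2 / |Q'|^2 with L2-norms (\<open>multiplier_first_order\<close>);
  with \<gamma> = 2/p - 1 this has a simple zero at p = 4. For p = 4 the mass term drops out and the
  boundary terms decide: u/a tends to 0 at -X and to (1/2) \<integral>Q at X, both with vanishing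
  derivatives, whence c \<approx> a^2 (\<integral>Q)^2 / (8 |Q'|^2)
  (\<open>multiplier_second_order\<close>). The limit on the left is 0 because the second a-derivative of u
  is bounded uniformly in x \<le> 0 while u itself decays there (\<open>left_tail\<close>); the jump from
  left to right is read off from the equation integrated once in x. Since |Q'|^2 = |Q|^2 / 2 for
  p = 4, the quotient of the two expansions is the asserted slope; its value in terms of \<Gamma> is a
  Beta integral (\<open>integral_sech_powr\<close>).

  For a > 0 the energy vanishes by a virial identity: multiplied by -u'' - u^(p+1), the profile
  equation says that a (p + 4) / p times the energy density is minus the derivative of a quantity B
  built from u, u', u''. As u' is square integrable, the equation forces u''^2 + |x| u'^2 to be
  arbitrarily small at points arbitrarily far out on either side, and B tends to 0 along such points
  (\<open>profile_zero_energy\<close>).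

  A competing curve starts at p = 4; it agrees with the constructed one as long as it stays close to
  4, and the set of agreement is open and closed in the interval.
\<close>

section \<open>Functions of class C^k on sets with one-sided derivatives\<close>

text \<open>
  Every point of S is approached within S along every coordinate axis. This is what makes
  derivatives within S unique, also at boundary points of half-open boxes.
\<close>

definition axis_thick :: "'a::euclidean_space set \<Rightarrow> bool" where
  "axis_thick S \<longleftrightarrow>
     (\<forall>z\<in>S. \<forall>i\<in>Basis. \<forall>e>0. \<exists>d. 0 < \<bar>d\<bar> \<and> \<bar>d\<bar> < e \<and> z + d *\<^sub>R i \<in> S)"

lemma axis_thick_open: "open S \<Longrightarrow> axis_thick S"
  unfolding axis_thick_def
proof safe
  fix z i :: 'a and e :: real
  assume S: "open S" and z: "z \<in> S" and i: "i \<in> Basis" and e: "e > 0"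
  obtain r where r: "r > 0" "ball z r \<subseteq> S" using S z by (meson openE)
  define d where "d = min (r/2) (e/2)"
  have "z + d *\<^sub>R i \<in> ball z r"
    using r e i by (auto simp: d_def dist_norm)
  then show "\<exists>d. 0 < \<bar>d\<bar> \<and> \<bar>d\<bar> < e \<and> z + d *\<^sub>R i \<in> S"
    using r e by (intro exI[of _ d]) (auto simp: d_def)
qed

lemma axis_thick_real_interval:
  fixes I :: "real set"
  assumes "is_interval I" "u \<in> I" "v \<in> I" "u < v"
  shows "axis_thick I"
  unfolding axis_thick_def
proof safe
  fix z i e :: real
  assume z: "z \<in> I" and i: "i \<in> Basis" and e: "e > 0"
  have i1: "i = 1" using i by simp
  show "\<exists>d. 0 < \<bar>d\<bar> \<and> \<bar>d\<bar> < e \<and> z + d *\<^sub>R i \<in> I"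
  proof (cases "z < v")
    case True
    define d where "d = min (e/2) (v - z)"
    have "d \<le> v - z" "0 \<le> d" using True e by (auto simp: d_def)
    then have "z \<le> z + d" "z + d \<le> v" by auto
    then have "z + d \<in> I"
      using assms(1,3) z unfolding is_interval_1 by blast
    then show ?thesis using True e i1 by (intro exI[of _ d]) (auto simp: d_def)
  next
    case False
    define d where "d = min (e/2) (z - u)"
    have "d \<le> z - u" "0 \<le> d" using False e assms by (auto simp: d_def)
    then have "u \<le> z - d" "z - d \<le> z" by auto
    then have "z - d \<in> I"
      using assms(1,2) z unfolding is_interval_1 by blast
    then show ?thesis using False e i1 assms(4) by (intro exI[of _ "-d"]) (auto simp: d_def)
  qed
qed

lemma axis_thick_Times:
  fixes S :: "'a::euclidean_space set" and T :: "'b::euclidean_space set"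
  assumes "axis_thick S" "axis_thick T"
  shows "axis_thick (S \<times> T)"
  unfolding axis_thick_def
proof safe
  fix x y and a :: 'a and b :: 'b and e :: real
  assume *: "x \<in> S" "y \<in> T" "(a, b) \<in> Basis" "e > 0"
  then consider "a \<in> Basis" "b = 0" | "b \<in> Basis" "a = 0"
    by (auto simp: Basis_prod_def)
  then show "\<exists>d. 0 < \<bar>d\<bar> \<and> \<bar>d\<bar> < e \<and> (x, y) + d *\<^sub>R (a, b) \<in> S \<times> T"
  proof cases
    case 1
    then obtain d where "0 < \<bar>d\<bar>" "\<bar>d\<bar> < e" "x + d *\<^sub>R a \<in> S"
      using assms(1) * unfolding axis_thick_def by blast
    with 1 * show ?thesis by (intro exI[of _ d]) auto
  next
    case 2
    then obtain d where "0 < \<bar>d\<bar>" "\<bar>d\<bar> < e" "y + d *\<^sub>R b \<in> T"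
      using assms(2) * unfolding axis_thick_def by blast
    with 2 * show ?thesis by (intro exI[of _ d]) auto
  qed
qed

lemma dir_deriv_eq:
  fixes f :: "'a::euclidean_space \<Rightarrow> 'b::real_normed_vector"
  assumes "axis_thick S" "z \<in> S" "(f has_derivative f') (at z within S)"
  shows "dir_deriv S v f z = f' v"
proof -
  have "frechet_derivative f (at z within S) = f'"
    using assms unfolding axis_thick_def
    by (intro frechet_derivative_unique_within[OF _ assms(3)])
       (auto simp: frechet_derivative_works[symmetric] differentiable_def)
  then show ?thesis by (simp add: dir_deriv_def)
qed

lemma dir_deriv_cong:
  assumes "\<And>z. z \<in> S \<Longrightarrow> f z = g z" "z \<in> S"
  shows "dir_deriv S v f z = dir_deriv S v g z"
proof -
  have "(f has_derivative f') (at z within S) = (g has_derivative f') (at z within S)" for f'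
    using assms has_derivative_transform[of z S f g] has_derivative_transform[of z S g f] by auto
  then show ?thesis by (simp add: dir_deriv_def frechet_derivative_def)
qed

lemma Ck_on_cong:
  assumes "\<And>z. z \<in> S \<Longrightarrow> f z = g z"
  shows "Ck_on k S f \<longleftrightarrow> Ck_on k S g"
  using assms
proof (induction k arbitrary: f g)
  case 0
  then show ?case by (simp cong: continuous_on_cong)
next
  case (Suc k)
  have "continuous_on S f = continuous_on S g" using Suc.prems by (simp cong: continuous_on_cong)
  moreover have "f differentiable_on S \<longleftrightarrow> g differentiable_on S"
    unfolding differentiable_on_def differentiable_def
    using has_derivative_transform[of _ S f g] has_derivative_transform[of _ S g f] Suc.prems
    by (metis (full_types))
  moreover have "Ck_on k S (dir_deriv S v f) = Ck_on k S (dir_deriv S v g)" for v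
    by (rule Suc.IH) (rule dir_deriv_cong[OF Suc.prems])
  ultimately show ?case by simp
qed

lemma Ck_on_mono_Suc: "Ck_on (Suc k) S f \<Longrightarrow> Ck_on k S f"
  by (induction k arbitrary: f) auto

lemma Ck_on_continuous: "Ck_on k S f \<Longrightarrow> continuous_on S f"
  by (cases k) auto

lemma Ck_on_has_derivative:
  assumes "Ck_on (Suc k) S f" "z \<in> S"
  shows "(f has_derivative (\<lambda>v. dir_deriv S v f z)) (at z within S)"
  using assms by (auto simp: differentiable_on_def dir_deriv_def frechet_derivative_works)

lemma Ck_on_SucI:
  fixes f :: "'a::euclidean_space \<Rightarrow> 'b::real_normed_vector"
  assumes "axis_thick S"
    and "\<And>z. z \<in> S \<Longrightarrow> (f has_derivative f' z) (at z within S)"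
    and "\<And>v. Ck_on k S (\<lambda>z. f' z v)"
  shows "Ck_on (Suc k) S f"
proof -
  have d: "f differentiable_on S" using assms(2) by (auto simp: differentiable_on_def differentiable_def)
  moreover have "Ck_on k S (dir_deriv S v f)" for v
    using assms(3)[of v]
    by (subst Ck_on_cong[where g = "\<lambda>z. f' z v"]) (auto intro: dir_deriv_eq[OF assms(1) _ assms(2)])
  ultimately show ?thesis by (auto intro: differentiable_imp_continuous_on)
qed

lemma Ck_on_const:
  fixes S :: "'a::euclidean_space set"
  assumes "axis_thick S" shows "Ck_on k S (\<lambda>_. c)"
proof (induction k arbitrary: c)
  case (Suc k) then show ?case
    using assms by (intro Ck_on_SucI[where f' = "\<lambda>_ _. 0"]) (auto)
qed simp

lemma Ck_on_bounded_linear: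
  fixes f :: "'a::euclidean_space \<Rightarrow> 'b::real_normed_vector"
  assumes "axis_thick S" "bounded_linear L" "Ck_on k S f"
  shows "Ck_on k S (\<lambda>z. L (f z))"
  using assms(3)
proof (induction k arbitrary: f)
  case 0
  then show ?case using assms(2)
    by (simp add: bounded_linear.continuous_on)
next
  case (Suc k)
  show ?case
  proof (rule Ck_on_SucI[OF assms(1), where f' = "\<lambda>z v. L (dir_deriv S v f z)"])
    fix z assume "z \<in> S"
    then show "((\<lambda>z. L (f z)) has_derivative (\<lambda>v. L (dir_deriv S v f z))) (at z within S)"
      by (intro bounded_linear.has_derivative[OF assms(2)] Ck_on_has_derivative[OF Suc.prems])
  qed (use Suc in auto)
qed

lemma Ck_on_linear:
  fixes S :: "'a::euclidean_space set"
  assumes "axis_thick S" "bounded_linear L"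
  shows "Ck_on k S L"
proof (cases k)
  case 0 then show ?thesis using assms by (simp add: linear_continuous_on)
next
  case (Suc m)
  have "Ck_on (Suc m) S L"
    using assms by (intro Ck_on_SucI[where f' = "\<lambda>_. L"] Ck_on_const bounded_linear_imp_has_derivative)
  then show ?thesis using Suc by simp
qed

lemma Ck_on_add:
  fixes f g :: "'a::euclidean_space \<Rightarrow> 'b::real_normed_vector"
  assumes "axis_thick S" "Ck_on k S f" "Ck_on k S g"
  shows "Ck_on k S (\<lambda>z. f z + g z)"
  using assms(2,3)
proof (induction k arbitrary: f g)
  case 0 then show ?case by (simp add: continuous_on_add continuous_on_mult continuous_on_exp)
next
  case (Suc k)
  show ?case
  proof (rule Ck_on_SucI[OF assms(1), where f' = "\<lambda>z v. dir_deriv S v f z + dir_deriv S v g z"])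
    fix z assume "z \<in> S"
    then show "((\<lambda>z. f z + g z) has_derivative (\<lambda>v. dir_deriv S v f z + dir_deriv S v g z)) (at z within S)"
      by (intro has_derivative_add Ck_on_has_derivative[OF Suc.prems(1)] Ck_on_has_derivative[OF Suc.prems(2)])
  qed (use Suc in auto)
qed

lemma Ck_on_mult:
  fixes f g :: "'a::euclidean_space \<Rightarrow> real"
  assumes "axis_thick S" "Ck_on k S f" "Ck_on k S g"
  shows "Ck_on k S (\<lambda>z. f z * g z)"
  using assms(2,3)
proof (induction k arbitrary: f g)
  case 0 then show ?case by (simp add: continuous_on_add continuous_on_mult continuous_on_exp)
next
  case (Suc k)
  show ?case
  proof (rule Ck_on_SucI[OF assms(1), where f' = "\<lambda>z v. f z * dir_deriv S v g z + dir_deriv S v f z * g z"])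
    fix z assume "z \<in> S"
    then show "((\<lambda>z. f z * g z) has_derivative (\<lambda>v. f z * dir_deriv S v g z + dir_deriv S v f z * g z)) (at z within S)"
      by (intro has_derivative_mult Ck_on_has_derivative[OF Suc.prems(1)] Ck_on_has_derivative[OF Suc.prems(2)])
  next
    fix v
    show "Ck_on k S (\<lambda>z. f z * dir_deriv S v g z + dir_deriv S v f z * g z)"
      using Suc.prems Suc.prems[THEN Ck_on_mono_Suc] assms(1)
      by (intro Ck_on_add Suc.IH) auto
  qed
qed

lemma Ck_on_sum:
  fixes f :: "'i \<Rightarrow> 'a::euclidean_space \<Rightarrow> 'b::real_normed_vector"
  assumes "axis_thick S" "finite I" "\<And>i. i \<in> I \<Longrightarrow> Ck_on k S (f i)"
  shows "Ck_on k S (\<lambda>z. \<Sum>i\<in>I. f i z)"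
  using assms(2,3)
proof (induction I)
  case empty
  then show ?case by (simp only: sum.empty Ck_on_const[OF assms(1)])
next
  case (insert i I)
  have "Ck_on k S (\<lambda>z. f i z + (\<Sum>i\<in>I. f i z))"
    using insert by (intro Ck_on_add[OF assms(1)]) auto
  then show ?case using insert.hyps by simp
qed

lemma Ck_on_diff:
  fixes f g :: "'a::euclidean_space \<Rightarrow> 'b::real_normed_vector"
  assumes "axis_thick S" "Ck_on k S f" "Ck_on k S g"
  shows "Ck_on k S (\<lambda>z. f z - g z)"
  using Ck_on_add[OF assms(1,2) Ck_on_bounded_linear[OF assms(1) bounded_linear_minus[OF bounded_linear_ident] assms(3)]]
  by simp

lemma Ck_on_Pair:
  fixes f :: "'a::euclidean_space \<Rightarrow> 'b::real_normed_vector" and g :: "'a \<Rightarrow> 'c::real_normed_vector"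
  assumes "axis_thick S" "Ck_on k S f" "Ck_on k S g"
  shows "Ck_on k S (\<lambda>z. (f z, g z))"
proof -
  have "Ck_on k S (\<lambda>z. (f z, 0) + (0, g z))"
    using assms by (intro Ck_on_add Ck_on_bounded_linear[where L = "\<lambda>x. (x, 0)"]
        Ck_on_bounded_linear[where L = "\<lambda>x. (0, x)"] bounded_linear_Pair bounded_linear_ident bounded_linear_zero)
  then show ?thesis by simp
qed

text \<open>
  The chain rule expresses a directional derivative of f \<circ> h as a finite sum of products of a
  component of a derivative of h with a partial derivative of f composed with h, so the regularity
  of the composition follows by induction on k from that of products.
\<close>

lemma Ck_on_compose:
  fixes f :: "'b::euclidean_space \<Rightarrow> real" and h :: "'a::euclidean_space \<Rightarrow> 'b"
  assumes S: "axis_thick S" and T: "axis_thick T"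
    and f: "Ck_on k S f" and h: "Ck_on k T h" and sub: "h ` T \<subseteq> S"
  shows "Ck_on k T (\<lambda>z. f (h z))"
  using f h
proof (induction k arbitrary: f)
  case 0
  then show ?case using sub by (auto intro: continuous_on_compose2)
next
  case (Suc k)
  define D where "D z v = (\<Sum>i\<in>Basis. (dir_deriv T v h z \<bullet> i) * dir_deriv S i f (h z))" for z v
  show ?case
  proof (rule Ck_on_SucI[OF T, where f' = D])
    fix z assume z: "z \<in> T"
    then have hz: "h z \<in> S" using sub by auto
    have df: "(f has_derivative (\<lambda>v. dir_deriv S v f (h z))) (at (h z) within S)"
      by (rule Ck_on_has_derivative[OF Suc.prems(1) hz])
    have lin: "linear (\<lambda>v. dir_deriv S v f (h z))"
      using df has_derivative_linear by blast
    have 1: "((\<lambda>z. f (h z)) has_derivative (\<lambda>v. dir_deriv S (dir_deriv T v h z) f (h z))) (at z within T)"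
      using has_derivative_in_compose[OF Ck_on_has_derivative[OF Suc.prems(2) z]
          has_derivative_subset[OF df sub]] by simp
    have "dir_deriv S w f (h z) = (\<Sum>i\<in>Basis. (w \<bullet> i) * dir_deriv S i f (h z))" for w
    proof -
      have "dir_deriv S w f (h z) = dir_deriv S (\<Sum>i\<in>Basis. (w \<bullet> i) *\<^sub>R i) f (h z)"
        by (simp add: euclidean_representation)
      also have "\<dots> = (\<Sum>i\<in>Basis. (w \<bullet> i) * dir_deriv S i f (h z))"
        by (subst linear_sum[OF lin]) (simp add: linear_scale[OF lin])
      finally show ?thesis .
    qed
    then have "(\<lambda>v. dir_deriv S (dir_deriv T v h z) f (h z)) = D z"
      unfolding D_def by (intro ext)
    with 1 show "((\<lambda>z. f (h z)) has_derivative D z) (at z within T)" by simp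
  next
    fix v
    show "Ck_on k T (\<lambda>z. D z v)"
      unfolding D_def
    proof (intro Ck_on_sum Ck_on_mult T finite_Basis)
      fix i :: 'b assume "i \<in> Basis"
      show "Ck_on k T (\<lambda>z. dir_deriv T v h z \<bullet> i)"
        using Suc.prems(2) by (intro Ck_on_bounded_linear[OF T bounded_linear_inner_left]) auto
      show "Ck_on k T (\<lambda>z. dir_deriv S i f (h z))"
        using Suc.prems Ck_on_mono_Suc by (intro Suc.IH) auto
    qed
  qed
qed

lemma Ck_on_exp: "Ck_on k (UNIV :: real set) exp"
proof (induction k)
  case (Suc k)
  show ?case
    by (rule Ck_on_SucI[where f' = "\<lambda>z v. v * exp z"])
       (auto intro!: axis_thick_open Ck_on_mult Ck_on_const Suc derivative_eq_intros)
qed (simp add: continuous_on_add continuous_on_mult continuous_on_exp)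

lemma Ck_on_inverse: "Ck_on k ({0<..} :: real set) inverse"
proof (induction k)
  case (Suc k)
  have thick: "axis_thick ({0<..} :: real set)" by (rule axis_thick_open) simp
  show ?case
  proof (rule Ck_on_SucI[OF thick, where f' = "\<lambda>z v. (- v) * (inverse z * inverse z)"])
    show "Ck_on k {0<..} (\<lambda>z::real. (- v) * (inverse z * inverse z))" for v
      by (intro Ck_on_mult Ck_on_const Suc thick)
  qed (auto intro!: derivative_eq_intros)
qed (auto intro!: continuous_intros)

lemma Ck_on_ln: "Ck_on k ({0<..} :: real set) ln"
proof (cases k)
  case (Suc m)
  have thick: "axis_thick ({0<..} :: real set)" by (rule axis_thick_open) simp
  have "Ck_on (Suc m) ({0<..} :: real set) ln"
  proof (rule Ck_on_SucI[OF thick, where f' = "\<lambda>z v. v * inverse z"])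
    show "Ck_on m {0<..} (\<lambda>z::real. v * inverse z)" for v
      by (intro Ck_on_mult Ck_on_const Ck_on_inverse thick)
  qed (auto intro!: derivative_eq_intros simp: field_simps)
  then show ?thesis using Suc by simp
qed (auto intro!: continuous_intros)

lemma smooth_on_dir_deriv: "smooth_on S f \<Longrightarrow> smooth_on S (dir_deriv S v f)"
  unfolding smooth_on_def by (metis Ck_on.simps(2))

lemma smooth_on_has_derivative:
  assumes "smooth_on S f" "z \<in> S"
  shows "(f has_derivative (\<lambda>v. dir_deriv S v f z)) (at z within S)"
  using assms Ck_on_has_derivative unfolding smooth_on_def by blast

lemma smooth_on_continuous: "smooth_on S f \<Longrightarrow> continuous_on S f"
  using Ck_on_continuous unfolding smooth_on_def by blast

text \<open>
  A directional derivative within S is an ordinary derivative along any piece of the line through z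
  that stays in S; this turns the multivariate derivatives into one-variable calculus.
\<close>

lemma dir_deriv_partial:
  assumes "smooth_on S f" "z \<in> S" "\<And>t. t \<in> I \<Longrightarrow> z + (t - s) *\<^sub>R v \<in> S" "s \<in> I"
  shows "((\<lambda>t. f (z + (t - s) *\<^sub>R v)) has_vector_derivative dir_deriv S v f z) (at s within I)"
proof -
  have "((\<lambda>t. z + (t - s) *\<^sub>R v) has_derivative (\<lambda>h. h *\<^sub>R v)) (at s within I)"
    by (auto intro!: derivative_eq_intros)
  moreover have "(f has_derivative (\<lambda>w. dir_deriv S w f z)) (at (z + (s - s) *\<^sub>R v) within (\<lambda>t. z + (t - s) *\<^sub>R v) ` I)"
    using smooth_on_has_derivative[OF assms(1,2)] assms(3) by (auto intro: has_derivative_subset)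
  ultimately have "((\<lambda>t. f (z + (t - s) *\<^sub>R v)) has_derivative (\<lambda>h. dir_deriv S (h *\<^sub>R v) f z)) (at s within I)"
    by (rule has_derivative_in_compose)
  moreover have "dir_deriv S (h *\<^sub>R v) f z = h *\<^sub>R dir_deriv S v f z" for h
    using linear_scale[OF has_derivative_linear[OF smooth_on_has_derivative[OF assms(1,2)]]] .
  ultimately show ?thesis by (simp add: has_vector_derivative_def)
qed


section \<open>Hadamard's division by the boundary variable\<close>

text \<open>
  For i = 0 and g the derivative in the first variable of f, this is the smooth quotient
  (f (a, y) - f (0, y)) / a. The weights t^i make the family closed under differentiation.
\<close>

definition ray_mean :: "nat \<Rightarrow> (real \<times> real \<Rightarrow> real) \<Rightarrow> real \<times> real \<Rightarrow> real" where
  "ray_mean i g z = integral {0..1} (\<lambda>t. t ^ i * g (t * fst z, snd z))"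

text \<open>
  Differentiation under the integral sign turns a derivative of a mean into means of derivatives,
  where each derivative in the first variable costs one more factor t.
\<close>

lemma Ck_on_ray_mean:
  fixes S :: "(real \<times> real) set"
  assumes thick: "axis_thick S" and conv: "convex S"
    and star: "\<And>a y t. (a, y) \<in> S \<Longrightarrow> 0 \<le> t \<Longrightarrow> t \<le> 1 \<Longrightarrow> (t * a, y) \<in> S"
    and g: "Ck_on k S g"
  shows "Ck_on k S (ray_mean i g)"
  using g
proof (induction k arbitrary: i g)
  have cont: "continuous_on (S \<times> cbox 0 1) (\<lambda>(z, t). t ^ j * h (t * fst z, snd z))"
    if "continuous_on S h" for h :: "real \<times> real \<Rightarrow> real" and j
    unfolding case_prod_unfold
    by (intro continuous_intros continuous_on_compose2[OF that]) (auto intro: star)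
  {
    case 0
    then show ?case
      using integral_continuous_on_param[OF cont[of g i]] by (simp add: ray_mean_def[abs_def] case_prod_unfold)
  next
    case (Suc k)
    let ?g1 = "dir_deriv S (1, 0) g" and ?g2 = "dir_deriv S (0, 1) g"
    define D where "D z t = (t ^ Suc i * ?g1 (t * fst z, snd z)) *\<^sub>R Blinfun fst
        + (t ^ i * ?g2 (t * fst z, snd z)) *\<^sub>R (Blinfun snd :: (real \<times> real) \<Rightarrow>\<^sub>L real)"
      for z :: "real \<times> real" and t :: real
    have c12: "continuous_on S ?g1" "continuous_on S ?g2"
      using Suc.prems by (auto intro: Ck_on_continuous)
    have D_apply: "blinfun_apply (D z t) v =
        t ^ Suc i * ?g1 (t * fst z, snd z) * fst v + t ^ i * ?g2 (t * fst z, snd z) * snd v" for z t v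
      by (simp add: D_def blinfun.add_left blinfun.scaleR_left bounded_linear_Blinfun_apply
          bounded_linear_fst bounded_linear_snd)
    have lin: "dir_deriv S v g w = ?g1 w * fst v + ?g2 w * snd v" if "w \<in> S" for v w
    proof -
      have l: "linear (\<lambda>v. dir_deriv S v g w)"
        using Ck_on_has_derivative[OF Suc.prems that] has_derivative_linear by blast
      have "dir_deriv S v g w = dir_deriv S (fst v *\<^sub>R (1, 0) + snd v *\<^sub>R (0, 1)) g w" by simp
      also have "\<dots> = ?g1 w * fst v + ?g2 w * snd v"
        by (simp only: linear_add[OF l] linear_scale[OF l]) simp
      finally show ?thesis .
    qed
    have contD: "continuous_on (S \<times> cbox 0 1) (\<lambda>(z, t). D z t)"
      using cont[OF c12(1), of 0] cont[OF c12(2), of 0]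
      unfolding D_def case_prod_unfold by (intro continuous_intros) auto
    have contD1: "continuous_on {0..1} (D z)" if "z \<in> S" for z
    proof -
      have "continuous_on {0..1} (\<lambda>t. (\<lambda>(z, t). D z t) (z, t))"
        using that by (intro continuous_on_compose2[OF contD]) (auto intro!: continuous_intros)
      then show ?thesis by simp
    qed
    have integrable_h: "(\<lambda>t. t ^ j * h (t * fst z, snd z)) integrable_on {0..1}"
      if "continuous_on S h" "z \<in> S" for h :: "real \<times> real \<Rightarrow> real" and j z
    proof -
      have "continuous_on {0..1} (\<lambda>t. (\<lambda>(z, t). t ^ j * h (t * fst z, snd z)) (z, t))"
        using that(2) by (intro continuous_on_compose2[OF cont[OF that(1)]]) (auto intro!: continuous_intros)
      then show ?thesis by (intro integrable_continuous_interval) simp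
    qed
    have deriv: "(ray_mean i g has_derivative
        (\<lambda>v. ray_mean (Suc i) ?g1 z * fst v + ray_mean i ?g2 z * snd v)) (at z within S)"
      if z: "z \<in> S" for z
    proof -
      have "((\<lambda>z. integral (cbox 0 1) (\<lambda>t. t ^ i * g (t * fst z, snd z))) has_derivative
          integral (cbox 0 1) (D z)) (at z within S)"
      proof (rule leibniz_rule[OF _ _ contD z conv])
        fix w :: "real \<times> real" and t :: real assume w: "w \<in> S" and t: "t \<in> cbox 0 1"
        then have tw: "(t * fst w, snd w) \<in> S" using star[of "fst w" "snd w" t] by auto
        have h: "((\<lambda>w. (t * fst w, snd w)) has_derivative (\<lambda>v. (t * fst v, snd v))) (at w within S)"
          by (auto intro!: derivative_eq_intros)
        have "((\<lambda>w. g (t * fst w, snd w)) has_derivative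
            (\<lambda>v. dir_deriv S (t * fst v, snd v) g (t * fst w, snd w))) (at w within S)"
          using t star
          by (intro has_derivative_in_compose[OF h] has_derivative_subset[OF Ck_on_has_derivative[OF Suc.prems tw]])
             auto
        then have "((\<lambda>w. t ^ i * g (t * fst w, snd w)) has_derivative
            (\<lambda>v. t ^ i * dir_deriv S (t * fst v, snd v) g (t * fst w, snd w))) (at w within S)"
          by (rule has_derivative_mult_right)
        also have "(\<lambda>v. t ^ i * dir_deriv S (t * fst v, snd v) g (t * fst w, snd w)) = blinfun_apply (D w t)"
          by (rule ext, subst lin[OF tw]) (simp add: D_apply algebra_simps)
        finally show "((\<lambda>w. t ^ i * g (t * fst w, snd w)) has_derivative blinfun_apply (D w t)) (at w within S)" .
      next
        fix w assume "w \<in> S"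
        then show "(\<lambda>t. t ^ i * g (t * fst w, snd w)) integrable_on cbox 0 1"
          using integrable_h[of g w i] Suc.prems by (simp add: Ck_on_continuous)
      qed
      moreover have apply_eq: "blinfun_apply (integral (cbox 0 1) (D z)) v =
          ray_mean (Suc i) ?g1 z * fst v + ray_mean i ?g2 z * snd v" for v
      proof -
        have "blinfun_apply (integral (cbox 0 1) (D z)) v = integral (cbox 0 1) (\<lambda>t. blinfun_apply (D z t) v)"
          using integral_linear[OF integrable_continuous_interval[OF contD1[OF z]] blinfun.bounded_linear_left[of v]]
          by (simp add: o_def)
        also have "\<dots> = ray_mean (Suc i) ?g1 z * fst v + ray_mean i ?g2 z * snd v"
          unfolding D_apply ray_mean_def interval_cbox[symmetric]
          using integrable_h[OF c12(1) z, of "Suc i"] integrable_h[OF c12(2) z, of i]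
          by (subst integral_add) (auto intro: integrable_on_mult_left)
        finally show ?thesis .
      qed
      moreover have "blinfun_apply (integral (cbox 0 1) (D z)) =
          (\<lambda>v. ray_mean (Suc i) ?g1 z * fst v + ray_mean i ?g2 z * snd v)"
        by (rule ext) (rule apply_eq)
      ultimately show ?thesis unfolding ray_mean_def[abs_def] by simp
    qed
    show ?case
      using Suc.prems
      by (intro Ck_on_SucI[OF thick deriv] Ck_on_add Ck_on_mult Ck_on_const Suc.IH thick) auto
  }
qed

lemma smooth_on_ray_mean:
  assumes "axis_thick S" "convex S"
    and "\<And>a y t. (a, y) \<in> S \<Longrightarrow> 0 \<le> t \<Longrightarrow> t \<le> 1 \<Longrightarrow> (t * a, y) \<in> S" and "smooth_on S g"
  shows "smooth_on S (ray_mean i g)"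
  using assms Ck_on_ray_mean unfolding smooth_on_def by blast

lemma ray_mean_factor:
  assumes star: "\<And>t. 0 \<le> t \<Longrightarrow> t \<le> 1 \<Longrightarrow> (t * a, y) \<in> S"
    and g: "smooth_on S g"
  shows "g (a, y) = g (0, y) + a * ray_mean 0 (dir_deriv S (1, 0) g) (a, y)"
proof -
  let ?g1 = "dir_deriv S (1, 0) g"
  have "((\<lambda>t. g (t * a, y)) has_vector_derivative a * ?g1 (s * a, y)) (at s within {0..1})" if s: "s \<in> {0..1}" for s
  proof -
    have sa: "(s * a, y) \<in> S" using star s by auto
    have "((\<lambda>t. (t * a, y)) has_derivative (\<lambda>h. (h * a, 0))) (at s within {0..1})"
      by (auto intro!: derivative_eq_intros)
    moreover have "(g has_derivative (\<lambda>v. dir_deriv S v g (s * a, y))) (at (s * a, y) within (\<lambda>t. (t * a, y)) ` {0..1})"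
      using smooth_on_has_derivative[OF g sa] star by (auto intro: has_derivative_subset)
    ultimately have "((\<lambda>t. g (t * a, y)) has_derivative (\<lambda>h. dir_deriv S (h * a, 0) g (s * a, y))) (at s within {0..1})"
      by (rule has_derivative_in_compose)
    moreover have "dir_deriv S (h * a, 0) g (s * a, y) = h *\<^sub>R (a * ?g1 (s * a, y))" for h
      using linear_scale[OF has_derivative_linear[OF smooth_on_has_derivative[OF g sa]], of "h * a" "(1, 0)"]
      by simp
    ultimately show ?thesis by (simp add: has_vector_derivative_def)
  qed
  then have "((\<lambda>t. a * ?g1 (t * a, y)) has_integral g (1 * a, y) - g (0 * a, y)) {0..1}"
    by (intro fundamental_theorem_of_calculus) auto
  then have "integral {0..1} (\<lambda>t. a * ?g1 (t * a, y)) = g (1 * a, y) - g (0 * a, y)"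
    by (rule integral_unique)
  then show ?thesis by (simp add: ray_mean_def)
qed


section \<open>The implicit function theorem at a boundary point\<close>

lemma axis_thick_half_open: "axis_thick {0::real..<r}"
proof (cases "0 < r")
  case True
  then show ?thesis by (intro axis_thick_real_interval[of _ 0 "r/2"]) (auto simp: is_interval_1)
qed (auto simp: axis_thick_def)

lemma has_real_derivative_fst:
  assumes "smooth_on (A \<times> B) f" "a \<in> A" "y \<in> B"
  shows "((\<lambda>a. f (a, y)) has_real_derivative dir_deriv (A \<times> B) (1, 0) f (a, y)) (at a within A)"
  using dir_deriv_partial[OF assms(1), of "(a, y)" A a "(1, 0)"] assms(2,3)
  by (simp add: has_real_derivative_iff_has_vector_derivative)

lemma has_real_derivative_snd:
  assumes "smooth_on (A \<times> B) f" "a \<in> A" "y \<in> B"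
  shows "((\<lambda>y. f (a, y)) has_real_derivative dir_deriv (A \<times> B) (0, 1) f (a, y)) (at y within B)"
  using dir_deriv_partial[OF assms(1), of "(a, y)" B y "(0, 1)"] assms(2,3)
  by (simp add: has_real_derivative_iff_has_vector_derivative)

text \<open>
  The zero set is a graph because F increases in y near (0, y0) and changes sign there. The graph y
  is differentiable with derivative R (a, y a), where R is the smooth function minus the quotient of
  the partial derivatives of F, and this equation lifts y from class C^k to class C^(k+1).
\<close>

lemma smooth_implicit_function_at_boundary:
  fixes F :: "real \<times> real \<Rightarrow> real"
  assumes r0: "0 < r0" and d0: "0 < \<delta>0"
    and F: "smooth_on ({0..<r0} \<times> {y0 - \<delta>0<..<y0 + \<delta>0}) F"
    and zero: "F (0, y0) = 0"
    and derA: "((\<lambda>a. F (a, y0)) has_real_derivative A) (at 0 within {0..<r0})"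
    and derB: "((\<lambda>y. F (0, y)) has_real_derivative B) (at y0)"
    and B: "B > 0"
  obtains \<epsilon> \<delta> y where "0 < \<epsilon>" "\<epsilon> \<le> r0" "0 < \<delta>" "\<delta> \<le> \<delta>0"
    "smooth_on {0..<\<epsilon>} y" "y 0 = y0" "(y has_real_derivative - A / B) (at 0 within {0..<\<epsilon>})"
    "\<And>a. a \<in> {0..<\<epsilon>} \<Longrightarrow> y a \<in> {y0 - \<delta><..<y0 + \<delta>}"
    "\<And>a z. a \<in> {0..<\<epsilon>} \<Longrightarrow> z \<in> {y0 - \<delta><..<y0 + \<delta>} \<Longrightarrow> F (a, z) = 0 \<longleftrightarrow> z = y a"
proof -
  let ?I = "{0..<r0}" and ?J = "{y0 - \<delta>0<..<y0 + \<delta>0}"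
  let ?T = "?I \<times> ?J"
  let ?F1 = "dir_deriv ?T (1, 0) F" and ?F2 = "dir_deriv ?T (0, 1) F"
  have thick: "axis_thick ?T"
    by (intro axis_thick_Times axis_thick_half_open axis_thick_open) simp
  have dF1: "((\<lambda>a. F (a, z)) has_real_derivative ?F1 (a, z)) (at a within ?I)"
    if "a \<in> ?I" "z \<in> ?J" for a z by (rule has_real_derivative_fst[OF F that])
  have dF2: "((\<lambda>z. F (a, z)) has_real_derivative ?F2 (a, z)) (at z)"
    if "a \<in> ?I" "z \<in> ?J" for a z
    using has_real_derivative_snd[OF F that] that by (simp add: at_within_open[of _ ?J])
  have cF1: "continuous_on ?T ?F1" and cF2: "continuous_on ?T ?F2" and cF: "continuous_on ?T F"
    using F by (auto intro: smooth_on_continuous smooth_on_dir_deriv)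
  have y0: "y0 \<in> ?J" and z0: "0 \<in> ?I" using r0 d0 by auto
  have F1_0: "?F1 (0, y0) = A"
  proof (rule has_field_derivative_unique[OF dF1[OF z0 y0] derA])
    show "at (0::real) within {0..<r0} \<noteq> bot"
    proof -
      have "at (0::real) within {0..r0/2} \<le> at 0 within {0..<r0}"
        using r0 by (intro at_le) auto
      moreover have "at (0::real) within {0..r0/2} \<noteq> bot"
        using r0 by (simp add: at_within_Icc_at_right)
      ultimately show ?thesis by (metis bot.extremum_uniqueI)
    qed
  qed
  have F2_0: "?F2 (0, y0) = B" using dF2[OF z0 y0] derB by (rule DERIV_unique)
  have "\<exists>d>0. \<forall>w\<in>?T. dist w (0, y0) < d \<longrightarrow> dist (?F2 w) (?F2 (0, y0)) < B"
    using cF2 z0 y0 B unfolding continuous_on_iff by blast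
  then obtain d where d0': "d > 0" and dd: "\<forall>w\<in>?T. dist w (0, y0) < d \<longrightarrow> \<bar>?F2 w - B\<bar> < B"
    unfolding F2_0 dist_real_def by blast
  have d: "d > 0" "\<And>w. w \<in> ?T \<Longrightarrow> dist w (0, y0) < d \<Longrightarrow> ?F2 w > 0"
  proof -
    fix w assume "w \<in> ?T" "dist w (0, y0) < d"
    then have "\<bar>?F2 w - B\<bar> < B" using dd by blast
    then show "?F2 w > 0" by linarith
  qed (rule d0')
  define \<delta> where "\<delta> = min (d/2) (\<delta>0/2)"
  have \<delta>: "0 < \<delta>" "\<delta> \<le> d/2" "\<delta> < \<delta>0" using d d0 by (auto simp: \<delta>_def)
  define e1 where "e1 = min (d/2) r0"
  have pos: "?F2 (a, z) > 0" if "a \<in> {0..<e1}" "\<bar>z - y0\<bar> \<le> \<delta>" for a z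
  proof (rule d(2))
    show "(a, z) \<in> ?T" using that \<delta> by (auto simp: e1_def)
    have "dist (a, z) (0, y0) \<le> \<bar>a\<bar> + \<bar>z - y0\<bar>"
      by (simp add: dist_prod_def dist_real_def sqrt_sum_squares_le_sum_abs)
    then show "dist (a, z) (0, y0) < d" using that \<delta> by (auto simp: e1_def)
  qed
  have mono: "F (a, z) < F (a, z')" if "a \<in> {0..<e1}" "\<bar>z - y0\<bar> \<le> \<delta>" "\<bar>z' - y0\<bar> \<le> \<delta>" "z < z'" for a z z'
  proof (rule DERIV_pos_imp_increasing[OF that(4)])
    fix x assume x: "z \<le> x" "x \<le> z'"
    then have "\<bar>x - y0\<bar> \<le> \<delta>" using that by auto
    with that(1) \<delta> show "\<exists>l. DERIV (\<lambda>z. F (a, z)) x :> l \<and> 0 < l"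
      by (intro exI[of _ "?F2 (a, x)"] conjI dF2 pos) (auto simp: e1_def)
  qed
  have conta: "continuous_on ?I (\<lambda>a. F (a, z))" if "z \<in> ?J" for z
    using that by (intro continuous_on_compose2[OF cF]) (auto intro!: continuous_intros)
  have e1: "0 < e1" "e1 \<le> r0" using d r0 by (auto simp: e1_def)
  have near: "\<exists>e>0. \<forall>a\<in>?I. \<bar>a - b\<bar> < e \<longrightarrow> F (a, z) < 0" if nz: "b \<in> ?I" "z \<in> ?J" "F (b, z) < 0" for b z
  proof -
    have "\<bar>F (b, z)\<bar> > 0" using nz(3) by simp
    then obtain e where e: "e > 0" "\<forall>a\<in>?I. \<bar>a - b\<bar> < e \<longrightarrow> \<bar>F (a, z) - F (b, z)\<bar> < \<bar>F (b, z)\<bar>"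
      using conta[OF nz(2)] nz(1) unfolding continuous_on_iff dist_real_def by blast
    have "F (a, z) < 0" if "a \<in> ?I" "\<bar>a - b\<bar> < e" for a
    proof -
      have "\<bar>F (a, z) - F (b, z)\<bar> < \<bar>F (b, z)\<bar>" using e(2) that by blast
      then show ?thesis using \<open>F (b, z) < 0\<close> by linarith
    qed
    with e(1) show ?thesis by blast
  qed
  have near': "\<exists>e>0. \<forall>a\<in>?I. \<bar>a - b\<bar> < e \<longrightarrow> F (a, z) > 0" if nz: "b \<in> ?I" "z \<in> ?J" "F (b, z) > 0" for b z
  proof -
    have "\<bar>F (b, z)\<bar> > 0" using nz(3) by simp
    then obtain e where e: "e > 0" "\<forall>a\<in>?I. \<bar>a - b\<bar> < e \<longrightarrow> \<bar>F (a, z) - F (b, z)\<bar> < \<bar>F (b, z)\<bar>"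
      using conta[OF nz(2)] nz(1) unfolding continuous_on_iff dist_real_def by blast
    have "F (a, z) > 0" if "a \<in> ?I" "\<bar>a - b\<bar> < e" for a
    proof -
      have "\<bar>F (a, z) - F (b, z)\<bar> < \<bar>F (b, z)\<bar>" using e(2) that by blast
      then show ?thesis using \<open>F (b, z) > 0\<close> by linarith
    qed
    with e(1) show ?thesis by blast
  qed
  have "F (0, y0 - \<delta>) < 0" "F (0, y0 + \<delta>) > 0"
    using mono[of 0 "y0 - \<delta>" y0] mono[of 0 y0 "y0 + \<delta>"] \<delta> e1 zero by auto
  then obtain e2 e3 where e23: "e2 > 0" "e3 > 0"
    "\<And>a. a \<in> ?I \<Longrightarrow> \<bar>a\<bar> < e2 \<Longrightarrow> F (a, y0 - \<delta>) < 0"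
    "\<And>a. a \<in> ?I \<Longrightarrow> \<bar>a\<bar> < e3 \<Longrightarrow> F (a, y0 + \<delta>) > 0"
    using near[of 0 "y0 - \<delta>"] near'[of 0 "y0 + \<delta>"] \<delta> z0 by auto
  define \<epsilon> where "\<epsilon> = min e1 (min e2 e3)"
  have \<epsilon>: "0 < \<epsilon>" "\<epsilon> \<le> e1" "\<epsilon> \<le> r0" "\<epsilon> \<le> e2" "\<epsilon> \<le> e3" using e1 e23 by (auto simp: \<epsilon>_def)
  have ex: "\<exists>z. \<bar>z - y0\<bar> < \<delta> \<and> F (a, z) = 0" if a: "a \<in> {0..<\<epsilon>}" for a
  proof -
    have s: "F (a, y0 - \<delta>) < 0" "F (a, y0 + \<delta>) > 0" using e23(3,4) a \<epsilon> by auto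
    have "continuous_on {y0 - \<delta>..y0 + \<delta>} (\<lambda>z. F (a, z))"
      using a \<epsilon> \<delta> by (intro continuous_on_compose2[OF cF]) (auto intro!: continuous_intros)
    then obtain z where z: "y0 - \<delta> \<le> z" "z \<le> y0 + \<delta>" "F (a, z) = 0"
      using IVT'[of "\<lambda>z. F (a, z)" "y0 - \<delta>" 0 "y0 + \<delta>"] s \<delta> by auto
    then have "z \<noteq> y0 - \<delta>" "z \<noteq> y0 + \<delta>" using s by auto
    with z show ?thesis by (intro exI[of _ z]) auto
  qed
  then obtain y where y: "\<And>a. a \<in> {0..<\<epsilon>} \<Longrightarrow> \<bar>y a - y0\<bar> < \<delta>" "\<And>a. a \<in> {0..<\<epsilon>} \<Longrightarrow> F (a, y a) = 0"
    by metis
  have uniq: "F (a, z) = 0 \<longleftrightarrow> z = y a" if "a \<in> {0..<\<epsilon>}" "\<bar>z - y0\<bar> < \<delta>" for a z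
  proof
    assume "F (a, z) = 0"
    then show "z = y a"
      using mono[of a z "y a"] mono[of a "y a" z] y[OF that(1)] that \<epsilon> by (cases z "y a" rule: linorder_cases) auto
  qed (use y that in auto)
  have y_0: "y 0 = y0" using uniq[of 0 y0] zero \<epsilon> \<delta> by auto
  have cont_y: "(y \<longlongrightarrow> y b) (at b within {0..<\<epsilon>})" if b: "b \<in> {0..<\<epsilon>}" for b
  proof (rule tendstoI)
    fix \<eta> :: real assume "\<eta> > 0"
    define h where "h = min \<eta> ((\<delta> - \<bar>y b - y0\<bar>) / 2)"
    have h: "0 < h" "h \<le> \<eta>" "\<bar>y b - h - y0\<bar> < \<delta>" "\<bar>y b + h - y0\<bar> < \<delta>"
      using y(1)[OF b] \<open>\<eta> > 0\<close> by (auto simp: h_def min_def abs_if field_simps split: if_splits)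
    have "F (b, y b - h) < 0" "F (b, y b + h) > 0"
      using mono[of b "y b - h" "y b"] mono[of b "y b" "y b + h"] y[OF b] h b \<epsilon> by auto
    moreover have "b \<in> ?I" "y b - h \<in> ?J" "y b + h \<in> ?J" using h(3,4) \<delta>(3) b \<epsilon>(3) by auto
    ultimately obtain e e' where e: "e > 0" "e' > 0"
      "\<And>a. a \<in> ?I \<Longrightarrow> \<bar>a - b\<bar> < e \<Longrightarrow> F (a, y b - h) < 0"
      "\<And>a. a \<in> ?I \<Longrightarrow> \<bar>a - b\<bar> < e' \<Longrightarrow> F (a, y b + h) > 0"
      using near[of b "y b - h"] near'[of b "y b + h"] by blast
    have "dist (y a) (y b) < \<eta>" if a: "a \<in> {0..<\<epsilon>}" "dist a b < min e e'" for a
    proof -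
      have "F (a, y b - h) < F (a, y a)" "F (a, y a) < F (a, y b + h)"
        using e(3,4)[of a] a \<epsilon> y(2)[OF a(1)] by (auto simp: dist_real_def)
      moreover have "a \<in> {0..<e1}" "\<bar>y a - y0\<bar> \<le> \<delta>" "\<bar>y b - h - y0\<bar> \<le> \<delta>" "\<bar>y b + h - y0\<bar> \<le> \<delta>"
        using y(1)[OF a(1)] h a(1) \<epsilon> by auto
      ultimately have "\<not> y a < y b - h" "y a \<noteq> y b - h" "\<not> y b + h < y a" "y a \<noteq> y b + h"
        using mono[of a "y a" "y b - h"] mono[of a "y b + h" "y a"] by auto
      then have "y b - h < y a" "y a < y b + h" by linarith+
      then show ?thesis using h by (auto simp: dist_real_def)
    qed
    then show "\<forall>\<^sub>F a in at b within {0..<\<epsilon>}. dist (y a) (y b) < \<eta>"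
      unfolding eventually_at using e by (intro exI[of _ "min e e'"]) auto
  qed
  have der_y: "(y has_real_derivative - ?F1 (b, y b) / ?F2 (b, y b)) (at b within {0..<\<epsilon>})" if b: "b \<in> {0..<\<epsilon>}" for b
  proof -
    have bI: "b \<in> ?I" and ybJ: "y b \<in> ?J" using b \<epsilon> y(1)[OF b] \<delta> by auto
    \<comment> \<open>the mean value theorem in the second variable reduces the increment of y to one of F in a alone\<close>
    have "\<exists>\<xi>. (\<bar>\<xi> - y b\<bar> \<le> \<bar>y a - y b\<bar>) \<and> F (a, y a) - F (a, y b) = ?F2 (a, \<xi>) * (y a - y b) \<and> \<bar>\<xi> - y0\<bar> < \<delta>"
      if a: "a \<in> {0..<\<epsilon>}" for a
    proof -
      have *: "DERIV (\<lambda>z. F (a, z)) x :> ?F2 (a, x)" if "\<bar>x - y0\<bar> < \<delta>" for x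
        using that a \<epsilon> \<delta> by (intro dF2) auto
      show ?thesis
      proof (cases "y a" "y b" rule: linorder_cases)
        case less
        obtain \<xi> where "y a < \<xi>" "\<xi> < y b" "F (a, y b) - F (a, y a) = (y b - y a) * ?F2 (a, \<xi>)"
          using MVT2[OF less, of "\<lambda>z. F (a, z)" "\<lambda>x. ?F2 (a, x)"] * y(1)[OF a] y(1)[OF b] by fastforce
        then show ?thesis using y(1)[OF a] y(1)[OF b] by (intro exI[of _ \<xi>]) (auto simp: algebra_simps)
      next
        case equal
        then show ?thesis using y(1)[OF a] by (intro exI[of _ "y b"]) auto
      next
        case greater
        obtain \<xi> where "y b < \<xi>" "\<xi> < y a" "F (a, y a) - F (a, y b) = (y a - y b) * ?F2 (a, \<xi>)"
          using MVT2[OF greater, of "\<lambda>z. F (a, z)" "\<lambda>x. ?F2 (a, x)"] * y(1)[OF a] y(1)[OF b] by fastforce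
        then show ?thesis using y(1)[OF a] y(1)[OF b] by (intro exI[of _ \<xi>]) (auto simp: algebra_simps)
      qed
    qed
    then obtain \<xi> where \<xi>: "\<And>a. a \<in> {0..<\<epsilon>} \<Longrightarrow> \<bar>\<xi> a - y b\<bar> \<le> \<bar>y a - y b\<bar>"
      "\<And>a. a \<in> {0..<\<epsilon>} \<Longrightarrow> F (a, y a) - F (a, y b) = ?F2 (a, \<xi> a) * (y a - y b)"
      "\<And>a. a \<in> {0..<\<epsilon>} \<Longrightarrow> \<bar>\<xi> a - y0\<bar> < \<delta>" by metis
    have ev: "\<forall>\<^sub>F a in at b within {0..<\<epsilon>}. a \<in> {0..<\<epsilon>} \<and> a \<noteq> b"
      by (simp add: eventually_at_filter)
    have "((\<lambda>a. \<bar>y a - y b\<bar>) \<longlongrightarrow> 0) (at b within {0..<\<epsilon>})"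
      using cont_y[OF b] by (simp add: tendsto_rabs_zero LIM_zero)
    then have "((\<lambda>a. \<xi> a - y b) \<longlongrightarrow> 0) (at b within {0..<\<epsilon>})"
      by (rule Lim_null_comparison[rotated]) (use \<xi>(1) in \<open>auto simp: eventually_at_filter\<close>)
    then have lim_xi: "(\<xi> \<longlongrightarrow> y b) (at b within {0..<\<epsilon>})" by (rule LIM_zero_cancel)
    have "((\<lambda>a. ?F2 (a, \<xi> a)) \<longlongrightarrow> ?F2 (b, y b)) (at b within {0..<\<epsilon>})"
    proof (rule continuous_on_tendsto_compose[OF cF2])
      show "((\<lambda>a. (a, \<xi> a)) \<longlongrightarrow> (b, y b)) (at b within {0..<\<epsilon>})"
        by (intro tendsto_intros lim_xi)
      show "\<forall>\<^sub>F a in at b within {0..<\<epsilon>}. (a, \<xi> a) \<in> ?T"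
        using ev by eventually_elim (use \<xi>(3) \<epsilon> \<delta> in fastforce)
    qed (use bI ybJ in auto)
    moreover have "((\<lambda>a. (F (a, y b) - F (b, y b)) / (a - b)) \<longlongrightarrow> ?F1 (b, y b)) (at b within {0..<\<epsilon>})"
      using DERIV_subset[OF dF1[OF bI ybJ], of "{0..<\<epsilon>}"] \<epsilon> by (simp add: has_field_derivative_iff)
    moreover have "?F2 (b, y b) \<noteq> 0" using pos[of b "y b"] y(1)[OF b] b \<epsilon> by auto
    ultimately have "((\<lambda>a. - ((F (a, y b) - F (b, y b)) / (a - b)) / ?F2 (a, \<xi> a)) \<longlongrightarrow>
        - ?F1 (b, y b) / ?F2 (b, y b)) (at b within {0..<\<epsilon>})"
      by (intro tendsto_intros)
    then have "((\<lambda>a. (y a - y b) / (a - b)) \<longlongrightarrow> - ?F1 (b, y b) / ?F2 (b, y b)) (at b within {0..<\<epsilon>})"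
    proof (rule Lim_transform_eventually)
      show "\<forall>\<^sub>F a in at b within {0..<\<epsilon>}. - ((F (a, y b) - F (b, y b)) / (a - b)) / ?F2 (a, \<xi> a) = (y a - y b) / (a - b)"
        using ev
      proof eventually_elim
        case (elim a)
        then have "- F (a, y b) = ?F2 (a, \<xi> a) * (y a - y b)" "F (b, y b) = 0"
          using \<xi>(2)[of a] y(2)[of a] y(2)[OF b] by auto
        moreover have "?F2 (a, \<xi> a) \<noteq> 0" using pos[of a "\<xi> a"] \<xi>(3)[of a] elim \<epsilon> by auto
        ultimately show ?case using elim by (simp add: field_simps)
      qed
    qed
    then show ?thesis by (simp add: has_field_derivative_iff)
  qed
  \<comment> \<open>the box on which the derivative of F in the second variable is positive\<close>
  define U where "U = {0..<\<epsilon>} \<times> {y0 - \<delta><..<y0 + \<delta>}"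
  have thickU: "axis_thick U" unfolding U_def
    by (intro axis_thick_Times axis_thick_half_open axis_thick_open) simp
  have thickE: "axis_thick {0..<\<epsilon>}" by (rule axis_thick_half_open)
  have UT: "U \<subseteq> ?T" using \<epsilon> \<delta> by (auto simp: U_def)
  have Fk: "Ck_on k ?T ?F1" "Ck_on k ?T ?F2" for k
    using F smooth_on_dir_deriv unfolding smooth_on_def by blast+
  have restrict: "Ck_on k U g" if "Ck_on k ?T g" for k and g :: "real \<times> real \<Rightarrow> real"
    using Ck_on_compose[OF thick thickU that Ck_on_linear[OF thickU bounded_linear_ident]] UT by simp
  have quot: "Ck_on k U (\<lambda>w. - ?F1 w * inverse (?F2 w))" for k
  proof -
    have thick0: "axis_thick ({0<..} :: real set)" by (rule axis_thick_open) simp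
    have sub: "?F2 ` U \<subseteq> {0<..}"
    proof (rule image_subsetI)
      fix w assume "w \<in> U"
      then show "?F2 w \<in> {0<..}" using pos[of "fst w" "snd w"] \<epsilon> by (cases w) (auto simp: U_def)
    qed
    show ?thesis
      by (rule Ck_on_mult[OF thickU Ck_on_bounded_linear[OF thickU bounded_linear_minus[OF bounded_linear_ident]
            restrict[OF Fk(1)]] Ck_on_compose[OF thick0 thickU Ck_on_inverse restrict[OF Fk(2)] sub]])
  qed
  have smooth_y: "Ck_on k {0..<\<epsilon>} y" for k
  proof (induction k)
    case 0
    then show ?case using cont_y by (simp add: continuous_on_def)
  next
    case (Suc k)
    have pair: "Ck_on k {0..<\<epsilon>} (\<lambda>a. (a, y a))"
      by (intro Ck_on_Pair thickE Suc Ck_on_linear bounded_linear_ident)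
    have sub: "(\<lambda>a. (a, y a)) ` {0..<\<epsilon>} \<subseteq> U"
    proof safe
      fix a assume "a \<in> {0..<\<epsilon>}"
      then show "(a, y a) \<in> U" using y(1)[of a] by (auto simp: U_def)
    qed
    show ?case
    proof (rule Ck_on_SucI[OF thickE])
      fix a assume "a \<in> {0..<\<epsilon>}"
      from der_y[OF this] show "(y has_derivative (\<lambda>v. v * (- ?F1 (a, y a) * inverse (?F2 (a, y a))))) (at a within {0..<\<epsilon>})"
        unfolding has_field_derivative_def
        by (rule has_derivative_eq_rhs) (auto simp: fun_eq_iff divide_inverse)
    next
      fix v
      show "Ck_on k {0..<\<epsilon>} (\<lambda>a. v * (- ?F1 (a, y a) * inverse (?F2 (a, y a))))"
        by (intro Ck_on_mult Ck_on_const thickE Ck_on_compose[OF thickU thickE quot pair sub])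
    qed
  qed
  show ?thesis
  proof (rule that[of \<epsilon> \<delta> y])
    show "(y has_real_derivative - A / B) (at 0 within {0..<\<epsilon>})"
      using der_y[of 0] \<epsilon> by (simp add: y_0 F1_0 F2_0)
    show "smooth_on {0..<\<epsilon>} y" using smooth_y by (simp add: smooth_on_def)
    show "y a \<in> {y0 - \<delta><..<y0 + \<delta>}" if "a \<in> {0..<\<epsilon>}" for a using y(1)[OF that] by auto
    show "F (a, z) = 0 \<longleftrightarrow> z = y a" if "a \<in> {0..<\<epsilon>}" "z \<in> {y0 - \<delta><..<y0 + \<delta>}" for a z
      by (rule uniq[OF that(1)]) (use that(2) in auto)
  qed (use \<epsilon> \<delta> y_0 in auto)
qed

section \<open>Integrals over the line from antiderivatives\<close>

lemma antiderivative_tendsto_integral: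
  fixes f G :: "real \<Rightarrow> real"
  assumes int: "integrable lborel f" and cont: "\<And>x. isCont f x"
    and der: "\<And>x. (G has_real_derivative f x) (at x)"
    and X: "filterlim X at_top sequentially" and Y: "filterlim Y at_bot sequentially"
  shows "(\<lambda>n. G (X n) - G (Y n)) \<longlonglongrightarrow> (LINT x|lborel. f x)"
proof -
  have "(\<lambda>n. LINT x|lborel. f x * indicator {Y n..X n} x) \<longlonglongrightarrow> (LINT x|lborel. f x)"
  proof (rule integral_dominated_convergence)
    show "integrable lborel (\<lambda>x. norm (f x))" using int by simp
    show "(\<lambda>x. f x * indicator {Y n..X n} x) \<in> borel_measurable lborel" for n
      using int by auto
    show "AE x in lborel. (\<lambda>n. f x * indicator {Y n..X n} x) \<longlonglongrightarrow> f x"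
    proof (rule AE_I2)
      fix x
      have "\<forall>\<^sub>F n in sequentially. x \<le> X n" "\<forall>\<^sub>F n in sequentially. Y n \<le> x"
        using X Y by (auto simp: filterlim_at_top filterlim_at_bot)
      then have "\<forall>\<^sub>F n in sequentially. f x * indicator {Y n..X n} x = f x"
        by eventually_elim auto
      then show "(\<lambda>n. f x * indicator {Y n..X n} x) \<longlonglongrightarrow> f x" by (rule tendsto_eventually)
    qed
  qed (use int in \<open>auto split: split_indicator\<close>)
  then show ?thesis
  proof (rule Lim_transform_eventually)
    have "\<forall>\<^sub>F n in sequentially. 0 \<le> X n" "\<forall>\<^sub>F n in sequentially. Y n \<le> 0"
      using X Y by (auto simp: filterlim_at_top filterlim_at_bot)
    then show "\<forall>\<^sub>F n in sequentially. (LINT x|lborel. f x * indicator {Y n..X n} x) = G (X n) - G (Y n)"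
      by eventually_elim (auto simp: integral_FTC_Icc_real[OF _ der cont])
  qed
qed

lemma integrable_bounded_antiderivative:
  fixes f G :: "real \<Rightarrow> real"
  assumes nonneg: "\<And>x. 0 \<le> f x" and cont: "\<And>x. isCont f x"
    and der: "\<And>x. (G has_real_derivative f x) (at x)"
    and bound: "\<And>x. \<bar>G x\<bar> \<le> M"
  shows "integrable lborel f"
proof -
  define s where "s i x = f x * indicator {- real i..real i} x" for i :: nat and x
  have int: "(LINT x|lborel. s i x) = G (real i) - G (- real i)" for i
    unfolding s_def by (rule integral_FTC_Icc_real[OF _ der cont]) simp
  have mono: "G x \<le> G y" if "x \<le> y" for x y
    using that by (rule DERIV_nonneg_imp_nondecreasing) (use der nonneg in blast)
  have "incseq (\<lambda>i. G (real i) - G (- real i))"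
    by (intro incseq_SucI diff_mono mono) auto
  moreover have "G (real i) - G (- real i) \<le> 2 * M" for i
    using bound[of "real i"] bound[of "- real i"] by linarith
  ultimately obtain L where L: "(\<lambda>i. G (real i) - G (- real i)) \<longlonglongrightarrow> L"
    using incseq_convergent by blast
  show ?thesis
  proof (rule integrable_monotone_convergence)
    show "integrable lborel (s i)" for i
      using has_bochner_integral_FTC_Icc_real[OF _ der cont, of "- real i" "real i"]
      unfolding s_def by (auto simp: has_bochner_integral_iff)
    show "AE x in lborel. mono (\<lambda>n. s n x)"
      using nonneg by (intro AE_I2) (auto simp: s_def mono_def split: split_indicator)
    show "AE x in lborel. (\<lambda>i. s i x) \<longlonglongrightarrow> f x"
    proof (rule AE_I2)
      fix x
      have "\<forall>\<^sub>F n in sequentially. \<bar>x\<bar> \<le> real n"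
        using filterlim_real_sequentially by (auto simp: filterlim_at_top)
      then have "\<forall>\<^sub>F n in sequentially. s n x = f x"
      proof eventually_elim
        case (elim n)
        then have "x \<in> {- real n..real n}" by auto
        then show ?case by (simp add: s_def)
      qed
      then show "(\<lambda>n. s n x) \<longlonglongrightarrow> f x" by (rule tendsto_eventually)
    qed
    show "(\<lambda>i. LINT x|lborel. s i x) \<longlonglongrightarrow> L" using L by (simp add: int)
    have "continuous_on UNIV f" using cont by (simp add: continuous_on_eq_continuous_at)
    then show "f \<in> borel_measurable lborel" by (simp add: borel_measurable_continuous_onI)
  qed
qed

lemma integrable_inverse_one_plus_square:
  fixes a :: real
  assumes "a > 0"
  shows "integrable lborel (\<lambda>x. 1 / (1 + (a * x)\<^sup>2))"
proof (rule integrable_bounded_antiderivative)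
  fix x :: real
  have pos: "1 + (a * x)\<^sup>2 > 0" by (rule add_pos_nonneg) auto
  show "0 \<le> 1 / (1 + (a * x)\<^sup>2)" using pos by simp
  show "isCont (\<lambda>x. 1 / (1 + (a * x)\<^sup>2)) x" using pos by (intro continuous_intros) auto
  show "((\<lambda>x. arctan (a * x) / a) has_real_derivative 1 / (1 + (a * x)\<^sup>2)) (at x)"
  proof -
    have "((\<lambda>x. arctan (a * x) / a) has_real_derivative inverse (1 + (a * x)\<^sup>2) * a / a) (at x)"
      by (auto intro!: derivative_eq_intros)
    then show ?thesis using assms by (simp add: inverse_eq_divide)
  qed
  show "\<bar>arctan (a * x) / a\<bar> \<le> pi / 2 / a"
    using assms arctan_bounded[of "a * x"] by (auto simp: abs_le_iff field_simps)
qed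

lemma exp_minus_abs_le: "exp (- \<bar>x\<bar>) \<le> 2 / (1 + (1 * x)\<^sup>2)" for x :: real
proof -
  have "(1 + x\<^sup>2) / 2 \<le> 1 + \<bar>x\<bar> + \<bar>x\<bar>\<^sup>2 / 2" by simp
  also have "\<dots> \<le> exp \<bar>x\<bar>" using exp_lower_Taylor_quadratic[of "\<bar>x\<bar>"] by simp
  finally have "(1 + x\<^sup>2) / 2 \<le> exp \<bar>x\<bar>" .
  moreover have "1 + x\<^sup>2 > 0" by (rule add_pos_nonneg) auto
  ultimately show ?thesis by (simp add: exp_minus field_simps)
qed

text \<open>
  The comparison with 1 / (1 + x^2) reduces integrability to the bounded antiderivative arctan.
\<close>

lemma integrable_exp_decay:
  fixes f :: "real \<Rightarrow> real"
  assumes cont: "\<And>x. isCont f x" and bound: "\<And>x. \<bar>f x\<bar> \<le> C * exp (- \<bar>x\<bar>)"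
  shows "integrable lborel f"
proof (rule Bochner_Integration.integrable_bound)
  have "0 \<le> C" using bound[of 0] by auto
  show "integrable lborel (\<lambda>x. C * (2 * (1 / (1 + (1 * x)\<^sup>2))))"
    by (intro integrable_mult_right integrable_inverse_one_plus_square) simp
  have "continuous_on UNIV f" using cont by (simp add: continuous_on_eq_continuous_at)
  then show "f \<in> borel_measurable lborel" by (simp add: borel_measurable_continuous_onI)
  show "AE x in lborel. norm (f x) \<le> norm (C * (2 * (1 / (1 + (1 * x)\<^sup>2))))"
  proof (rule AE_I2)
    fix x
    have "norm (f x) \<le> C * exp (- \<bar>x\<bar>)" using bound[of x] by simp
    also have "\<dots> \<le> C * (2 / (1 + (1 * x)\<^sup>2))"
      by (intro mult_left_mono exp_minus_abs_le \<open>0 \<le> C\<close>)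
    also have "\<dots> \<le> norm (C * (2 * (1 / (1 + (1 * x)\<^sup>2))))" using \<open>0 \<le> C\<close> by simp
    finally show "norm (f x) \<le> norm (C * (2 * (1 / (1 + (1 * x)\<^sup>2))))" .
  qed
qed

lemma antiderivative_exists:
  fixes f :: "real \<Rightarrow> real"
  assumes "\<And>x. isCont f x"
  obtains G where "G 0 = 0" "\<And>x. (G has_real_derivative f x) (at x)"
proof -
  obtain F where F: "\<And>x. (F has_vector_derivative f x) (at x)"
    using einterval_antiderivative[of "-\<infinity>" "\<infinity>" f] assms by auto
  show ?thesis
    by (rule that[of "\<lambda>x. F x - F 0"])
       (auto intro!: derivative_eq_intros F[folded has_real_derivative_iff_has_vector_derivative])
qed

section \<open>The soliton\<close>

lemma DERIV_powr_times:
  assumes "(v has_real_derivative v1) (at x)" "v x > (0::real)"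
  shows "((\<lambda>x. v x powr p * v x) has_real_derivative (p + 1) * v x powr p * v1) (at x)"
    "((\<lambda>x. v x powr p * (v x)\<^sup>2) has_real_derivative (p + 2) * (v x powr p * v x * v1)) (at x)"
  using assms by (auto intro!: derivative_eq_intros simp: powr_diff field_simps power2_eq_square)

text \<open>
  Closed forms of the first three derivatives of the soliton. The second and third are those that
  the equation Q'' = Q - Q^(p+1) prescribes.
\<close>

definition soliton1 :: "real \<Rightarrow> real \<Rightarrow> real" where
  "soliton1 p x = - tanh (p * x / 2) * soliton p x"

definition soliton2 :: "real \<Rightarrow> real \<Rightarrow> real" where
  "soliton2 p x = soliton p x - soliton p x powr p * soliton p x"

definition soliton3 :: "real \<Rightarrow> real \<Rightarrow> real" where
  "soliton3 p x = soliton1 p x - (p + 1) * soliton p x powr p * soliton1 p x"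

lemma soliton_pos: "p > 0 \<Longrightarrow> soliton p x > 0"
  by (simp add: soliton_def)

lemma sech_square: "(1 / cosh (x::real))\<^sup>2 = 1 - (tanh x)\<^sup>2"
proof -
  have "1 + (sinh x)\<^sup>2 > 0" by (rule add_pos_nonneg) auto
  then show ?thesis by (simp add: tanh_def power_divide cosh_square_eq field_simps)
qed

text \<open>
  The nonlinear coefficient Q^p is a polynomial in tanh; this makes the soliton equation and its
  first integral polynomial identities.
\<close>

lemma soliton_powr:
  assumes "p > 0"
  shows "soliton p x powr p = (p + 2) / 2 * (1 - (tanh (p * x / 2))\<^sup>2)"
proof -
  have "(1 / cosh (p * x / 2)) powr 2 = (1 / cosh (p * x / 2))\<^sup>2"
    by (rule powr_numeral) simp
  then have "soliton p x powr p = (p + 2) / 2 * (1 / cosh (p * x / 2))\<^sup>2"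
    using assms by (simp add: soliton_def powr_mult powr_powr)
  then show ?thesis by (simp only: sech_square)
qed

lemma DERIV_soliton:
  assumes "p > 0"
  shows "(soliton p has_real_derivative soliton1 p x) (at x)"
proof -
  have "(1 / cosh (p * x / 2)) powr ((2 - p) / p) = cosh (p * x / 2) * (1 / cosh (p * x / 2)) powr (2 / p)"
    using powr_diff[of "1 / cosh (p * x / 2)" "2 / p" 1] assms by (simp add: diff_divide_distrib)
  then have "((\<lambda>x. ((p + 2) / 2) powr (1 / p) * (1 / cosh (p * x / 2)) powr (2 / p)) has_real_derivative soliton1 p x) (at x)"
    using assms
    by (auto intro!: derivative_eq_intros simp: soliton1_def soliton_def tanh_def powr_diff field_simps)
  then show ?thesis by (simp add: soliton_def[abs_def])
qed

lemma DERIV_soliton1: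
  assumes "p > 0"
  shows "(soliton1 p has_real_derivative soliton2 p x) (at x)"
proof -
  have "((\<lambda>x. - tanh (p * x / 2) * soliton p x) has_real_derivative
      - ((1 - (tanh (p * x / 2))\<^sup>2) * (p / 2)) * soliton p x + - tanh (p * x / 2) * soliton1 p x) (at x)"
    by (auto intro!: derivative_eq_intros DERIV_soliton[OF assms])
  also have "- ((1 - (tanh (p * x / 2))\<^sup>2) * (p / 2)) * soliton p x + - tanh (p * x / 2) * soliton1 p x = soliton2 p x"
    by (simp add: soliton2_def soliton_powr[OF assms] soliton1_def power2_eq_square field_simps)
  finally show ?thesis by (simp add: soliton1_def[abs_def])
qed

lemma DERIV_soliton2:
  assumes "p > 0"
  shows "(soliton2 p has_real_derivative soliton3 p x) (at x)"
proof -
  have pos: "soliton p x > 0" using soliton_pos[OF assms] .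
  have "((\<lambda>x. soliton p x - soliton p x powr p * soliton p x) has_real_derivative soliton3 p x) (at x)"
    using pos assms
    by (auto intro!: derivative_eq_intros DERIV_soliton[OF assms] simp: soliton3_def powr_diff field_simps)
  then show ?thesis by (simp add: soliton2_def[abs_def])
qed

lemma deriv_soliton:
  assumes "p > 0"
  shows "deriv (soliton p) = soliton1 p" "deriv (soliton1 p) = soliton2 p"
  using DERIV_soliton[OF assms] DERIV_soliton1[OF assms] by (auto intro!: ext DERIV_imp_deriv)

lemma isCont_soliton:
  assumes "p > 0"
  shows "isCont (soliton p) x" "isCont (soliton1 p) x" "isCont (soliton2 p) x"
  using assms DERIV_soliton DERIV_soliton1 DERIV_soliton2 DERIV_isCont by blast+

lemma soliton1_square:
  assumes "p > 0"
  shows "(soliton1 p x)\<^sup>2 = (soliton p x)\<^sup>2 - 2 / (p + 2) * (soliton p x powr p * (soliton p x)\<^sup>2)"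
  using assms by (simp add: soliton1_def soliton_powr field_simps power2_eq_square)

lemma soliton_even: "soliton p (- x) = soliton p x"
  by (simp add: soliton_def)

lemma soliton1_le:
  assumes "p > 0"
  shows "\<bar>soliton1 p x\<bar> \<le> soliton p x"
proof -
  have "\<bar>tanh (p * x / 2)\<bar> \<le> 1" using tanh_real_bounds[of "p * x / 2"] by (auto simp: abs_le_iff)
  then show ?thesis using soliton_pos[OF assms, of x]
    by (simp add: soliton1_def abs_mult mult_left_le_one_le)
qed

lemma soliton_powr_bounds:
  assumes "p > 0"
  shows "0 \<le> soliton p x powr p" "soliton p x powr p \<le> (p + 2) / 2"
proof -
  have "(tanh (p * x / 2))\<^sup>2 \<le> 1"
    using tanh_real_bounds[of "p * x / 2"] by (simp add: abs_square_le_1 abs_le_iff)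
  then show "0 \<le> soliton p x powr p" "soliton p x powr p \<le> (p + 2) / 2"
    using assms by (auto simp: soliton_powr intro!: mult_left_le)
qed

lemma soliton2_le:
  assumes "p > 0"
  shows "\<bar>soliton2 p x\<bar> \<le> (p + 2) * soliton p x"
proof -
  have "soliton2 p x = (1 - soliton p x powr p) * soliton p x" by (simp add: soliton2_def algebra_simps)
  moreover have "\<bar>1 - soliton p x powr p\<bar> \<le> p + 2"
  proof -
    have "\<bar>1 - t\<bar> \<le> p + 2" if "0 \<le> t" "t \<le> (p + 2) / 2" for t
      using that assms by (auto simp: abs_le_iff field_simps)
    then show ?thesis using soliton_powr_bounds[OF assms, of x] by blast
  qed
  ultimately show ?thesis using soliton_pos[OF assms, of x] by (simp add: abs_mult)
qed

definition soliton_const :: "real \<Rightarrow> real" where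
  "soliton_const p = ((p + 2) / 2) powr (1 / p) * 2 powr (2 / p)"

lemma soliton_decay:
  assumes "p > 0"
  shows "soliton p x \<le> soliton_const p * exp (- \<bar>x\<bar>)"
proof -
  have "exp \<bar>p * x / 2\<bar> \<le> 2 * cosh (p * x / 2)"
    by (cases "0 \<le> p * x / 2") (auto simp: cosh_def)
  then have "1 / cosh (p * x / 2) \<le> 2 * exp (- \<bar>p * x / 2\<bar>)"
    by (simp add: exp_minus field_simps)
  then have "(1 / cosh (p * x / 2)) powr (2 / p) \<le> (2 * exp (- \<bar>p * x / 2\<bar>)) powr (2 / p)"
    using assms by (intro powr_mono2) auto
  also have "\<dots> = 2 powr (2 / p) * exp (- \<bar>x\<bar>)"
    using assms by (simp add: powr_mult exp_powr_real abs_mult)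
  finally show ?thesis
    by (simp add: soliton_def soliton_const_def mult_left_mono mult.assoc)
qed

lemma soliton_const_pos: "p > 0 \<Longrightarrow> soliton_const p > 0"
  by (simp add: soliton_const_def)

lemma soliton_const_ge: "p > 0 \<Longrightarrow> soliton p x \<le> soliton_const p"
  using soliton_decay[of p x] soliton_const_pos[of p] by (smt (verit) mult_left_le exp_le_one_iff abs_ge_zero)

lemma integrable_soliton:
  assumes p: "p > 0"
  shows "integrable lborel (soliton p)" "integrable lborel (\<lambda>x. (soliton p x)\<^sup>2)"
    "integrable lborel (\<lambda>x. (soliton1 p x)\<^sup>2)" "integrable lborel (soliton1 p)"
proof -
  note pos = soliton_pos[OF p] and c = isCont_soliton[OF p]
  have sq: "(soliton p x)\<^sup>2 \<le> (soliton_const p)\<^sup>2 * exp (- \<bar>x\<bar>)" for x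
    using mult_mono[OF soliton_decay[OF p, of x] soliton_const_ge[OF p, of x]] pos[of x]
      soliton_const_pos[OF p] by (simp add: power2_eq_square mult_ac)
  have sq1: "(soliton1 p x)\<^sup>2 \<le> (soliton p x)\<^sup>2" for x
    using power_mono[OF soliton1_le[OF p, of x], of 2] by simp
  show "integrable lborel (soliton p)"
    using soliton_decay[OF p] less_imp_le[OF pos] by (intro integrable_exp_decay[OF c(1)]) auto
  show "integrable lborel (\<lambda>x. (soliton p x)\<^sup>2)"
    using sq by (intro integrable_exp_decay continuous_intros c) auto
  show "integrable lborel (\<lambda>x. (soliton1 p x)\<^sup>2)"
    using order_trans[OF sq1 sq] by (intro integrable_exp_decay continuous_intros c) auto
  show "integrable lborel (soliton1 p)"
    using order_trans[OF soliton1_le[OF p] soliton_decay[OF p]] by (intro integrable_exp_decay[OF c(2)]) auto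
qed

lemma soliton_tendsto:
  assumes p: "p > 0"
  shows "(soliton p \<longlongrightarrow> 0) at_top" "(soliton p \<longlongrightarrow> 0) at_bot"
proof -
  have 1: "((\<lambda>x::real. soliton_const p * exp (- \<bar>x\<bar>)) \<longlongrightarrow> 0) at_top" by real_asymp
  have 2: "((\<lambda>x::real. soliton_const p * exp (- \<bar>x\<bar>)) \<longlongrightarrow> 0) at_bot" by real_asymp
  show "(soliton p \<longlongrightarrow> 0) at_top" "(soliton p \<longlongrightarrow> 0) at_bot"
    using soliton_decay[OF p] less_imp_le[OF soliton_pos[OF p]]
    by (auto intro!: tendsto_sandwich[OF _ _ tendsto_const 1] tendsto_sandwich[OF _ _ tendsto_const 2])
qed

text \<open>
  Multiply the soliton equation by Q and eliminate Q^(p+2) by the first integral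
  (\<open>soliton1_square\<close>).
\<close>

lemma soliton_virial_density:
  assumes p: "p > 0"
  shows "((\<lambda>x. soliton p x * soliton1 p x) has_real_derivative
           (p + 4) / 2 * (soliton1 p x)\<^sup>2 - p / 2 * (soliton p x)\<^sup>2) (at x)"
proof -
  have "((\<lambda>x. soliton p x * soliton1 p x) has_real_derivative
           soliton1 p x * soliton1 p x + soliton p x * soliton2 p x) (at x)"
    by (auto intro!: derivative_eq_intros DERIV_soliton DERIV_soliton1 p)
  also have "soliton1 p x * soliton1 p x + soliton p x * soliton2 p x =
      (p + 4) / 2 * (soliton1 p x)\<^sup>2 - p / 2 * (soliton p x)\<^sup>2"
  proof -
    have "soliton p x powr p * (soliton p x)\<^sup>2 = (p + 2) / 2 * ((soliton p x)\<^sup>2 - (soliton1 p x)\<^sup>2)"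
      using soliton1_square[OF p, of x] p by (simp add: field_simps)
    then show ?thesis by (simp add: soliton2_def power2_eq_square field_simps)
  qed
  finally show ?thesis .
qed

lemma soliton_virial_limits:
  assumes p: "p > 0"
  shows "((\<lambda>x. soliton p x * soliton1 p x) \<longlongrightarrow> 0) at_top"
    "((\<lambda>x. soliton p x * soliton1 p x) \<longlongrightarrow> 0) at_bot"
proof -
  have "norm (soliton1 p x) \<le> soliton p x" for x using soliton1_le[OF p] by simp
  then have "(soliton1 p \<longlongrightarrow> 0) at_top" "(soliton1 p \<longlongrightarrow> 0) at_bot"
    using soliton_tendsto[OF p] by (intro Lim_null_comparison[of "soliton1 p" "soliton p"] always_eventually; simp)+
  then show "((\<lambda>x. soliton p x * soliton1 p x) \<longlongrightarrow> 0) at_top"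
    "((\<lambda>x. soliton p x * soliton1 p x) \<longlongrightarrow> 0) at_bot"
    using soliton_tendsto[OF p] tendsto_mult_zero by blast+
qed

lemma lborel_integral_vanishing_antiderivative:
  fixes f G :: "real \<Rightarrow> real"
  assumes "integrable lborel f" "\<And>x. isCont f x" "\<And>x. (G has_real_derivative f x) (at x)"
    and "(G \<longlongrightarrow> r) at_top" "(G \<longlongrightarrow> l) at_bot"
  shows "(LINT x|lborel. f x) = r - l"
proof (rule LIMSEQ_unique)
  have X: "filterlim (\<lambda>n. real n) at_top sequentially" by (rule filterlim_real_sequentially)
  then have Y: "filterlim (\<lambda>n. - real n) at_bot sequentially"
    by (simp add: filterlim_uminus_at_top)
  show "(\<lambda>n. G (real n) - G (- real n)) \<longlonglongrightarrow> (LINT x|lborel. f x)"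
    by (rule antiderivative_tendsto_integral[OF assms(1-3) X Y])
  show "(\<lambda>n. G (real n) - G (- real n)) \<longlonglongrightarrow> r - l"
    by (intro tendsto_diff filterlim_compose[OF assms(4) X] filterlim_compose[OF assms(5) Y])
qed

lemma soliton_virial:
  assumes p: "p > 0"
  shows "(p + 4) * (LINT x|lborel. (soliton1 p x)\<^sup>2) = p * (LINT x|lborel. (soliton p x)\<^sup>2)"
proof -
  have "(LINT x|lborel. (p + 4) / 2 * (soliton1 p x)\<^sup>2 - p / 2 * (soliton p x)\<^sup>2) = 0 - 0"
    by (rule lborel_integral_vanishing_antiderivative[OF _ _ soliton_virial_density[OF p]])
       (intro Bochner_Integration.integrable_diff integrable_mult_right continuous_intros isCont_soliton
          integrable_soliton p soliton_virial_limits)+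
  then show ?thesis
    using integrable_soliton[OF p] by (simp add: field_simps)
qed

text \<open>
  For p = 4 the energy density is a multiple of the density in \<open>soliton_virial_density\<close>.
\<close>

lemma soliton_energy:
  "has_bochner_integral lborel (energy_density 4 (soliton 4)) 0"
proof -
  have e: "energy_density 4 (soliton 4) x = ((4 + 4) / 2 * (soliton1 4 x)\<^sup>2 - 4 / 2 * (soliton 4 x)\<^sup>2) / 4" for x
  proof -
    have "\<bar>soliton 4 x\<bar> powr (4 + 2) = soliton 4 x powr 4 * (soliton 4 x)\<^sup>2"
      using soliton_pos[of 4 x] by (subst powr_add) auto
    also have "\<dots> = 3 * ((soliton 4 x)\<^sup>2 - (soliton1 4 x)\<^sup>2)"
      using soliton1_square[of 4 x] by simp
    finally have "\<bar>soliton 4 x\<bar> powr (4 + 2) = 3 * ((soliton 4 x)\<^sup>2 - (soliton1 4 x)\<^sup>2)" .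
    then show ?thesis unfolding energy_density_def by (simp add: deriv_soliton field_simps)
  qed
  have "integrable lborel (\<lambda>x. ((4 + 4) / 2 * (soliton1 4 x)\<^sup>2 - 4 / 2 * (soliton 4 x)\<^sup>2) / 4)"
    by (intro Bochner_Integration.integrable_diff integrable_mult_right integrable_divide integrable_soliton) auto
  moreover have "(LINT x|lborel. ((4 + 4) / 2 * (soliton1 4 x)\<^sup>2 - 4 / 2 * (soliton 4 x)\<^sup>2) / 4) = 0"
    using soliton_virial[of 4] integrable_soliton[of 4] by simp
  ultimately show ?thesis unfolding has_bochner_integral_iff e[abs_def] by simp
qed

section \<open>The slope of the curve in terms of the Gamma function\<close>

text \<open>
  The logistic substitution t = 1 / (1 + exp (- 2 c x)) satisfies t' = 2 c t (1 - t) and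
  4 t (1 - t) = sech (c x)^2, so it carries the integral to a symmetric Beta integral over (0, 1).
\<close>

lemma integral_sech_powr:
  fixes s c :: real
  assumes s: "s > 0" and c: "c > 0"
    and int: "integrable lborel (\<lambda>x. (1 / cosh (c * x)) powr s)"
  shows "(LINT x|lborel. (1 / cosh (c * x)) powr s) = 2 powr (s - 1) / c * Beta (s / 2) (s / 2)"
proof -
  define \<beta> where "\<beta> t = t powr (s / 2 - 1) * (1 - t) powr (s / 2 - 1)" for t :: real
  have B: "(\<beta> has_integral Beta (s / 2) (s / 2)) {0..1}"
    unfolding \<beta>_def[abs_def] using has_integral_Beta_real[of "s / 2" "s / 2"] s by simp
  then have \<beta>_int: "\<beta> integrable_on {0..1}" by (rule has_integral_integrable)
  define J where "J \<tau> = integral {0..\<tau>} \<beta>" for \<tau>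
  have J_cont: "continuous_on {0..1} J"
    unfolding J_def[abs_def] by (rule indefinite_integral_continuous_1[OF \<beta>_int])
  have J0: "J 0 = 0" and J1: "J 1 = Beta (s / 2) (s / 2)"
    using B by (auto simp: J_def integral_unique)
  have J_der: "(J has_real_derivative \<beta> t) (at t)" if t: "0 < t" "t < 1" for t
  proof -
    have "continuous (at t within ({0..1} - {})) \<beta>"
      unfolding \<beta>_def[abs_def] using t by (intro continuous_intros) auto
    then have "(J has_vector_derivative \<beta> t) (at t within ({0..1} - {}))"
      unfolding J_def[abs_def] using t by (intro integral_has_vector_derivative_continuous_at[OF \<beta>_int]) auto
    then have "(J has_real_derivative \<beta> t) (at t within {0..1})"
      by (simp add: has_real_derivative_iff_has_vector_derivative)
    then have "(J has_real_derivative \<beta> t) (at t within {0<..<1})"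
      by (rule DERIV_subset) auto
    then show ?thesis using t by (simp add: at_within_open[of t "{0<..<1}"])
  qed
  define T where "T x = 1 / (1 + exp (- 2 * c * x))" for x
  have T01: "0 < T x" "T x < 1" for x by (auto simp: T_def add_pos_pos)
  have T_der: "(T has_real_derivative 2 * c * (T x * (1 - T x))) (at x)" for x
  proof -
    have "1 + exp (- 2 * c * x) \<noteq> 0" using exp_gt_zero[of "- 2 * c * x"] by linarith
    then show ?thesis
      unfolding T_def[abs_def] by (auto intro!: derivative_eq_intros simp: field_simps power2_eq_square)
  qed
  have T_cosh: "T x * (1 - T x) = (1 / cosh (c * x))\<^sup>2 / 4" for x
  proof -
    let ?E = "exp (c * x)"
    have E: "exp (- 2 * c * x) = 1 / ?E\<^sup>2" "exp (- (c * x)) = 1 / ?E" and pos: "?E > 0"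
      by (auto simp: exp_minus exp_double[symmetric] field_simps simp flip: exp_add)
    have w: "1 + ?E\<^sup>2 > 0" by (rule add_pos_nonneg) auto
    have T: "T x = ?E\<^sup>2 / (1 + ?E\<^sup>2)" unfolding T_def E(1) using pos w by (simp add: field_simps)
    have "1 - T x = 1 / (1 + ?E\<^sup>2)" unfolding T using w by (simp add: field_simps)
    moreover have "cosh (c * x) = (1 + ?E\<^sup>2) / (2 * ?E)"
      unfolding cosh_field_def E(2) using pos by (simp add: field_simps power2_eq_square)
    ultimately show ?thesis using pos w by (simp add: T power2_eq_square)
  qed
  have der: "((\<lambda>x. J (T x)) has_real_derivative c * 2 powr (1 - s) * (1 / cosh (c * x)) powr s) (at x)" for x
  proof -
    have "((\<lambda>x. J (T x)) has_real_derivative \<beta> (T x) * (2 * c * (T x * (1 - T x)))) (at x)"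
      using DERIV_chain[OF J_der[OF T01] T_der] by (simp add: o_def)
    also have "\<beta> (T x) * (2 * c * (T x * (1 - T x))) = 2 * c * (T x * (1 - T x)) powr (s / 2)"
      using T01[of x] by (simp add: \<beta>_def powr_mult[symmetric] powr_diff)
    also have "(T x * (1 - T x)) powr (s / 2) = ((1 / cosh (c * x) / 2) powr 2) powr (s / 2)"
      unfolding T_cosh by (subst powr_numeral) (auto simp: power_divide)
    also have "\<dots> = (1 / cosh (c * x)) powr s / 2 powr s"
      by (simp only: powr_powr) (simp add: powr_divide powr_mult)
    finally show ?thesis by (simp add: powr_diff field_simps)
  qed
  have "(LINT x|lborel. c * 2 powr (1 - s) * (1 / cosh (c * x)) powr s) = J 1 - J 0"
  proof (rule lborel_integral_vanishing_antiderivative[OF _ _ der])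
    have T_top: "(T \<longlongrightarrow> 1) at_top" and T_bot: "(T \<longlongrightarrow> 0) at_bot"
      unfolding T_def[abs_def] using c by real_asymp+
    show "((\<lambda>x. J (T x)) \<longlongrightarrow> J 1) at_top" "((\<lambda>x. J (T x)) \<longlongrightarrow> J 0) at_bot"
      using less_imp_le[OF T01(1)] less_imp_le[OF T01(2)]
      by (auto intro!: continuous_on_tendsto_compose[OF J_cont T_top] continuous_on_tendsto_compose[OF J_cont T_bot])
    show "isCont (\<lambda>x. c * 2 powr (1 - s) * (1 / cosh (c * x)) powr s) x" for x
      by (intro continuous_intros) auto
  qed (use int in simp)
  then have "c * 2 powr (1 - s) * (LINT x|lborel. (1 / cosh (c * x)) powr s) = Beta (s / 2) (s / 2)"
    by (simp add: J0 J1)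
  then show ?thesis using c by (simp add: powr_diff field_simps)
qed

lemma soliton4_norms:
  "(L1_norm (soliton 4))\<^sup>2 = sqrt 3 / (8 * pi) * Gamma (1/4) ^ 4"
  "(L2_norm (soliton 4))\<^sup>2 = sqrt 3 * pi / 2"
proof -
  have s4: "soliton 4 x = 3 powr (1/4) * (1 / cosh (2 * x)) powr (1/2)" for x
    by (simp add: soliton_def)
  have s4sq: "(soliton 4 x)\<^sup>2 = sqrt 3 * (1 / cosh (2 * x)) powr 1" for x
  proof -
    have "(3 powr (1/4))\<^sup>2 = sqrt (3::real)" by (simp add: powr_half_sqrt[symmetric] power2_eq_square flip: powr_add)
    moreover have "((1 / cosh (2 * x)) powr (1/2))\<^sup>2 = (1 / cosh (2 * x)) powr 1"
      by (simp add: power2_eq_square flip: powr_add)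
    ultimately show ?thesis by (simp only: s4 power_mult_distrib)
  qed
  have i1: "integrable lborel (\<lambda>x::real. (1 / cosh (2 * x)) powr (1/2))"
    using integrable_soliton(1)[of 4] by (simp add: s4[abs_def])
  have i2: "integrable lborel (\<lambda>x::real. (1 / cosh (2 * x)) powr 1)"
  proof -
    have "integrable lborel (\<lambda>x. 1 / sqrt 3 * (soliton 4 x)\<^sup>2)"
      by (intro integrable_mult_right integrable_soliton) simp
    then show ?thesis unfolding s4sq by simp
  qed
  have "L1_norm (soliton 4) = (LINT x|lborel. soliton 4 x)"
    unfolding L1_norm_def using soliton_pos[of 4] by (intro Bochner_Integration.integral_cong) (auto simp: abs_of_pos)
  also have "\<dots> = 3 powr (1/4) * (LINT x|lborel. (1 / cosh (2 * x)) powr (1/2))"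
    unfolding s4 by simp
  also have "\<dots> = 3 powr (1/4) * (2 powr (1/2 - 1) / 2 * Beta (1/4) (1/4))"
    using integral_sech_powr[of "1/2" 2, OF _ _ i1] by simp
  also have "\<dots> = 3 powr (1/4) * 2 powr (- 1/2) / 2 * (Gamma (1/4))\<^sup>2 / sqrt pi"
    by (simp add: Beta_def Gamma_one_half_real power2_eq_square)
  finally have L1: "L1_norm (soliton 4) = 3 powr (1/4) * 2 powr (- 1/2) / 2 * (Gamma (1/4))\<^sup>2 / sqrt pi" .
  have a: "(3 powr (1/4))\<^sup>2 = sqrt (3::real)" by (simp add: powr_half_sqrt[symmetric] power2_eq_square flip: powr_add)
  have b: "(2 powr (- 1/2))\<^sup>2 = 1 / (2::real)" by (simp add: power2_eq_square powr_minus_divide flip: powr_add)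
  show "(L1_norm (soliton 4))\<^sup>2 = sqrt 3 / (8 * pi) * Gamma (1/4) ^ 4"
    unfolding L1 power_mult_distrib power_divide a b by (simp flip: power_mult)
  have "(L2_norm (soliton 4))\<^sup>2 = (LINT x|lborel. (soliton 4 x)\<^sup>2)"
    unfolding L2_norm_def by simp
  also have "\<dots> = sqrt 3 * (LINT x|lborel. (1 / cosh (2 * x)) powr 1)"
    unfolding s4sq by (rule integral_mult_right_zero)
  also have "\<dots> = sqrt 3 * (2 powr (1 - 1) / 2 * Beta (1/2) (1/2))"
    by (subst integral_sech_powr[OF _ _ i2]) auto
  also have "\<dots> = sqrt 3 * pi / 2"
    by (simp add: Beta_def Gamma_one_half_real)
  finally show "(L2_norm (soliton 4))\<^sup>2 = sqrt 3 * pi / 2" .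
qed

lemma soliton4_norm_ratio:
  "(L1_norm (soliton 4))\<^sup>2 / (L2_norm (soliton 4))\<^sup>2 = Gamma (1/4) ^ 4 / (4 * pi\<^sup>2)"
  unfolding soliton4_norms by (simp add: field_simps power2_eq_square)

section \<open>Relaxation of bounded solutions of a perturbed linear equation\<close>

text \<open>
  The second order necessary condition at an interior maximum, for the comparison argument below.
\<close>

lemma second_derivative_at_max_nonpos:
  fixes g g1 :: "real \<Rightarrow> real"
  assumes xy: "x < y" "y < z"
    and der: "\<And>t. x \<le> t \<Longrightarrow> t \<le> z \<Longrightarrow> (g has_real_derivative g1 t) (at t)"
    and der2: "(g1 has_real_derivative d) (at y)"
    and max: "\<And>t. x \<le> t \<Longrightarrow> t \<le> z \<Longrightarrow> g t \<le> g y"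
  shows "d \<le> 0"
proof (rule ccontr)
  assume "\<not> d \<le> 0"
  then have d: "d > 0" by simp
  define m where "m = min (y - x) (z - y)"
  have m: "m > 0" using xy by (simp add: m_def)
  have "g1 y = 0"
    by (rule DERIV_local_max[OF der[of y] m]) (use xy max in \<open>auto simp: m_def abs_less_iff\<close>)
  obtain e where e: "e > 0" "\<And>h. 0 < h \<Longrightarrow> h < e \<Longrightarrow> g1 y < g1 (y + h)"
    using DERIV_pos_inc_right[OF der2 d] by blast
  define h where "h = min (e / 2) (m / 2)"
  have h0: "0 < h" "h < e" using e m by (auto simp: h_def)
  have "h \<le> m / 2" "m \<le> z - y" by (simp_all only: h_def m_def min.cobounded2)
  with h0 m have h: "0 < h" "h < e" "y + h \<le> z" by auto
  have "g y < g (y + h)"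
  proof (rule DERIV_pos_imp_increasing_open[of y "y + h" g])
    fix t :: real assume t: "y < t" "t < y + h"
    have "0 < g1 t" using e(2)[of "t - y"] t h \<open>g1 y = 0\<close> by simp
    moreover have "(g has_real_derivative g1 t) (at t)" using t xy h by (intro der) auto
    ultimately show "\<exists>l. (g has_real_derivative l) (at t) \<and> 0 < l" by blast
  next
    show "continuous_on {y..y + h} g"
      using xy h by (intro continuous_at_imp_continuous_on ballI DERIV_isCont[OF der]) auto
  qed (use h in simp)
  moreover have "g (y + h) \<le> g y" using xy h by (intro max) auto
  ultimately show False by simp
qed

text \<open>
  Maximum principle: the comparison function \<eta> + K cosh (x - y) / cosh M dominates \<psi> at the ends
  of the interval, and at a positive interior maximum of the difference the differential inequality
  would give a positive second derivative.
\<close>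

lemma exponential_relaxation_upper:
  fixes \<psi> \<psi>1 \<psi>2 :: "real \<Rightarrow> real"
  assumes der: "\<And>x. (\<psi> has_real_derivative \<psi>1 x) (at x)" "\<And>x. (\<psi>1 has_real_derivative \<psi>2 x) (at x)"
    and M: "M > 0" and K: "K \<ge> 0" and \<eta>: "\<eta> \<ge> 0"
    and near: "\<And>x. \<bar>x - y\<bar> \<le> M \<Longrightarrow> \<psi> x - \<eta> \<le> \<psi>2 x"
    and bound: "\<And>x. \<bar>x - y\<bar> \<le> M \<Longrightarrow> \<psi> x \<le> K"
  shows "\<psi> y \<le> \<eta> + K / cosh M"
proof -
  define k where "k = K / cosh M"
  have k: "k \<ge> 0" using K by (simp add: k_def)
  define \<theta> where "\<theta> x = \<psi> x - \<eta> - k * cosh (x - y)" for x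
  define \<theta>1 where "\<theta>1 x = \<psi>1 x - k * sinh (x - y)" for x
  have d1: "(\<theta> has_real_derivative \<theta>1 x) (at x)" for x
    unfolding \<theta>_def[abs_def] \<theta>1_def by (auto intro!: derivative_eq_intros der)
  have d2: "(\<theta>1 has_real_derivative \<psi>2 x - k * cosh (x - y)) (at x)" for x
    unfolding \<theta>1_def[abs_def] by (auto intro!: derivative_eq_intros der)
  have "continuous_on {y - M..y + M} \<theta>"
    by (intro continuous_at_imp_continuous_on ballI DERIV_isCont[OF d1])
  then obtain z where z: "z \<in> {y - M..y + M}" "\<And>x. x \<in> {y - M..y + M} \<Longrightarrow> \<theta> x \<le> \<theta> z"
    using continuous_attains_sup[of "{y - M..y + M}" \<theta>] M by auto
  have "\<theta> z \<le> 0"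
  proof (cases "z = y - M \<or> z = y + M")
    case True
    then have "cosh (z - y) = cosh M" by auto
    then have "k * cosh (z - y) = k * cosh M" by (rule arg_cong)
    also have "\<dots> = K" by (simp add: k_def)
    finally have "k * cosh (z - y) = K" .
    moreover have "\<psi> z \<le> K" using z(1) by (intro bound) auto
    ultimately show ?thesis using \<eta> by (simp add: \<theta>_def)
  next
    case False
    then have "y - M < z" "z < y + M" using z(1) by auto
    then have "\<psi>2 z - k * cosh (z - y) \<le> 0"
      by (rule second_derivative_at_max_nonpos[OF _ _ d1 d2]) (use z(2) in auto)
    moreover have "\<psi> z - \<eta> \<le> \<psi>2 z" using z(1) by (intro near) auto
    ultimately show ?thesis by (simp add: \<theta>_def)
  qed
  then have "\<theta> y \<le> 0" using z(2)[of y] M by auto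
  then show ?thesis by (simp add: \<theta>_def k_def)
qed

text \<open>
  A bounded function that nearly solves \<psi>'' = \<psi> on a long interval is small, with its first two
  derivatives, in the middle of it: the growing and the decaying exponential can only be felt near
  the ends. The first derivative is controlled by the mean value theorem on a unit interval, which
  is why M is lowered by 1 in the bound.
\<close>

lemma exponential_relaxation:
  fixes \<psi> \<psi>1 \<psi>2 :: "real \<Rightarrow> real"
  assumes der: "\<And>x. (\<psi> has_real_derivative \<psi>1 x) (at x)" "\<And>x. (\<psi>1 has_real_derivative \<psi>2 x) (at x)"
    and M: "M > 1" and K: "K \<ge> 0" and \<eta>: "\<eta> \<ge> 0"
    and near: "\<And>x. \<bar>x - y\<bar> \<le> M \<Longrightarrow> \<bar>\<psi>2 x - \<psi> x\<bar> \<le> \<eta>"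
    and bound: "\<And>x. \<bar>x - y\<bar> \<le> M \<Longrightarrow> \<bar>\<psi> x\<bar> \<le> K"
  shows "\<bar>\<psi> y\<bar> \<le> 4 * (\<eta> + K / cosh (M - 1))" "\<bar>\<psi>1 y\<bar> \<le> 4 * (\<eta> + K / cosh (M - 1))"
    "\<bar>\<psi>2 y\<bar> \<le> 4 * (\<eta> + K / cosh (M - 1))"
proof -
  define \<kappa> where "\<kappa> = K / cosh (M - 1)"
  have \<kappa>: "0 \<le> \<kappa>" using K by (simp add: \<kappa>_def)
  have small: "\<bar>\<psi> x\<bar> \<le> \<eta> + \<kappa>" if x: "\<bar>x - y\<bar> \<le> 1" for x
  proof -
    have "\<psi> x \<le> \<eta> + K / cosh (M - 1)"
    proof (rule exponential_relaxation_upper[OF der _ K \<eta>])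
      fix t assume "\<bar>t - x\<bar> \<le> M - 1"
      then have t: "\<bar>t - y\<bar> \<le> M" using x by linarith
      show "\<psi> t - \<eta> \<le> \<psi>2 t" "\<psi> t \<le> K" using near[OF t] bound[OF t] by auto
    qed (use M in simp)
    moreover have "- \<psi> x \<le> \<eta> + K / cosh (M - 1)"
    proof (rule exponential_relaxation_upper[OF DERIV_minus[OF der(1)] DERIV_minus[OF der(2)] _ K \<eta>])
      fix t assume "\<bar>t - x\<bar> \<le> M - 1"
      then have t: "\<bar>t - y\<bar> \<le> M" using x by linarith
      show "- \<psi> t - \<eta> \<le> - \<psi>2 t" "- \<psi> t \<le> K" using near[OF t] bound[OF t] by auto
    qed (use M in simp)
    ultimately show ?thesis by (simp add: \<kappa>_def abs_le_iff)
  qed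
  have small2: "\<bar>\<psi>2 x\<bar> \<le> 2 * \<eta> + \<kappa>" if x: "\<bar>x - y\<bar> \<le> 1" for x
    using near[of x] small[OF x] x M by auto
  obtain \<xi> where \<xi>: "y < \<xi>" "\<xi> < y + 1" "\<psi> (y + 1) - \<psi> y = (y + 1 - y) * \<psi>1 \<xi>"
    using MVT2[of y "y + 1" \<psi> \<psi>1] der(1) by auto
  obtain \<zeta> where \<zeta>: "y < \<zeta>" "\<zeta> < \<xi>" "\<psi>1 \<xi> - \<psi>1 y = (\<xi> - y) * \<psi>2 \<zeta>"
    using MVT2[of y \<xi> \<psi>1 \<psi>2] der(2) \<xi>(1) by auto
  have "\<bar>(\<xi> - y) * \<psi>2 \<zeta>\<bar> \<le> 1 * \<bar>\<psi>2 \<zeta>\<bar>"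
    unfolding abs_mult using \<xi> by (intro mult_right_mono) auto
  moreover have "\<bar>\<psi>2 \<zeta>\<bar> \<le> 2 * \<eta> + \<kappa>" using \<xi> \<zeta> by (intro small2) auto
  ultimately have "\<bar>\<psi>1 y\<bar> \<le> \<bar>\<psi> (y + 1)\<bar> + \<bar>\<psi> y\<bar> + (2 * \<eta> + \<kappa>)"
    using \<xi>(3) \<zeta>(3) by simp
  with small[of y] small[of "y + 1"] have "\<bar>\<psi>1 y\<bar> \<le> 4 * (\<eta> + \<kappa>)" using \<kappa> \<eta> by simp
  then show "\<bar>\<psi>1 y\<bar> \<le> 4 * (\<eta> + K / cosh (M - 1))" by (simp add: \<kappa>_def)
  show "\<bar>\<psi> y\<bar> \<le> 4 * (\<eta> + K / cosh (M - 1))" "\<bar>\<psi>2 y\<bar> \<le> 4 * (\<eta> + K / cosh (M - 1))"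
    using small[of y] small2[of y] \<kappa> \<eta> unfolding \<kappa>_def[symmetric] by auto
qed

section \<open>Expansion of the multiplier\<close>

lemma antiderivative_difference_le:
  fixes F G f g :: "real \<Rightarrow> real"
  assumes "\<And>x. (F has_real_derivative f x) (at x)" "\<And>x. (G has_real_derivative g x) (at x)"
    and "F 0 = 0" "G 0 = 0" and bound: "\<And>x. \<bar>f x - g x\<bar> \<le> d"
  shows "\<bar>F x - G x\<bar> \<le> d * \<bar>x\<bar>"
proof -
  have "norm ((F x - G x) - (F 0 - G 0)) \<le> d * norm (x - 0)"
  proof (rule field_differentiable_bound[where S = UNIV and f' = "\<lambda>x. f x - g x"])
    show "((\<lambda>x. F x - G x) has_field_derivative f z - g z) (at z within UNIV)" for z
      by (intro DERIV_diff assms)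
  qed (use bound in auto)
  then show ?thesis using assms(3,4) by simp
qed

lemma powr_times_self_lipschitz:
  fixes s t M p :: real
  assumes p: "p > 0" and st: "0 < s" "0 < t" "s \<le> M" "t \<le> M"
  shows "\<bar>s powr p * s - t powr p * t\<bar> \<le> (p + 1) * M powr p * \<bar>s - t\<bar>"
proof -
  have "norm (s powr p * s - t powr p * t) \<le> (p + 1) * M powr p * norm (s - t)"
  proof (rule field_differentiable_bound[where S = "{0<..M}" and f' = "\<lambda>x. (p + 1) * x powr p"])
    fix z assume z: "z \<in> {0<..M}"
    then show "((\<lambda>x. x powr p * x) has_field_derivative (p + 1) * z powr p) (at z within {0<..M})"
      by (auto intro!: derivative_eq_intros simp: powr_diff field_simps)
    show "norm ((p + 1) * z powr p) \<le> (p + 1) * M powr p"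
      using z p by (auto simp: abs_mult intro!: powr_mono2)
  qed (use st in auto)
  then show ?thesis by simp
qed

text \<open>
  A sequence of solutions of the forced equation that lies within O(a) of the soliton as a \<rightarrow> 0; c is
  the coefficient of the forcing term. The choice a = \<alpha> / (n + 1)^4, together with the cut-off
  X = n + 1, gives the two scale separations used throughout: a X \<rightarrow> 0 and exp (- X) / a \<rightarrow> 0.
\<close>

locale soliton_perturbation =
  fixes p \<gamma> \<alpha> C :: real and a c :: "nat \<Rightarrow> real" and u u1 u2 u3 :: "nat \<Rightarrow> real \<Rightarrow> real"
  assumes p: "p > 0" and \<alpha>: "\<alpha> > 0"
    and a_eq: "\<And>n. a n = \<alpha> / (real n + 1) ^ 4"
    and der: "\<And>n x. (u n has_real_derivative u1 n x) (at x)"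
      "\<And>n x. (u1 n has_real_derivative u2 n x) (at x)"
      "\<And>n x. (u2 n has_real_derivative u3 n x) (at x)"
    and pos: "\<And>n x. u n x > 0"
    and eq: "\<And>n x. a n * ((1 + \<gamma>) * u n x + x * u1 n x) - u3 n x + u1 n x
        - (p + 1) * u n x powr p * u1 n x + c n * soliton2 p x = 0"
    and close: "\<And>n x. \<bar>u n x - soliton p x\<bar> \<le> C * a n"
    and close2: "\<And>n. \<bar>u2 n 0 - soliton2 p 0\<bar> \<le> C * a n"
    and c_le: "\<And>n. \<bar>c n\<bar> \<le> C * a n"
begin

abbreviation "Q \<equiv> soliton p"
abbreviation "Q1 \<equiv> soliton1 p"
abbreviation "Q2 \<equiv> soliton2 p"
abbreviation "c\<^sub>Q \<equiv> soliton_const p"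
abbreviation "q \<equiv> (LINT x|lborel. soliton p x)"
abbreviation "mass \<equiv> (LINT x|lborel. (soliton p x)\<^sup>2)"
abbreviation "grad \<equiv> (LINT x|lborel. (soliton1 p x)\<^sup>2)"

definition X :: "nat \<Rightarrow> real" where "X n = real n + 1"

lemma a_pos: "a n > 0" using \<alpha> by (simp add: a_eq)

lemma C_nonneg: "C \<ge> 0"
  using c_le[of 0] a_pos[of 0] by (smt (verit) mult_neg_pos abs_ge_zero)

lemma a_le: "a n \<le> \<alpha>"
proof -
  have "1 \<le> (real n + 1) ^ 4" by (rule one_le_power) simp
  then show ?thesis using \<alpha> by (simp add: a_eq divide_le_eq mult_le_cancel_left1)
qed

lemma a_tendsto: "a \<longlonglongrightarrow> 0" "(\<lambda>n. a n * X n) \<longlonglongrightarrow> 0"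
  unfolding a_eq[abs_def] X_def using \<alpha> by real_asymp+

lemma exp_over_a: "(\<lambda>n. exp (- X n) / a n) \<longlonglongrightarrow> 0"
  unfolding a_eq X_def using \<alpha> by real_asymp

lemma X_pos: "X n > 0" by (simp add: X_def)

lemma filterlim_X: "filterlim X at_top sequentially" "filterlim (\<lambda>n. - X n) at_bot sequentially"
  "filterlim (\<lambda>n. X n / 2) at_top sequentially"
  unfolding X_def[abs_def] by real_asymp+

definition M0 :: real where "M0 = c\<^sub>Q + C * \<alpha>"

lemma Q_pos: "Q x > 0" by (rule soliton_pos[OF p])
lemma Q_le: "Q x \<le> c\<^sub>Q" by (rule soliton_const_ge[OF p])
lemma c\<^sub>Q_pos: "c\<^sub>Q > 0" by (rule soliton_const_pos[OF p])

lemma Ca_le: "C * a n \<le> C * \<alpha>" using C_nonneg a_le by (rule mult_left_mono[rotated])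

lemma u_le: "u n x \<le> Q x + C * a n" using close[of n x] by simp
lemma u_le_M0: "u n x \<le> M0" using u_le[of n x] Q_le[of x] Ca_le[of n] by (simp add: M0_def)
lemma Q_le_M0: "Q x \<le> M0" using Q_le[of x] mult_nonneg_nonneg[OF C_nonneg less_imp_le[OF \<alpha>]] by (simp add: M0_def)

text \<open>
  The odd antiderivative of the soliton; below, I, S and T are antiderivatives, also normalised
  at 0, of u, u^2 and Q'' u.
\<close>

definition P :: "real \<Rightarrow> real" where
  "P = (SOME P. P 0 = 0 \<and> (\<forall>x. (P has_real_derivative Q x) (at x)))"

lemma P: "P 0 = 0" "(P has_real_derivative Q x) (at x)"
proof -
  have "\<exists>P. P 0 = 0 \<and> (\<forall>x. (P has_real_derivative Q x) (at x))"
    using antiderivative_exists[of Q] isCont_soliton(1)[OF p] by metis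
  from someI_ex[OF this] show "P 0 = 0" "(P has_real_derivative Q x) (at x)"
    unfolding P_def by auto
qed

lemma P_odd: "P (- x) = - P x"
proof -
  have "((\<lambda>x. P (- x) + P x) has_real_derivative 0) (at x)" for x
    using DERIV_add[OF DERIV_chain'[OF DERIV_minus[OF DERIV_ident] P(2)] P(2), of x]
    by (simp add: soliton_even)
  then have "P (- x) + P x = P (- 0) + P 0" by (intro DERIV_isconst_all) auto
  then show ?thesis using P(1) by simp
qed

lemma P_mono: "x \<le> y \<Longrightarrow> P x \<le> P y"
  by (rule DERIV_nonneg_imp_nondecreasing) (use P(2) less_imp_le[OF Q_pos] in blast)+

lemma P_tendsto: "filterlim Z at_top sequentially \<Longrightarrow> (\<lambda>n. P (Z n)) \<longlonglongrightarrow> q / 2"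
proof -
  assume Z: "filterlim Z at_top sequentially"
  then have Z': "filterlim (\<lambda>n. - Z n) at_bot sequentially" by (simp add: filterlim_uminus_at_top)
  have "(\<lambda>n. P (Z n) - P (- Z n)) \<longlonglongrightarrow> q"
    by (rule antiderivative_tendsto_integral[OF integrable_soliton(1)[OF p] isCont_soliton(1)[OF p] P(2) Z Z'])
  then have "(\<lambda>n. (P (Z n) - P (- Z n)) / 2) \<longlonglongrightarrow> q / 2" by (intro tendsto_divide) auto
  then show ?thesis by (simp add: P_odd)
qed

lemma P_le: "P x \<le> q / 2"
proof (rule LIMSEQ_le_const)
  show "(\<lambda>n. P (x + real n)) \<longlonglongrightarrow> q / 2" by (rule P_tendsto) real_asymp
qed (auto intro!: P_mono)

lemma P_near: "0 \<le> y \<Longrightarrow> y \<le> x \<Longrightarrow> \<bar>P x - q / 2\<bar> \<le> q / 2 - P y"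
  using P_le[of x] P_mono[of y x] by simp

definition I :: "nat \<Rightarrow> real \<Rightarrow> real" where
  "I n = (SOME P. P 0 = 0 \<and> (\<forall>x. (P has_real_derivative u n x) (at x)))"

lemma I: "I n 0 = 0" "(I n has_real_derivative u n x) (at x)"
proof -
  have "\<exists>P. P 0 = 0 \<and> (\<forall>x. (P has_real_derivative u n x) (at x))"
    using antiderivative_exists[of "u n"] DERIV_isCont[OF der(1)] by metis
  from someI_ex[OF this] show "I n 0 = 0" "(I n has_real_derivative u n x) (at x)"
    unfolding I_def by auto
qed

lemma I_near: "\<bar>I n x - P x\<bar> \<le> C * a n * \<bar>x\<bar>"
  by (rule antiderivative_difference_le[OF I(2) P(2) I(1) P(1) close])

text \<open>
  The constant of integration, divided by a, of the forced equation integrated once in x.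
\<close>

definition k :: "nat \<Rightarrow> real" where
  "k n = (u n 0 - u n 0 powr p * u n 0 - u2 n 0) / a n"

lemma Q1_0: "Q1 0 = 0" by (simp add: soliton1_def)

text \<open>
  The forced equation is the derivative of this identity: a ((1 + \<gamma>) u + x u') is the derivative of
  a (x u + \<gamma> \<integral>u).
\<close>

lemma u2_eq: "u2 n x = a n * (x * u n x + \<gamma> * I n x) + u n x - u n x powr p * u n x + c n * Q1 x - k n * a n"
proof -
  define J where "J x = a n * (x * u n x + \<gamma> * I n x) - u2 n x + u n x - u n x powr p * u n x + c n * Q1 x" for x
  have "(J has_real_derivative 0) (at x)" for x
  proof -
    define N where "N x = u n x powr p * u n x" for x
    have dN: "(N has_real_derivative (p + 1) * u n x powr p * u1 n x) (at x)"
      unfolding N_def[abs_def] by (rule DERIV_powr_times(1)[OF der(1) pos])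
    have J_N: "J = (\<lambda>x. a n * (x * u n x + \<gamma> * I n x) - u2 n x + u n x - N x + c n * Q1 x)"
      by (simp add: J_def[abs_def] N_def)
    have "(J has_real_derivative a n * (u n x + x * u1 n x + \<gamma> * u n x) - u3 n x + u1 n x
        - (p + 1) * u n x powr p * u1 n x + c n * Q2 x) (at x)"
      unfolding J_N
      by (rule derivative_eq_intros der dN I(2) DERIV_soliton1[OF p] refl)+ (simp add: algebra_simps)
    moreover have "a n * (u n x + x * u1 n x + \<gamma> * u n x) - u3 n x + u1 n x
        - (p + 1) * u n x powr p * u1 n x + c n * Q2 x = 0"
      using eq[of n x] by (simp add: algebra_simps)
    ultimately show ?thesis by simp
  qed
  then have "J x = J 0" by (intro DERIV_isconst_all) auto
  moreover have "J 0 = k n * a n"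
    using a_pos[of n] by (simp add: J_def k_def I(1) Q1_0)
  ultimately show ?thesis by (simp add: J_def)
qed

lemma nonlinearity_near:
  "\<bar>u n x powr p * u n x - Q x powr p * Q x\<bar> \<le> (p + 1) * (Q x + C * a n) powr p * (C * a n)"
proof -
  have "\<bar>u n x powr p * u n x - Q x powr p * Q x\<bar> \<le> (p + 1) * (Q x + C * a n) powr p * \<bar>u n x - Q x\<bar>"
    using C_nonneg a_pos[of n] by (intro powr_times_self_lipschitz p pos Q_pos u_le) auto
  also have "\<dots> \<le> (p + 1) * (Q x + C * a n) powr p * (C * a n)"
    using p by (intro mult_left_mono close) auto
  finally show ?thesis .
qed

lemma k_bounded: "\<bar>k n\<bar> \<le> 2 * C + (p + 1) * M0 powr p * C"
proof -
  have "k n * a n = (u n 0 - Q 0) - (u2 n 0 - Q2 0) - (u n 0 powr p * u n 0 - Q 0 powr p * Q 0)"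
    using a_pos[of n] by (simp add: k_def soliton2_def)
  then have "\<bar>k n * a n\<bar> \<le> C * a n + C * a n + \<bar>u n 0 powr p * u n 0 - Q 0 powr p * Q 0\<bar>"
    using close[of n 0] close2[of n] by linarith
  also have "\<bar>u n 0 powr p * u n 0 - Q 0 powr p * Q 0\<bar> \<le> (p + 1) * M0 powr p * (C * a n)"
  proof -
    have "\<bar>u n 0 powr p * u n 0 - Q 0 powr p * Q 0\<bar> \<le> (p + 1) * M0 powr p * \<bar>u n 0 - Q 0\<bar>"
      by (intro powr_times_self_lipschitz p pos Q_pos u_le_M0 Q_le_M0)
    also have "\<dots> \<le> (p + 1) * M0 powr p * (C * a n)"
      using p by (intro mult_left_mono close) auto
    finally show ?thesis .
  qed
  finally have "\<bar>k n\<bar> * a n \<le> (2 * C + (p + 1) * M0 powr p * C) * a n"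
    using a_pos[of n] by (simp add: abs_mult algebra_simps)
  then show ?thesis using a_pos[of n] by simp
qed

definition r :: "nat \<Rightarrow> real \<Rightarrow> real" where "r n x = (u n x - Q x) / a n"
definition r1 :: "nat \<Rightarrow> real \<Rightarrow> real" where "r1 n x = (u1 n x - Q1 x) / a n"
definition r2 :: "nat \<Rightarrow> real \<Rightarrow> real" where "r2 n x = (u2 n x - Q2 x) / a n"

lemma r_der: "(r n has_real_derivative r1 n x) (at x)" "(r1 n has_real_derivative r2 n x) (at x)"
  unfolding r_def[abs_def] r1_def[abs_def] r2_def
  by (intro DERIV_cdivide DERIV_diff der DERIV_soliton DERIV_soliton1 p)+

lemma r_bound: "\<bar>r n x\<bar> \<le> C"
  using close[of n x] a_pos[of n] by (simp add: r_def field_simps)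

lemma r2_minus_r:
  "r2 n x - r n x = x * u n x + \<gamma> * I n x - (u n x powr p * u n x - Q x powr p * Q x) / a n + c n / a n * Q1 x - k n"
  using a_pos[of n] by (simp add: r_def r2_def u2_eq[of n x] soliton2_def field_simps)

text \<open>
  On the side \<sigma> = \<plusminus>1 the integral of Q from 0 is nearly \<sigma> q / 2, so that r = (u - Q) / a
  solves r'' - r = L up to the small error \<eta> below; hence r is close to - L there.
\<close>

definition L :: "real \<Rightarrow> nat \<Rightarrow> real" where "L \<sigma> n = \<gamma> * (\<sigma> * (q / 2)) - k n"

definition tail :: "nat \<Rightarrow> real" where "tail n = q / 2 - P (X n / 2)"

definition \<epsilon>\<^sub>Q :: "nat \<Rightarrow> real" where "\<epsilon>\<^sub>Q n = c\<^sub>Q * exp (- (X n / 2))"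

definition \<eta> :: "nat \<Rightarrow> real" where
  "\<eta> n = 3 / 2 * X n * (\<epsilon>\<^sub>Q n + C * a n) + \<bar>\<gamma>\<bar> * (C * a n * (3 / 2 * X n) + tail n)
      + (p + 1) * (\<epsilon>\<^sub>Q n + C * a n) powr p * C + C * \<epsilon>\<^sub>Q n"

lemma Q_far: "X n / 2 \<le> \<bar>x\<bar> \<Longrightarrow> Q x \<le> \<epsilon>\<^sub>Q n"
proof -
  assume "X n / 2 \<le> \<bar>x\<bar>"
  then have "c\<^sub>Q * exp (- \<bar>x\<bar>) \<le> \<epsilon>\<^sub>Q n" unfolding \<epsilon>\<^sub>Q_def using c\<^sub>Q_pos by (intro mult_left_mono) auto
  then show ?thesis using soliton_decay[OF p, of x] by linarith
qed

lemma eps_pos: "\<epsilon>\<^sub>Q n > 0" using c\<^sub>Q_pos by (simp add: \<epsilon>\<^sub>Q_def)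
lemma tail_nonneg: "tail n \<ge> 0" using P_le by (simp add: tail_def)
lemma Ca_nonneg: "0 \<le> C * a n" using C_nonneg a_pos[of n] by simp

lemma eta_nonneg: "\<eta> n \<ge> 0"
  unfolding \<eta>_def using X_pos[of n] eps_pos[of n] tail_nonneg[of n] Ca_nonneg[of n] C_nonneg p
  by (intro add_nonneg_nonneg mult_nonneg_nonneg less_imp_le[OF a_pos]) auto

text \<open>
  Away from the soliton only the constant of integration and the integral of u survive at order a.
\<close>

lemma r2_minus_r_near:
  assumes \<sigma>: "\<sigma> = 1 \<or> \<sigma> = -1" and x: "\<bar>x - \<sigma> * X n\<bar> \<le> X n / 2"
  shows "\<bar>r2 n x - r n x - L \<sigma> n\<bar> \<le> \<eta> n"
proof -
  have ax: "X n / 2 \<le> \<bar>x\<bar>" "\<bar>x\<bar> \<le> 3 / 2 * X n" and sx: "\<sigma> * x = \<bar>x\<bar>"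
    using \<sigma> x X_pos[of n] by (auto simp: abs_le_iff abs_if split: if_splits)
  have Qx: "Q x \<le> \<epsilon>\<^sub>Q n" by (rule Q_far[OF ax(1)])
  have "\<bar>x * u n x\<bar> \<le> 3 / 2 * X n * (\<epsilon>\<^sub>Q n + C * a n)"
    unfolding abs_mult using ax pos[of n x] u_le[of n x] Qx X_pos[of n] by (intro mult_mono) auto
  moreover have "\<bar>\<gamma> * (I n x - \<sigma> * (q / 2))\<bar> \<le> \<bar>\<gamma>\<bar> * (C * a n * (3 / 2 * X n) + tail n)"
    unfolding abs_mult
  proof (rule mult_left_mono)
    have "P x = \<sigma> * P \<bar>x\<bar>" using \<sigma> sx P_odd[of x] by (auto simp: abs_if split: if_splits)
    then have "\<bar>P x - \<sigma> * (q / 2)\<bar> = \<bar>P \<bar>x\<bar> - q / 2\<bar>" using \<sigma> by auto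
    also have "\<dots> \<le> tail n" unfolding tail_def using ax X_pos[of n] by (intro P_near) auto
    finally have "\<bar>P x - \<sigma> * (q / 2)\<bar> \<le> tail n" .
    moreover have "\<bar>I n x - P x\<bar> \<le> C * a n * (3 / 2 * X n)"
      using I_near[of n x] mult_left_mono[OF ax(2) Ca_nonneg[of n]] by linarith
    ultimately show "\<bar>I n x - \<sigma> * (q / 2)\<bar> \<le> C * a n * (3 / 2 * X n) + tail n" by linarith
  qed simp
  moreover have "\<bar>(u n x powr p * u n x - Q x powr p * Q x) / a n\<bar> \<le> (p + 1) * (\<epsilon>\<^sub>Q n + C * a n) powr p * C"
  proof -
    have "\<bar>u n x powr p * u n x - Q x powr p * Q x\<bar> \<le> (p + 1) * (Q x + C * a n) powr p * (C * a n)"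
      by (rule nonlinearity_near)
    also have "\<dots> \<le> (p + 1) * (\<epsilon>\<^sub>Q n + C * a n) powr p * (C * a n)"
      using p Qx Q_pos[of x] Ca_nonneg[of n] by (intro mult_right_mono mult_left_mono powr_mono2) auto
    finally show ?thesis using a_pos[of n] by (simp add: field_simps)
  qed
  moreover have "\<bar>c n / a n * Q1 x\<bar> \<le> C * \<epsilon>\<^sub>Q n"
    unfolding abs_mult using c_le[of n] a_pos[of n] soliton1_le[OF p, of x] Qx C_nonneg
    by (intro mult_mono) (auto simp: field_simps)
  moreover have "r2 n x - r n x - L \<sigma> n = x * u n x + \<gamma> * (I n x - \<sigma> * (q / 2))
      - (u n x powr p * u n x - Q x powr p * Q x) / a n + c n / a n * Q1 x"
    unfolding r2_minus_r L_def by (simp add: algebra_simps)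
  ultimately show ?thesis unfolding \<eta>_def by linarith
qed

lemma eta_tendsto: "\<eta> \<longlonglongrightarrow> 0"
proof -
  have aX: "(\<lambda>n. C * (a n * X n)) \<longlonglongrightarrow> 0" using tendsto_mult[OF tendsto_const a_tendsto(2)] by simp
  have e: "\<epsilon>\<^sub>Q \<longlonglongrightarrow> 0" and eX: "(\<lambda>n. X n * \<epsilon>\<^sub>Q n) \<longlonglongrightarrow> 0"
    unfolding \<epsilon>\<^sub>Q_def[abs_def] X_def by real_asymp+
  have t: "tail \<longlonglongrightarrow> 0"
    using tendsto_diff[OF tendsto_const P_tendsto[OF filterlim_X(3)], of "q / 2"] by (simp add: tail_def[abs_def])
  have s: "(\<lambda>n. \<epsilon>\<^sub>Q n + C * a n) \<longlonglongrightarrow> 0"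
    using tendsto_add[OF e tendsto_mult[OF tendsto_const a_tendsto(1)]] by simp
  have pw: "(\<lambda>n. (\<epsilon>\<^sub>Q n + C * a n) powr p) \<longlonglongrightarrow> 0"
    using tendsto_powr2[OF s tendsto_const[of p]] p eps_pos Ca_nonneg
    by (auto simp: less_imp_le add_nonneg_nonneg)
  have "(\<lambda>n. 3 / 2 * (X n * \<epsilon>\<^sub>Q n + C * (a n * X n)) + \<bar>\<gamma>\<bar> * (3 / 2 * (C * (a n * X n)) + tail n)
      + (p + 1) * (\<epsilon>\<^sub>Q n + C * a n) powr p * C + C * \<epsilon>\<^sub>Q n) \<longlonglongrightarrow>
      3 / 2 * (0 + 0) + \<bar>\<gamma>\<bar> * (3 / 2 * 0 + 0) + (p + 1) * 0 * C + C * 0"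
    by (intro tendsto_intros aX eX e t pw)
  then show ?thesis by (simp add: \<eta>_def[abs_def] algebra_simps add_divide_distrib)
qed

lemma L_bounded: "\<bar>L \<sigma> n\<bar> \<le> \<bar>\<gamma>\<bar> * (\<bar>\<sigma>\<bar> * \<bar>q / 2\<bar>) + (2 * C + (p + 1) * M0 powr p * C)"
proof -
  have "\<bar>L \<sigma> n\<bar> \<le> \<bar>\<gamma> * (\<sigma> * (q / 2))\<bar> + \<bar>k n\<bar>" unfolding L_def by linarith
  then show ?thesis using k_bounded[of n] by (simp add: abs_mult)
qed

lemma r_at_X:
  assumes \<sigma>: "\<sigma> = 1 \<or> \<sigma> = -1"
  shows "(\<lambda>n. r n (\<sigma> * X n) + L \<sigma> n) \<longlonglongrightarrow> 0" "(\<lambda>n. r1 n (\<sigma> * X n)) \<longlonglongrightarrow> 0" "(\<lambda>n. r2 n (\<sigma> * X n)) \<longlonglongrightarrow> 0"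
proof -
  define K where "K = C + (\<bar>\<gamma>\<bar> * (\<bar>\<sigma>\<bar> * \<bar>q / 2\<bar>) + (2 * C + (p + 1) * M0 powr p * C))"
  have rL: "\<bar>r n x + L \<sigma> n\<bar> \<le> K" for n x
    using r_bound[of n x] L_bounded[of \<sigma> n] unfolding K_def by linarith
  then have K: "0 \<le> K" using order_trans[OF abs_ge_zero] by blast
  define b where "b n = 4 * (\<eta> n + K / cosh (X n / 2 - 1))" for n
  have b: "b \<longlonglongrightarrow> 0"
  proof -
    have "(\<lambda>n. K / cosh (X n / 2 - 1)) \<longlonglongrightarrow> 0"
      unfolding X_def cosh_field_def by real_asymp
    from tendsto_mult[OF tendsto_const tendsto_add[OF eta_tendsto this], of 4]
    show ?thesis by (simp add: b_def[abs_def])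
  qed
  have ev: "\<forall>\<^sub>F n in sequentially. 1 < X n / 2"
    using filterlim_X(3) unfolding filterlim_at_top_dense by blast
  have "\<bar>r n (\<sigma> * X n) + L \<sigma> n\<bar> \<le> b n \<and> \<bar>r1 n (\<sigma> * X n)\<bar> \<le> b n \<and> \<bar>r2 n (\<sigma> * X n)\<bar> \<le> b n"
    if n: "1 < X n / 2" for n
  proof -
    have d: "((\<lambda>x. r n x + L \<sigma> n) has_real_derivative r1 n x) (at x)" for x
      using DERIV_add[OF r_der(1) DERIV_const] by simp
    have near: "\<bar>r2 n x - (r n x + L \<sigma> n)\<bar> \<le> \<eta> n" if "\<bar>x - \<sigma> * X n\<bar> \<le> X n / 2" for x
      using r2_minus_r_near[OF \<sigma> that] by (simp add: algebra_simps)
    show ?thesis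
      using exponential_relaxation[OF d r_der(2) n K eta_nonneg near rL] unfolding b_def by blast
  qed
  then have ev2: "\<forall>\<^sub>F n in sequentially. \<bar>r n (\<sigma> * X n) + L \<sigma> n\<bar> \<le> b n \<and> \<bar>r1 n (\<sigma> * X n)\<bar> \<le> b n \<and> \<bar>r2 n (\<sigma> * X n)\<bar> \<le> b n"
    using ev by (auto elim: eventually_mono)
  show "(\<lambda>n. r n (\<sigma> * X n) + L \<sigma> n) \<longlonglongrightarrow> 0" "(\<lambda>n. r1 n (\<sigma> * X n)) \<longlonglongrightarrow> 0" "(\<lambda>n. r2 n (\<sigma> * X n)) \<longlonglongrightarrow> 0"
    by (rule Lim_null_comparison[OF _ b]; use ev2 in \<open>auto elim: eventually_mono\<close>)+
qed

lemma Q_over_a: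
  assumes \<sigma>: "\<sigma> = 1 \<or> \<sigma> = -1"
  shows "(\<lambda>n. Q (\<sigma> * X n) / a n) \<longlonglongrightarrow> 0" "(\<lambda>n. Q1 (\<sigma> * X n) / a n) \<longlonglongrightarrow> 0" "(\<lambda>n. Q2 (\<sigma> * X n) / a n) \<longlonglongrightarrow> 0"
proof -
  have lim: "(\<lambda>n. g (\<sigma> * X n) / a n) \<longlonglongrightarrow> 0" if g: "\<And>x. \<bar>g x\<bar> \<le> D * Q x" and D: "D \<ge> 0" for g D
  proof (rule Lim_null_comparison)
    show "(\<lambda>n. D * c\<^sub>Q * (exp (- X n) / a n)) \<longlonglongrightarrow> 0"
      using tendsto_mult[OF tendsto_const exp_over_a] by simp
    have "norm (g (\<sigma> * X n) / a n) \<le> D * c\<^sub>Q * (exp (- X n) / a n)" for n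
    proof -
      have "\<bar>\<sigma> * X n\<bar> = X n" using \<sigma> X_pos[of n] by auto
      then have "\<bar>g (\<sigma> * X n)\<bar> \<le> D * (c\<^sub>Q * exp (- X n))"
        using g[of "\<sigma> * X n"] mult_left_mono[OF soliton_decay[OF p, of "\<sigma> * X n"] D] by simp
      then show ?thesis using a_pos[of n] by (simp add: field_simps)
    qed
    then show "\<forall>\<^sub>F n in sequentially. norm (g (\<sigma> * X n) / a n) \<le> D * c\<^sub>Q * (exp (- X n) / a n)"
      by (intro always_eventually) blast
  qed
  show "(\<lambda>n. Q (\<sigma> * X n) / a n) \<longlonglongrightarrow> 0" by (rule lim[of Q 1]) (use Q_pos in \<open>auto simp: abs_of_pos\<close>)
  show "(\<lambda>n. Q1 (\<sigma> * X n) / a n) \<longlonglongrightarrow> 0" by (rule lim[of Q1 1]) (use soliton1_le[OF p] in auto)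
  show "(\<lambda>n. Q2 (\<sigma> * X n) / a n) \<longlonglongrightarrow> 0" by (rule lim[of Q2 "p + 2"]) (use soliton2_le[OF p] p in auto)
qed

text \<open>
  The boundary term of the identity obtained by multiplying the forced equation by u.
\<close>

definition B :: "nat \<Rightarrow> real \<Rightarrow> real" where
  "B n x = a n * (x * (u n x)\<^sup>2) / 2 - u n x * u2 n x + (u1 n x)\<^sup>2 / 2 + (u n x)\<^sup>2 / 2
     - (p + 1) / (p + 2) * (u n x powr p * (u n x)\<^sup>2)"

text \<open>
  After division by a^2 the boundary term is a quadratic form in the bounded quantities u/a, u'/a and
  u''/a; the last two tend to 0, as do its coefficients a X and u^p, so that only (u/a)^2 / 2
  survives.
\<close>

lemma B_at_X:
  assumes \<sigma>: "\<sigma> = 1 \<or> \<sigma> = -1"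
  shows "(\<lambda>n. B n (\<sigma> * X n) / (a n)\<^sup>2 - (L \<sigma> n)\<^sup>2 / 2) \<longlonglongrightarrow> 0"
proof -
  let ?x = "\<lambda>n. \<sigma> * X n"
  define y y1 y2 where "y n = u n (?x n) / a n" and "y1 n = u1 n (?x n) / a n" and "y2 n = u2 n (?x n) / a n" for n
  have "(\<lambda>n. (r n (?x n) + L \<sigma> n) + Q (?x n) / a n) \<longlonglongrightarrow> 0 + 0"
    by (intro tendsto_add r_at_X[OF \<sigma>] Q_over_a[OF \<sigma>])
  then have y: "(\<lambda>n. y n + L \<sigma> n) \<longlonglongrightarrow> 0"
    by (simp add: y_def r_def diff_divide_distrib algebra_simps)
  have "(\<lambda>n. r1 n (?x n) + Q1 (?x n) / a n) \<longlonglongrightarrow> 0 + 0"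
    by (intro tendsto_add r_at_X[OF \<sigma>] Q_over_a[OF \<sigma>])
  then have y1: "y1 \<longlonglongrightarrow> 0" by (simp add: y1_def[abs_def] r1_def diff_divide_distrib)
  have "(\<lambda>n. r2 n (?x n) + Q2 (?x n) / a n) \<longlonglongrightarrow> 0 + 0"
    by (intro tendsto_add r_at_X[OF \<sigma>] Q_over_a[OF \<sigma>])
  then have y2: "y2 \<longlonglongrightarrow> 0" by (simp add: y2_def[abs_def] r2_def diff_divide_distrib)
  define \<Lambda> where "\<Lambda> = \<bar>\<gamma>\<bar> * (\<bar>\<sigma>\<bar> * \<bar>q / 2\<bar>) + (2 * C + (p + 1) * M0 powr p * C)"
  have L_le: "\<bar>L \<sigma> n\<bar> \<le> \<Lambda>" for n using L_bounded by (simp add: \<Lambda>_def)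
  have "Bseq (\<lambda>n. y n + L \<sigma> n)" using y by (intro convergent_imp_Bseq) (auto simp: convergent_def)
  then obtain K where "\<forall>n. norm (y n + L \<sigma> n) \<le> K" by (rule BseqE)
  then have K: "\<bar>y n + L \<sigma> n\<bar> \<le> K" for n by simp
  have y_le: "\<bar>y n\<bar> \<le> K + \<Lambda>" for n using K[of n] L_le[of n] by linarith
  have yL_le: "\<bar>y n - L \<sigma> n\<bar> \<le> K + \<Lambda> + \<Lambda>" for n using y_le[of n] L_le[of n] by linarith
  have ysq_le: "\<bar>(y n)\<^sup>2\<bar> \<le> (K + \<Lambda>)\<^sup>2" for n
    using power_mono[OF y_le[of n] abs_ge_zero, of 2] by simp
  have mult0: "(\<lambda>n. f n * g n) \<longlonglongrightarrow> 0" if "f \<longlonglongrightarrow> 0" "\<And>n. \<bar>g n\<bar> \<le> D" for f g :: "nat \<Rightarrow> real" and D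
    by (rule lim_null_mult_right_bounded[OF that(1)]) (use that(2) in \<open>auto intro: always_eventually\<close>)
  have ux: "(\<lambda>n. u n (?x n)) \<longlonglongrightarrow> 0"
  proof -
    have "a n * y n = u n (?x n)" for n using a_pos[of n] by (simp add: y_def)
    then show ?thesis using mult0[of a y, OF a_tendsto(1) y_le] by simp
  qed
  have upx: "(\<lambda>n. u n (?x n) powr p) \<longlonglongrightarrow> 0"
    using tendsto_powr2[OF ux tendsto_const[of p]] p pos by (auto simp: less_imp_le)
  have "(\<lambda>n. a n * X n * (y n)\<^sup>2) \<longlonglongrightarrow> 0" by (rule mult0[OF a_tendsto(2) ysq_le])
  moreover have "(\<lambda>n. y2 n * y n) \<longlonglongrightarrow> 0" by (rule mult0[OF y2 y_le])
  moreover have "(\<lambda>n. (y1 n)\<^sup>2) \<longlonglongrightarrow> 0" using tendsto_power[OF y1, of 2] by simp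
  moreover have "(\<lambda>n. u n (?x n) powr p * (y n)\<^sup>2) \<longlonglongrightarrow> 0" by (rule mult0[OF upx ysq_le])
  moreover have "(\<lambda>n. (y n + L \<sigma> n) * (y n - L \<sigma> n)) \<longlonglongrightarrow> 0"
    by (rule mult0[OF y yL_le])
  ultimately have "(\<lambda>n. \<sigma> / 2 * (a n * X n * (y n)\<^sup>2) - y2 n * y n + 1 / 2 * (y1 n)\<^sup>2
      - (p + 1) / (p + 2) * (u n (?x n) powr p * (y n)\<^sup>2) + 1 / 2 * ((y n + L \<sigma> n) * (y n - L \<sigma> n)))
      \<longlonglongrightarrow> \<sigma> / 2 * 0 - 0 + 1 / 2 * 0 - (p + 1) / (p + 2) * 0 + 1 / 2 * 0"
    by (intro tendsto_intros)
  moreover have "B n (?x n) / (a n)\<^sup>2 - (L \<sigma> n)\<^sup>2 / 2 = \<sigma> / 2 * (a n * X n * (y n)\<^sup>2) - y2 n * y n + 1 / 2 * (y1 n)\<^sup>2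
      - (p + 1) / (p + 2) * (u n (?x n) powr p * (y n)\<^sup>2) + 1 / 2 * ((y n + L \<sigma> n) * (y n - L \<sigma> n))" for n
  proof -
    have u: "u n (?x n) = a n * y n" "u1 n (?x n) = a n * y1 n" "u2 n (?x n) = a n * y2 n"
      using a_pos[of n] by (auto simp: y_def y1_def y2_def)
    define w where "w = u n (?x n) powr p"
    define Z where "Z = \<sigma> / 2 * (a n * X n * (y n)\<^sup>2) - y2 n * y n + 1 / 2 * (y1 n)\<^sup>2 + 1 / 2 * (y n)\<^sup>2
      - (p + 1) / (p + 2) * (w * (y n)\<^sup>2)"
    have "B n (?x n) = (a n)\<^sup>2 * (\<sigma> / 2 * (a n * X n * (y n)\<^sup>2) - y2 n * y n + 1 / 2 * (y1 n)\<^sup>2 + 1 / 2 * (y n)\<^sup>2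
      - (p + 1) / (p + 2) * (w * (y n)\<^sup>2))"
      unfolding B_def w_def[symmetric] unfolding u by (simp add: power2_eq_square algebra_simps)
    then have "B n (?x n) = (a n)\<^sup>2 * Z" by (simp only: Z_def)
    then have "B n (?x n) / (a n)\<^sup>2 = Z" using a_pos[of n] by simp
    then show ?thesis by (simp add: Z_def w_def power2_eq_square algebra_simps)
  qed
  ultimately show ?thesis by simp
qed

definition S :: "nat \<Rightarrow> real \<Rightarrow> real" where
  "S n = (SOME P. P 0 = 0 \<and> (\<forall>x. (P has_real_derivative (u n x)\<^sup>2) (at x)))"

definition T :: "nat \<Rightarrow> real \<Rightarrow> real" where
  "T n = (SOME P. P 0 = 0 \<and> (\<forall>x. (P has_real_derivative Q2 x * u n x) (at x)))"

lemma S: "S n 0 = 0" "(S n has_real_derivative (u n x)\<^sup>2) (at x)"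
proof -
  have "isCont (\<lambda>x. (u n x)\<^sup>2) x" for x by (intro continuous_intros DERIV_isCont[OF der(1)])
  then have "\<exists>P. P 0 = 0 \<and> (\<forall>x. (P has_real_derivative (u n x)\<^sup>2) (at x))"
    using antiderivative_exists[of "\<lambda>x. (u n x)\<^sup>2"] by metis
  from someI_ex[OF this] show "S n 0 = 0" "(S n has_real_derivative (u n x)\<^sup>2) (at x)"
    unfolding S_def by auto
qed

lemma T: "T n 0 = 0" "(T n has_real_derivative Q2 x * u n x) (at x)"
proof -
  have "isCont (\<lambda>x. Q2 x * u n x) x" for x
    by (intro continuous_intros DERIV_isCont[OF der(1)] isCont_soliton p)
  then have "\<exists>P. P 0 = 0 \<and> (\<forall>x. (P has_real_derivative Q2 x * u n x) (at x))"
    using antiderivative_exists[of "\<lambda>x. Q2 x * u n x"] by metis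
  from someI_ex[OF this] show "T n 0 = 0" "(T n has_real_derivative Q2 x * u n x) (at x)"
    unfolding T_def by auto
qed

lemma mass_identity:
  "B n (X n) - B n (- X n) + a n * (\<gamma> + 1 / 2) * (S n (X n) - S n (- X n)) + c n * (T n (X n) - T n (- X n)) = 0"
proof -
  define F where "F x = B n x + a n * (\<gamma> + 1 / 2) * S n x + c n * T n x" for x
  have "(F has_real_derivative 0) (at x)" for x
  proof -
    define E where "E x = u n x powr p * (u n x)\<^sup>2" for x
    have dE: "(E has_real_derivative (p + 2) * (u n x powr p * u n x * u1 n x)) (at x)"
      unfolding E_def[abs_def] by (rule DERIV_powr_times(2)[OF der(1) pos])
    have F: "F = (\<lambda>x. 1 / 2 * (a n * (x * (u n x)\<^sup>2)) - u n x * u2 n x + 1 / 2 * (u1 n x)\<^sup>2 + 1 / 2 * (u n x)\<^sup>2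
     - (p + 1) / (p + 2) * E x + a n * (\<gamma> + 1 / 2) * S n x + c n * T n x)"
      by (simp add: F_def[abs_def] B_def E_def)
    have "(F has_real_derivative 1 / 2 * (a n * (u n x)\<^sup>2) + a n * (x * (u n x * u1 n x)) - (u1 n x * u2 n x + u n x * u3 n x)
      + u1 n x * u2 n x + u n x * u1 n x - (p + 1) / (p + 2) * ((p + 2) * (u n x powr p * u n x * u1 n x))
      + a n * (\<gamma> + 1 / 2) * (u n x)\<^sup>2 + c n * (Q2 x * u n x)) (at x)"
      unfolding F by (rule derivative_eq_intros der dE S(2) T(2) refl)+ (simp add: field_simps power2_eq_square)
    moreover have "(p + 1) / (p + 2) * ((p + 2) * (u n x powr p * u n x * u1 n x)) = (p + 1) * (u n x powr p * u n x * u1 n x)"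
      using p by simp
    moreover have "1 / 2 * (a n * (u n x)\<^sup>2) + a n * (x * (u n x * u1 n x)) - (u1 n x * u2 n x + u n x * u3 n x)
      + u1 n x * u2 n x + u n x * u1 n x - (p + 1) * (u n x powr p * u n x * u1 n x)
      + a n * (\<gamma> + 1 / 2) * (u n x)\<^sup>2 + c n * (Q2 x * u n x) =
      u n x * (a n * ((1 + \<gamma>) * u n x + x * u1 n x) - u3 n x + u1 n x - (p + 1) * u n x powr p * u1 n x + c n * Q2 x)"
      by (simp add: algebra_simps power2_eq_square)
    ultimately show ?thesis using eq[of n x] by simp
  qed
  then have "F (X n) = F (- X n)" by (intro DERIV_isconst_all) auto
  then show ?thesis by (simp add: F_def algebra_simps)
qed

lemma antiderivative_increment_tendsto:
  assumes F: "\<And>n x. (F n has_real_derivative f n x) (at x)" "\<And>n. F n 0 = 0"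
    and g: "integrable lborel g" "\<And>x. isCont g x"
    and bound: "\<And>n x. \<bar>f n x - g x\<bar> \<le> D * a n"
  shows "(\<lambda>n. F n (X n) - F n (- X n)) \<longlonglongrightarrow> (LINT x|lborel. g x)"
proof -
  obtain G where G: "G 0 = 0" "\<And>x. (G has_real_derivative g x) (at x)"
    using antiderivative_exists[OF g(2)] by blast
  have near: "\<bar>F n x - G x\<bar> \<le> D * a n * \<bar>x\<bar>" for n x
    by (rule antiderivative_difference_le[OF F(1) G(2) F(2) G(1) bound])
  have "(\<lambda>n. (F n (X n) - F n (- X n)) - (G (X n) - G (- X n))) \<longlonglongrightarrow> 0"
  proof (rule Lim_null_comparison)
    show "(\<lambda>n. 2 * (D * (a n * X n))) \<longlonglongrightarrow> 0"
      using tendsto_mult[OF tendsto_const tendsto_mult[OF tendsto_const a_tendsto(2)]] by simp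
    have "norm ((F n (X n) - F n (- X n)) - (G (X n) - G (- X n))) \<le> 2 * (D * (a n * X n))" for n
      using near[of n "X n"] near[of n "- X n"] X_pos[of n] by simp
    then show "\<forall>\<^sub>F n in sequentially. norm ((F n (X n) - F n (- X n)) - (G (X n) - G (- X n))) \<le> 2 * (D * (a n * X n))"
      by (intro always_eventually) blast
  qed
  from tendsto_add[OF this antiderivative_tendsto_integral[OF g G(2) filterlim_X(1,2)]]
  show ?thesis by simp
qed

lemma S_tendsto: "(\<lambda>n. S n (X n) - S n (- X n)) \<longlonglongrightarrow> mass"
proof (rule antiderivative_increment_tendsto[OF S(2,1)])
  fix n x
  have "\<bar>(u n x)\<^sup>2 - (Q x)\<^sup>2\<bar> = \<bar>u n x + Q x\<bar> * \<bar>u n x - Q x\<bar>"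
    by (simp add: abs_mult[symmetric] power2_eq_square algebra_simps)
  also have "\<dots> \<le> (2 * M0) * (C * a n)"
    using close[of n x] u_le_M0[of n x] Q_le_M0[of x] pos[of n x] Q_pos[of x] by (intro mult_mono) auto
  finally show "\<bar>(u n x)\<^sup>2 - (Q x)\<^sup>2\<bar> \<le> 2 * M0 * C * a n" by simp
qed (intro integrable_soliton p continuous_intros isCont_soliton)+

text \<open>
  In the limit u may be replaced by Q, and \<integral>Q'' Q = - \<integral>Q'^2.
\<close>

lemma T_tendsto: "(\<lambda>n. T n (X n) - T n (- X n)) \<longlonglongrightarrow> - grad"
proof -
  have int: "integrable lborel (\<lambda>x. Q2 x * Q x)" and "(LINT x|lborel. Q2 x * Q x) = - grad"
  proof -
    have e: "Q2 x * Q x = ((p + 4) / 2 * (Q1 x)\<^sup>2 - p / 2 * (Q x)\<^sup>2) - (Q1 x)\<^sup>2" for x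
    proof -
      have "Q1 x * Q1 x + Q x * Q2 x = (p + 4) / 2 * (Q1 x)\<^sup>2 - p / 2 * (Q x)\<^sup>2"
        using DERIV_unique[OF DERIV_mult[OF DERIV_soliton[OF p] DERIV_soliton1[OF p]] soliton_virial_density[OF p], of x]
        by (simp add: algebra_simps)
      then show ?thesis by (simp add: power2_eq_square algebra_simps)
    qed
    show "integrable lborel (\<lambda>x. Q2 x * Q x)" unfolding e
      by (intro Bochner_Integration.integrable_diff integrable_mult_right integrable_soliton p)
    show "(LINT x|lborel. Q2 x * Q x) = - grad" unfolding e
      using integrable_soliton[OF p] soliton_virial[OF p] by (simp add: field_simps)
  qed
  moreover have "(\<lambda>n. T n (X n) - T n (- X n)) \<longlonglongrightarrow> (LINT x|lborel. Q2 x * Q x)"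
  proof (rule antiderivative_increment_tendsto[OF T(2,1) int])
    show "isCont (\<lambda>x. Q2 x * Q x) x" for x by (intro continuous_intros isCont_soliton p)
    fix n x
    have "\<bar>Q2 x * u n x - Q2 x * Q x\<bar> = \<bar>Q2 x\<bar> * \<bar>u n x - Q x\<bar>"
      by (simp add: abs_mult[symmetric] algebra_simps)
    also have "\<dots> \<le> ((p + 2) * c\<^sub>Q) * (C * a n)"
      using close[of n x] order_trans[OF soliton2_le[OF p, of x] mult_left_mono[OF Q_le[of x]]] p c\<^sub>Q_pos
      by (intro mult_mono) auto
    finally show "\<bar>Q2 x * u n x - Q2 x * Q x\<bar> \<le> (p + 2) * c\<^sub>Q * C * a n" by simp
  qed
  ultimately show ?thesis by simp
qed

lemma mass_pos: "mass > 0" and grad_pos: "grad > 0"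
proof -
  have "mass \<noteq> 0"
  proof
    assume "mass = 0"
    then have "AE x in lborel. (Q x)\<^sup>2 = 0"
      using integral_nonneg_eq_0_iff_AE[OF integrable_soliton(2)[OF p]] by simp
    moreover have "(Q x)\<^sup>2 \<noteq> 0" for x using Q_pos[of x] by simp
    ultimately have "AE x in (lborel :: real measure). False" by simp
    then have "ae_filter (lborel :: real measure) = bot" by (simp add: trivial_limit_def)
    then show False by (simp add: ae_filter_eq_bot_iff)
  qed
  moreover have "mass \<ge> 0" by simp
  ultimately have "mass > 0" by linarith
  then show "mass > 0" .
  then have "0 < p * mass" using p by simp
  then have "0 < (p + 4) * grad" using soliton_virial[OF p] by simp
  then show "grad > 0" using p by (simp add: zero_less_mult_iff)
qed

lemma B_over_a:
  assumes \<sigma>: "\<sigma> = 1 \<or> \<sigma> = -1"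
  shows "(\<lambda>n. B n (\<sigma> * X n) / a n) \<longlonglongrightarrow> 0"
proof -
  define \<Lambda> where "\<Lambda> = \<bar>\<gamma>\<bar> * (\<bar>\<sigma>\<bar> * \<bar>q / 2\<bar>) + (2 * C + (p + 1) * M0 powr p * C)"
  have "(\<lambda>n. a n * (\<Lambda>\<^sup>2 / 2)) \<longlonglongrightarrow> 0"
    using tendsto_mult[OF a_tendsto(1) tendsto_const] by simp
  then have 1: "(\<lambda>n. a n * ((L \<sigma> n)\<^sup>2 / 2)) \<longlonglongrightarrow> 0"
  proof (rule Lim_null_comparison[rotated])
    have "norm (a n * ((L \<sigma> n)\<^sup>2 / 2)) \<le> a n * (\<Lambda>\<^sup>2 / 2)" for n
      using a_pos[of n] power_mono[OF L_bounded[of \<sigma> n] abs_ge_zero, of 2] by (simp add: \<Lambda>_def abs_mult)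
    then show "\<forall>\<^sub>F n in sequentially. norm (a n * ((L \<sigma> n)\<^sup>2 / 2)) \<le> a n * (\<Lambda>\<^sup>2 / 2)"
      by (intro always_eventually) blast
  qed
  have "(\<lambda>n. a n * (B n (\<sigma> * X n) / (a n)\<^sup>2 - (L \<sigma> n)\<^sup>2 / 2) + a n * ((L \<sigma> n)\<^sup>2 / 2)) \<longlonglongrightarrow> 0 * 0 + 0"
    by (intro tendsto_intros B_at_X[OF \<sigma>] a_tendsto 1)
  moreover have "a n * (B n (\<sigma> * X n) / (a n)\<^sup>2 - (L \<sigma> n)\<^sup>2 / 2) + a n * ((L \<sigma> n)\<^sup>2 / 2) = B n (\<sigma> * X n) / a n" for n
    using a_pos[of n] by (simp add: field_simps power2_eq_square)
  ultimately show ?thesis by simp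
qed

lemma T_eventually: "\<forall>\<^sub>F n in sequentially. T n (X n) - T n (- X n) \<noteq> 0"
  using tendsto_imp_eventually_ne[OF T_tendsto, of 0] grad_pos by simp

text \<open>
  The boundary terms are of order a^2, so the mass term must balance the forcing term.
\<close>

theorem multiplier_first_order: "(\<lambda>n. c n / a n) \<longlonglongrightarrow> (\<gamma> + 1 / 2) * mass / grad"
proof -
  have "(\<lambda>n. (- (B n (1 * X n) / a n - B n (-1 * X n) / a n) - (\<gamma> + 1 / 2) * (S n (X n) - S n (- X n))) / (T n (X n) - T n (- X n)))
    \<longlonglongrightarrow> (- (0 - 0) - (\<gamma> + 1 / 2) * mass) / (- grad)"
    using grad_pos by (intro tendsto_intros B_over_a S_tendsto T_tendsto) auto
  then have "(\<lambda>n. c n / a n) \<longlonglongrightarrow> (- (0 - 0) - (\<gamma> + 1 / 2) * mass) / (- grad)"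
  proof (rule Lim_transform_eventually)
    show "\<forall>\<^sub>F n in sequentially. (- (B n (1 * X n) / a n - B n (-1 * X n) / a n) - (\<gamma> + 1 / 2) * (S n (X n) - S n (- X n))) / (T n (X n) - T n (- X n)) = c n / a n"
      using T_eventually
    proof eventually_elim
      case (elim n)
      have "(- (b / e - b' / e) - g * s) / t = d / e" if "b - b' + e * g * s + d * t = 0" "e > 0" "t \<noteq> 0"
        for b b' d e g s t :: real
      proof -
        have b': "b' = b + e * g * s + d * t" using that(1) by simp
        have "b / e - b' / e = - (g * s) - d / e * t"
          using that(2) by (simp add: b' field_simps)
        then show ?thesis using that(3) by simp
      qed
      from this[OF _ a_pos elim] mass_identity[of n] show ?case by simp
    qed
  qed
  then show ?thesis by simp
qed

text \<open>
  The mass term carries the factor \<gamma> + 1/2 = 0. As r tends to 0 on the left, so does L (-1), which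
  determines the constant of integration and hence the limit - q / 2 of L 1 on the right.
\<close>

theorem multiplier_second_order:
  assumes \<gamma>: "\<gamma> = - 1 / 2" and left: "(\<lambda>n. r n (- X n)) \<longlonglongrightarrow> 0"
  shows "(\<lambda>n. c n / (a n)\<^sup>2) \<longlonglongrightarrow> q\<^sup>2 / (8 * grad)"
proof -
  have "(\<lambda>n. (r n (-1 * X n) + L (-1) n) - r n (- X n)) \<longlonglongrightarrow> 0 - 0"
    by (intro tendsto_diff r_at_X left) simp
  then have Lm: "L (-1) \<longlonglongrightarrow> 0" by simp
  have "L 1 n = L (-1) n - q / 2" for n
  proof -
    have "L 1 n - L (-1) n = \<gamma> * q" by (simp add: L_def algebra_simps)
    also have "\<dots> = - q / 2" by (simp only: \<gamma>)
    finally show ?thesis by simp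
  qed
  then have "L 1 = (\<lambda>n. L (-1) n - q / 2)" by (rule ext)
  then have Lp: "L 1 \<longlonglongrightarrow> 0 - q / 2" using tendsto_diff[OF Lm tendsto_const[of "q / 2"]] by (simp only:)
  have Bm: "(\<lambda>n. (B n (-1 * X n) / (a n)\<^sup>2 - (L (-1) n)\<^sup>2 / 2) + (L (-1) n)\<^sup>2 / 2) \<longlonglongrightarrow> 0 + 0\<^sup>2 / 2"
    by (intro tendsto_intros B_at_X Lm) auto
  have Bp: "(\<lambda>n. (B n (1 * X n) / (a n)\<^sup>2 - (L 1 n)\<^sup>2 / 2) + (L 1 n)\<^sup>2 / 2) \<longlonglongrightarrow> 0 + (0 - q / 2)\<^sup>2 / 2"
    by (intro tendsto_intros B_at_X Lp) auto
  have "(\<lambda>n. - (B n (X n) / (a n)\<^sup>2 - B n (- X n) / (a n)\<^sup>2) / (T n (X n) - T n (- X n))) \<longlonglongrightarrow>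
      - ((0 - q / 2)\<^sup>2 / 2 - 0) / (- grad)"
  proof (rule tendsto_divide[OF tendsto_minus[OF tendsto_diff] T_tendsto])
    show "(\<lambda>n. B n (X n) / (a n)\<^sup>2) \<longlonglongrightarrow> (0 - q / 2)\<^sup>2 / 2"
      using Bp by (simp only: diff_add_cancel mult_1 add_0)
    show "(\<lambda>n. B n (- X n) / (a n)\<^sup>2) \<longlonglongrightarrow> 0" using Bm by simp
    show "- grad \<noteq> 0" using grad_pos by simp
  qed
  then have "(\<lambda>n. c n / (a n)\<^sup>2) \<longlonglongrightarrow> - ((0 - q / 2)\<^sup>2 / 2 - 0) / (- grad)"
  proof (rule Lim_transform_eventually)
    show "\<forall>\<^sub>F n in sequentially. - (B n (X n) / (a n)\<^sup>2 - B n (- X n) / (a n)\<^sup>2) / (T n (X n) - T n (- X n)) = c n / (a n)\<^sup>2"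
      using T_eventually
    proof eventually_elim
      case (elim n)
      have "- (b / e\<^sup>2 - b' / e\<^sup>2) / t = d / e\<^sup>2" if "b - b' + d * t = 0" "e > 0" "t \<noteq> 0"
        for b b' d e t :: real
      proof -
        have "d = - (b - b') / t" using that by (simp add: field_simps)
        then show ?thesis by (simp add: diff_divide_distrib mult.commute)
      qed
      moreover have "B n (X n) - B n (- X n) + c n * (T n (X n) - T n (- X n)) = 0"
      proof -
        have "a n * (\<gamma> + 1 / 2) * (S n (X n) - S n (- X n)) = 0" using assms(1) by (simp only:) simp
        then show ?thesis using mass_identity[of n] by linarith
      qed
      ultimately show ?case using a_pos[of n] elim by blast
    qed
  qed
  then show ?thesis by (simp add: power2_eq_square)
qed

end

section \<open>Profiles have zero energy\<close>

text \<open>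
  Suppose that f'^2 + x f^2 \<ge> \<delta> beyond R. Since f is square integrable, \<integral>x f^2 up to x is o(x), so
  (f f')' = f'^2 + f f'' is on average bounded below by a positive constant; then f f' and with it
  f^2 grow, which contradicts integrability.
\<close>

lemma square_integrable_vanishing_points:
  fixes f f1 f2 :: "real \<Rightarrow> real"
  assumes der: "\<And>x. (f has_real_derivative f1 x) (at x)" "\<And>x. (f1 has_real_derivative f2 x) (at x)"
    and int: "integrable lborel (\<lambda>x. (f x)\<^sup>2)"
    and lower: "\<And>\<eta>. \<eta> > 0 \<Longrightarrow> \<exists>K\<ge>0. \<forall>x\<ge>0. - K * (1 + x) * (f x)\<^sup>2 - \<eta> \<le> f x * f2 x"
    and \<delta>: "\<delta> > 0"
  shows "\<exists>x\<ge>R. (f1 x)\<^sup>2 + x * (f x)\<^sup>2 < \<delta>"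
proof (rule ccontr)
  assume "\<not> ?thesis"
  then have big: "\<delta> \<le> (f1 x)\<^sup>2 + x * (f x)\<^sup>2" if "R \<le> x" for x using that by force
  obtain K where K: "K \<ge> 0" "\<And>x. x \<ge> 0 \<Longrightarrow> - K * (1 + x) * (f x)\<^sup>2 - \<delta> / 4 \<le> f x * f2 x"
    using lower[of "\<delta> / 4"] \<delta> by auto
  define K' where "K' = 1 + 2 * K"
  have K': "K' > 0" using K by (simp add: K'_def)
  have cont_f: "isCont f x" for x using der(1) DERIV_isCont by blast
  obtain \<Phi> where \<Phi>: "\<Phi> 0 = 0" "\<And>x. (\<Phi> has_real_derivative (f x)\<^sup>2) (at x)"
    using antiderivative_exists[of "\<lambda>x. (f x)\<^sup>2"] cont_f by (metis continuous_power)
  have \<Phi>_mono: "\<Phi> x \<le> \<Phi> y" if "x \<le> y" for x y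
    using that by (rule DERIV_nonneg_imp_nondecreasing) (use \<Phi>(2) in fastforce)
  define L where "L = (LINT x|lborel. (f x)\<^sup>2)"
  have \<Phi>_le: "\<Phi> x \<le> L" if "x \<ge> 0" for x
  proof -
    have "\<Phi> x = (LINT y|lborel. (f y)\<^sup>2 * indicator {0..x} y)"
      using integral_FTC_Icc_real[OF that, of \<Phi> "\<lambda>x. (f x)\<^sup>2"] \<Phi> cont_f by simp
    also have "\<dots> \<le> L"
      unfolding L_def using int by (intro integral_mono_AE' AE_I2) (auto split: split_indicator)
    finally show ?thesis .
  qed
  \<comment> \<open>beyond R1 the mass of f^2 is at most \<tau>, so that K' x \<tau> = \<delta> x / 4 leaves \<delta> x / 2 of the gain 3 \<delta> x / 4\<close>
  define \<tau> where "\<tau> = \<delta> / (4 * K')"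
  have \<tau>: "\<tau> > 0" using \<delta> K' by (simp add: \<tau>_def)
  define s where "s = Sup (\<Phi> ` {0..})"
  have bdd: "bdd_above (\<Phi> ` {0..})" using \<Phi>_le by (auto intro!: bdd_aboveI[of _ L])
  obtain R' where R': "R' \<ge> 0" "s - \<tau> < \<Phi> R'"
    using less_cSup_iff[OF _ bdd, of "s - \<tau>"] \<tau> by (auto simp: s_def)
  define R1 where "R1 = max (max R 1) R'"
  have R1: "R \<le> R1" "1 \<le> R1" "R' \<le> R1" by (auto simp: R1_def)
  have tail: "\<Phi> x - \<Phi> R1 \<le> \<tau>" if "R1 \<le> x" for x
  proof -
    have "\<Phi> x \<le> s" unfolding s_def using that R1 by (intro cSup_upper bdd) auto
    then show ?thesis using R'(2) \<Phi>_mono[OF R1(3)] by linarith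
  qed
  \<comment> \<open>the derivative of the middle term is at least K' x f^2, which makes up for the negative terms in that of f f'\<close>
  define \<Psi> where "\<Psi> x = f x * f1 x + K' * (x * (\<Phi> x - \<Phi> R1)) - 3 / 4 * \<delta> * x" for x
  have \<Psi>_mono: "\<Psi> R1 \<le> \<Psi> x" if "R1 \<le> x" for x
    using that
  proof (rule DERIV_nonneg_imp_nondecreasing)
    fix y assume y: "R1 \<le> y" "y \<le> x"
    let ?d = "f1 y * f1 y + f x * 0 + f y * f2 y + K' * ((\<Phi> y - \<Phi> R1) + y * (f y)\<^sup>2) - 3 / 4 * \<delta>"
    have "(\<Psi> has_real_derivative ?d) (at y)"
      unfolding \<Psi>_def[abs_def] by (auto intro!: derivative_eq_intros der \<Phi>)
    moreover have "0 \<le> ?d"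
    proof -
      have "\<delta> - y * (f y)\<^sup>2 \<le> f1 y * f1 y" using big[of y] y R1 by (simp add: power2_eq_square)
      moreover have "- K * (1 + y) * (f y)\<^sup>2 - \<delta> / 4 \<le> f y * f2 y" using K(2)[of y] y R1 by simp
      moreover have "K * (1 + y) * (f y)\<^sup>2 \<le> K * (2 * y) * (f y)\<^sup>2"
        using y R1 K by (intro mult_right_mono mult_left_mono) auto
      moreover have "0 \<le> K' * (\<Phi> y - \<Phi> R1)" using K' \<Phi>_mono[OF y(1)] by simp
      ultimately show ?thesis by (simp add: K'_def algebra_simps)
    qed
    ultimately show "\<exists>d. (\<Psi> has_real_derivative d) (at y) \<and> 0 \<le> d" by blast
  qed
  have D_ge: "\<Psi> R1 + \<delta> / 2 * x \<le> f x * f1 x" if "R1 \<le> x" for x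
  proof -
    have "K' * (x * (\<Phi> x - \<Phi> R1)) \<le> K' * (x * \<tau>)"
      using tail[OF that] that R1 K' by (intro mult_left_mono) auto
    also have "\<dots> = \<delta> / 4 * x" using K' by (simp add: \<tau>_def)
    finally show ?thesis using \<Psi>_mono[OF that] unfolding \<Psi>_def[of x] by simp
  qed
  define R2 where "R2 = max R1 ((1 - \<Psi> R1) * 2 / \<delta>)"
  have R2: "R1 \<le> R2" by (simp add: R2_def)
  have D1: "1 \<le> f x * f1 x" if "R2 \<le> x" for x
  proof -
    have "(1 - \<Psi> R1) * 2 / \<delta> \<le> x" using that by (simp add: R2_def)
    then have "1 - \<Psi> R1 \<le> \<delta> / 2 * x" using \<delta> by (simp add: field_simps)
    then show ?thesis using D_ge[of x] that R2 by linarith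
  qed
  have f_ge: "1 \<le> (f x)\<^sup>2" if "R2 + 1 \<le> x" for x
  proof -
    have "(f R2)\<^sup>2 - R2 \<le> (f x)\<^sup>2 - x"
    proof (rule DERIV_nonneg_imp_nondecreasing[of R2 x "\<lambda>y. (f y)\<^sup>2 - y"])
      fix y assume y: "R2 \<le> y"
      have "((\<lambda>y. (f y)\<^sup>2 - y) has_real_derivative 2 * (f y * f1 y) - 1) (at y)"
        by (auto intro!: derivative_eq_intros der)
      moreover have "0 \<le> 2 * (f y * f1 y) - 1" using D1[OF y] by linarith
      ultimately show "\<exists>d. ((\<lambda>y. (f y)\<^sup>2 - y) has_real_derivative d) (at y) \<and> 0 \<le> d" by blast
    qed (use that in simp)
    moreover have "0 \<le> (f R2)\<^sup>2" by simp
    ultimately show ?thesis using that by linarith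
  qed
  have L0: "0 \<le> L" using \<Phi>_le[of 0] \<Phi>(1) by simp
  have "\<Phi> (R2 + 1) - (R2 + 1) \<le> \<Phi> (R2 + 2 + L) - (R2 + 2 + L)"
  proof (rule DERIV_nonneg_imp_nondecreasing[of "R2 + 1" "R2 + 2 + L" "\<lambda>y. \<Phi> y - y"])
    fix y assume y: "R2 + 1 \<le> y"
    have "((\<lambda>y. \<Phi> y - y) has_real_derivative (f y)\<^sup>2 - 1) (at y)"
      by (auto intro!: derivative_eq_intros \<Phi>)
    moreover have "0 \<le> (f y)\<^sup>2 - 1" using f_ge[OF y] by linarith
    ultimately show "\<exists>d. ((\<lambda>y. \<Phi> y - y) has_real_derivative d) (at y) \<and> 0 \<le> d" by blast
  qed (use L0 in simp)
  moreover have "0 \<le> \<Phi> (R2 + 1)" using \<Phi>_mono[of 0 "R2 + 1"] R2 R1 \<Phi>(1) by simp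
  moreover have "\<Phi> (R2 + 2 + L) \<le> L" using \<Phi>_le[of "R2 + 2 + L"] R2 R1 L0 by simp
  ultimately show False by linarith
qed

lemma square_integrable_vanishing_sequence:
  fixes f f1 f2 :: "real \<Rightarrow> real"
  assumes der: "\<And>x. (f has_real_derivative f1 x) (at x)" "\<And>x. (f1 has_real_derivative f2 x) (at x)"
    and int: "integrable lborel (\<lambda>x. (f x)\<^sup>2)"
    and lower: "\<And>\<eta>. \<eta> > 0 \<Longrightarrow> \<exists>K\<ge>0. \<forall>x. - K * (1 + \<bar>x\<bar>) * (f x)\<^sup>2 - \<eta> \<le> f x * f2 x"
  obtains X Y where "filterlim X at_top sequentially" "filterlim Y at_bot sequentially"
    "(\<lambda>n::nat. (f1 (X n))\<^sup>2 + \<bar>X n\<bar> * (f (X n))\<^sup>2) \<longlonglongrightarrow> 0"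
    "(\<lambda>n::nat. (f1 (Y n))\<^sup>2 + \<bar>Y n\<bar> * (f (Y n))\<^sup>2) \<longlonglongrightarrow> 0"
proof -
  have lim: "(\<lambda>n::nat. g n) \<longlonglongrightarrow> 0" if "\<And>n. 0 \<le> g n" "\<And>n. g n < 1 / (real n + 1)" for g :: "nat \<Rightarrow> real"
  proof (rule Lim_null_comparison)
    show "(\<lambda>n::nat. 1 / (real n + 1)) \<longlonglongrightarrow> 0" by real_asymp
    show "\<forall>\<^sub>F n in sequentially. norm (g n) \<le> 1 / (real n + 1)"
      using that less_imp_le by (intro always_eventually) auto
  qed
  have "\<exists>x\<ge>real n. (f1 x)\<^sup>2 + x * (f x)\<^sup>2 < 1 / (real n + 1)" for n :: nat
  proof (rule square_integrable_vanishing_points[OF der int])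
    fix \<eta> :: real assume "\<eta> > 0"
    then obtain K where "K \<ge> 0" "\<And>x. - K * (1 + \<bar>x\<bar>) * (f x)\<^sup>2 - \<eta> \<le> f x * f2 x" using lower by blast
    then show "\<exists>K\<ge>0. \<forall>x\<ge>0. - K * (1 + x) * (f x)\<^sup>2 - \<eta> \<le> f x * f2 x"
      by (intro exI[of _ K]) (metis abs_of_nonneg)
  qed simp
  then obtain X where X: "\<And>n::nat. X n \<ge> real n" "\<And>n. (f1 (X n))\<^sup>2 + X n * (f (X n))\<^sup>2 < 1 / (real n + 1)"
    by metis
  have "\<exists>x\<ge>real n. (- f1 (- x))\<^sup>2 + x * (f (- x))\<^sup>2 < 1 / (real n + 1)" for n :: nat
  proof (rule square_integrable_vanishing_points[of "\<lambda>x. f (- x)" "\<lambda>x. - f1 (- x)" "\<lambda>x. f2 (- x)"])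
    show "((\<lambda>x. f (- x)) has_real_derivative - f1 (- x)) (at x)" for x
      using DERIV_chain'[OF DERIV_minus[OF DERIV_ident] der(1), of x] by simp
    show "((\<lambda>x. - f1 (- x)) has_real_derivative f2 (- x)) (at x)" for x
      using DERIV_minus[OF DERIV_chain'[OF DERIV_minus[OF DERIV_ident] der(2), of x]] by simp
    show "integrable lborel (\<lambda>x. (f (- x))\<^sup>2)"
      using lborel_integrable_real_affine[OF int, of "-1" 0] by simp
    fix \<eta> :: real assume "\<eta> > 0"
    then obtain K where K: "K \<ge> 0" "\<And>x. - K * (1 + \<bar>x\<bar>) * (f x)\<^sup>2 - \<eta> \<le> f x * f2 x" using lower by blast
    have "- K * (1 + x) * (f (- x))\<^sup>2 - \<eta> \<le> f (- x) * f2 (- x)" if "x \<ge> 0" for x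
      using K(2)[of "- x"] that by simp
    with K(1) show "\<exists>K\<ge>0. \<forall>x\<ge>0. - K * (1 + x) * (f (- x))\<^sup>2 - \<eta> \<le> f (- x) * f2 (- x)" by blast
  qed simp
  then obtain Y where Y: "\<And>n::nat. Y n \<ge> real n" "\<And>n. (f1 (- Y n))\<^sup>2 + Y n * (f (- Y n))\<^sup>2 < 1 / (real n + 1)"
    unfolding power2_minus by metis
  have XY: "\<bar>X n\<bar> = X n" "\<bar>Y n\<bar> = Y n" "0 \<le> X n" "0 \<le> Y n" for n
    using X(1)[of n] Y(1)[of n] by auto
  have top: "filterlim Z at_top sequentially" if "\<And>n::nat. real n \<le> Z n" for Z :: "nat \<Rightarrow> real"
    by (rule filterlim_at_top_mono[OF filterlim_real_sequentially]) (use that in auto)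
  show ?thesis
  proof (rule that[of X "\<lambda>n. - Y n"])
    show "filterlim X at_top sequentially" by (rule top[OF X(1)])
    show "filterlim (\<lambda>n. - Y n) at_bot sequentially"
      using top[OF Y(1)] by (simp add: filterlim_uminus_at_top)
    show "(\<lambda>n. (f1 (X n))\<^sup>2 + \<bar>X n\<bar> * (f (X n))\<^sup>2) \<longlonglongrightarrow> 0"
      using X(2) XY by (intro lim) auto
    show "(\<lambda>n. (f1 (- Y n))\<^sup>2 + \<bar>- Y n\<bar> * (f (- Y n))\<^sup>2) \<longlonglongrightarrow> 0"
      using Y(2) XY by (intro lim) auto
  qed
qed

text \<open>
  The profile equation multiplied by -v'' - v^(p+1); the function B in the proof is the resulting
  antiderivative of - a (p + 4) / p times the energy density. The equation also bounds v' v'''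
  from below, which provides the points of \<open>square_integrable_vanishing_sequence\<close>, along
  which B tends to 0.
\<close>

lemma profile_zero_energy:
  fixes v v1 v2 v3 :: "real \<Rightarrow> real" and a p C :: real
  assumes a: "a > 0" and p: "p > 0"
    and der: "\<And>x. (v has_real_derivative v1 x) (at x)" "\<And>x. (v1 has_real_derivative v2 x) (at x)"
      "\<And>x. (v2 has_real_derivative v3 x) (at x)"
    and pos: "\<And>x. v x > 0"
    and decay: "\<And>x. (1 + a * \<bar>x\<bar>) powr (2 / p) * v x \<le> C"
    and int: "integrable lborel (\<lambda>x. (v1 x)\<^sup>2)"
    and eq: "\<And>x. a * (2 / p * v x + x * v1 x) - v3 x + v1 x - (p + 1) * v x powr p * v1 x = 0"
  shows "has_bochner_integral lborel (\<lambda>x. 1 / 2 * (v1 x)\<^sup>2 - 1 / (p + 2) * v x powr (p + 2)) 0"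
proof -
  define w where "w x = v x powr p" for x
  have w: "0 < w x" for x using pos[of x] by (simp add: w_def)
  have C: "0 < C" using decay[of 0] pos[of 0] by simp
  have base: "1 \<le> 1 + a * \<bar>x\<bar>" for x using a by simp
  have v_le: "v x \<le> C * (1 + a * \<bar>x\<bar>) powr (- 2 / p)" for x
    using decay[of x] base[of x] by (simp add: powr_minus field_simps)
  have v_le_C: "v x \<le> C" for x
  proof -
    have "1 * v x \<le> (1 + a * \<bar>x\<bar>) powr (2 / p) * v x"
      using pos[of x] p base[of x] by (intro mult_right_mono ge_one_powr_ge_zero) auto
    then show ?thesis using decay[of x] by simp
  qed
  have w_le: "w x \<le> C powr p" for x
    using v_le_C[of x] pos[of x] p unfolding w_def by (intro powr_mono2) auto
  have E_eq: "v x powr (p + 2) = w x * (v x)\<^sup>2" for x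
    using pos[of x] by (simp add: powr_add w_def)
  have E_le: "w x * (v x)\<^sup>2 \<le> C powr (p + 2) * (1 / (1 + a * \<bar>x\<bar>)\<^sup>2)" for x
  proof -
    have "v x powr (p + 2) \<le> (C * (1 + a * \<bar>x\<bar>) powr (- 2 / p)) powr (p + 2)"
      using v_le[of x] pos[of x] p by (intro powr_mono2) auto
    also have "\<dots> = C powr (p + 2) * (1 + a * \<bar>x\<bar>) powr (- 2 / p * (p + 2))"
      using C by (simp add: powr_mult powr_powr)
    also have "(1 + a * \<bar>x\<bar>) powr (- 2 / p * (p + 2)) \<le> (1 + a * \<bar>x\<bar>) powr (- 2)"
      using base[of x] p by (intro powr_mono) (auto simp: field_simps)
    also have "(1 + a * \<bar>x\<bar>) powr (- 2) = 1 / (1 + a * \<bar>x\<bar>)\<^sup>2"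
      using base[of x] by (simp add: powr_minus_divide powr_numeral)
    finally show ?thesis using C by (simp add: E_eq mult_left_mono)
  qed
  have cont: "isCont v x" "isCont v1 x" "isCont v2 x" for x
    using der DERIV_isCont by blast+
  have cont_w: "isCont w x" for x
    unfolding w_def[abs_def] using cont(1) pos[of x] by (intro continuous_intros) auto
  have int_E: "integrable lborel (\<lambda>x. w x * (v x)\<^sup>2)"
  proof (rule Bochner_Integration.integrable_bound)
    show "integrable lborel (\<lambda>x. C powr (p + 2) * (1 / (1 + (a * x)\<^sup>2)))"
      by (intro integrable_mult_right integrable_inverse_one_plus_square a)
    have "continuous_on UNIV (\<lambda>x. w x * (v x)\<^sup>2)"
      by (intro continuous_at_imp_continuous_on ballI continuous_intros cont cont_w)
    then show "(\<lambda>x. w x * (v x)\<^sup>2) \<in> borel_measurable lborel" by (simp add: borel_measurable_continuous_onI)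
    show "AE x in lborel. norm (w x * (v x)\<^sup>2) \<le> norm (C powr (p + 2) * (1 / (1 + (a * x)\<^sup>2)))"
    proof (rule AE_I2)
      fix x
      have "(1 + a * \<bar>x\<bar>)\<^sup>2 = 1 + 2 * (a * \<bar>x\<bar>) + (a * x)\<^sup>2"
        by (simp add: power2_eq_square algebra_simps)
      then have le: "1 + (a * x)\<^sup>2 \<le> (1 + a * \<bar>x\<bar>)\<^sup>2" using a by simp
      have "norm (w x * (v x)\<^sup>2) = w x * (v x)\<^sup>2" using w[of x] by simp
      also note E_le[of x]
      also have "C powr (p + 2) * (1 / (1 + a * \<bar>x\<bar>)\<^sup>2) \<le> C powr (p + 2) * (1 / (1 + (a * x)\<^sup>2))"
        by (intro mult_left_mono divide_left_mono le) (auto intro!: mult_pos_pos add_pos_nonneg zero_less_power simp: a less_imp_le)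
      also have "\<dots> \<le> norm \<dots>" by simp
      finally show "norm (w x * (v x)\<^sup>2) \<le> norm (C powr (p + 2) * (1 / (1 + (a * x)\<^sup>2)))" .
    qed
  qed
  define e where "e x = 1 / 2 * (v1 x)\<^sup>2 - 1 / (p + 2) * (w x * (v x)\<^sup>2)" for x
  have int_e: "integrable lborel e"
    unfolding e_def[abs_def] by (intro Bochner_Integration.integrable_diff integrable_mult_right int int_E)
  define B where "B x = a * (- (2 / p) * (v x * v1 x) - 1 / 2 * (x * (v1 x)\<^sup>2) - 1 / (p + 2) * (x * (w x * (v x)\<^sup>2)))
      + 1 / 2 * (v2 x + w x * v x)\<^sup>2 - 1 / 2 * (v1 x)\<^sup>2 - 1 / (p + 2) * (w x * (v x)\<^sup>2)" for x
  have B_der: "(B has_real_derivative - (a * (p + 4) / p) * e x) (at x)" for x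
  proof -
    have d1: "((\<lambda>x. w x * v x) has_real_derivative (p + 1) * w x * v1 x) (at x)"
      and d2: "((\<lambda>x. w x * (v x)\<^sup>2) has_real_derivative (p + 2) * (w x * v x * v1 x)) (at x)"
      using DERIV_powr_times[OF der(1) pos] by (simp_all add: w_def[abs_def])
    define H E where "H x = w x * v x" and "E x = w x * (v x)\<^sup>2" for x
    have B_HE: "B = (\<lambda>x. a * (- (2 / p) * (v x * v1 x) - 1 / 2 * (x * (v1 x)\<^sup>2) - 1 / (p + 2) * (x * E x))
        + 1 / 2 * (v2 x + H x)\<^sup>2 - 1 / 2 * (v1 x)\<^sup>2 - 1 / (p + 2) * E x)"
      by (simp add: B_def[abs_def] H_def E_def)
    have "(B has_real_derivative
        a * (- (2 / p) * (v1 x * v1 x + v x * v2 x) - 1 / 2 * ((v1 x)\<^sup>2 + x * (2 * v1 x * v2 x))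
          - 1 / (p + 2) * (w x * (v x)\<^sup>2 + x * ((p + 2) * (w x * v x * v1 x))))
      + (v2 x + w x * v x) * (v3 x + (p + 1) * w x * v1 x) - v1 x * v2 x
      - 1 / (p + 2) * ((p + 2) * (w x * v x * v1 x))) (at x)"
      unfolding B_HE
      by (rule derivative_eq_intros der d1[folded H_def] d2[folded E_def] refl)+
         (simp add: H_def E_def algebra_simps power2_eq_square)
    also have "v3 x + (p + 1) * w x * v1 x = a * (2 / p * v x + x * v1 x) + v1 x"
      using eq[of x] by (simp add: w_def)
    also have "a * (- (2 / p) * (v1 x * v1 x + v x * v2 x) - 1 / 2 * ((v1 x)\<^sup>2 + x * (2 * v1 x * v2 x))
          - 1 / (p + 2) * (w x * (v x)\<^sup>2 + x * ((p + 2) * (w x * v x * v1 x))))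
      + (v2 x + w x * v x) * (a * (2 / p * v x + x * v1 x) + v1 x) - v1 x * v2 x
      - 1 / (p + 2) * ((p + 2) * (w x * v x * v1 x)) = - (a * (p + 4) / p) * e x"
    proof -
      have "p + 2 \<noteq> 0" "p \<noteq> 0" using p by auto
      then show ?thesis unfolding e_def by (simp add: divide_simps) algebra
    qed
    finally show ?thesis .
  qed
  have lower: "\<exists>K\<ge>0. \<forall>x. - K * (1 + \<bar>x\<bar>) * (v1 x)\<^sup>2 - \<eta> \<le> v1 x * v3 x" if \<eta>: "\<eta> > 0" for \<eta>
  proof -
    define b where "b = a * (2 / p) * C"
    have b: "0 < b" using a p C by (simp add: b_def)
    define \<beta> where "\<beta> = b\<^sup>2 / (4 * \<eta>)"
    have \<beta>: "0 \<le> \<beta>" using \<eta> by (simp add: \<beta>_def)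
    define K where "K = \<beta> + a + (p + 1) * C powr p"
    have K: "K \<ge> 0" using a p \<beta> by (simp add: K_def add_nonneg_nonneg)
    have "- K * (1 + \<bar>x\<bar>) * (v1 x)\<^sup>2 - \<eta> \<le> v1 x * v3 x" for x
    proof -
      have v3: "v3 x = a * (2 / p) * v x + (a * x + 1 - (p + 1) * w x) * v1 x"
        using eq[of x] by (simp add: w_def algebra_simps)
      have "- (b * \<bar>v1 x\<bar>) \<le> a * (2 / p) * v x * v1 x"
      proof -
        have "\<bar>a * (2 / p) * v x * v1 x\<bar> = a * (2 / p) * v x * \<bar>v1 x\<bar>"
          using a p pos[of x] by (simp add: abs_mult)
        also have "\<dots> \<le> b * \<bar>v1 x\<bar>"
          unfolding b_def using a p v_le_C[of x] by (intro mult_right_mono mult_left_mono) auto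
        finally show ?thesis by linarith
      qed
      moreover have "b * \<bar>v1 x\<bar> \<le> \<beta> * (v1 x)\<^sup>2 + \<eta>"
      proof -
        have "0 \<le> (b * \<bar>v1 x\<bar> - 2 * \<eta>)\<^sup>2" by simp
        then have "4 * \<eta> * (b * \<bar>v1 x\<bar>) \<le> b\<^sup>2 * (v1 x)\<^sup>2 + 4 * \<eta> * \<eta>"
          by (simp add: power2_eq_square algebra_simps)
        then show ?thesis using \<eta> by (simp add: \<beta>_def field_simps)
      qed
      moreover have "- (a * \<bar>x\<bar> + (p + 1) * C powr p) * (v1 x)\<^sup>2 \<le> (a * x + 1 - (p + 1) * w x) * (v1 x)\<^sup>2"
      proof (rule mult_right_mono)
        have "a * - \<bar>x\<bar> \<le> a * x" using a by (intro mult_left_mono) auto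
        moreover have "(p + 1) * w x \<le> (p + 1) * C powr p" using p w_le[of x] by (intro mult_left_mono) auto
        ultimately show "- (a * \<bar>x\<bar> + (p + 1) * C powr p) \<le> a * x + 1 - (p + 1) * w x" by simp
      qed simp
      moreover have "(\<beta> + (a * \<bar>x\<bar> + (p + 1) * C powr p)) * (v1 x)\<^sup>2 \<le> K * (1 + \<bar>x\<bar>) * (v1 x)\<^sup>2"
      proof (rule mult_right_mono)
        have "0 \<le> (\<beta> + (p + 1) * C powr p) * \<bar>x\<bar>" using \<beta> p by simp
        then show "\<beta> + (a * \<bar>x\<bar> + (p + 1) * C powr p) \<le> K * (1 + \<bar>x\<bar>)"
          using a unfolding K_def by (simp add: algebra_simps)
      qed simp
      moreover have "v1 x * v3 x = a * (2 / p) * v x * v1 x + (a * x + 1 - (p + 1) * w x) * (v1 x)\<^sup>2"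
        unfolding v3 by (simp add: algebra_simps power2_eq_square)
      ultimately show ?thesis by (simp add: algebra_simps)
    qed
    with K show ?thesis by blast
  qed
  obtain X Y where XY: "filterlim X at_top sequentially" "filterlim Y at_bot sequentially"
    "(\<lambda>n::nat. (v2 (X n))\<^sup>2 + \<bar>X n\<bar> * (v1 (X n))\<^sup>2) \<longlonglongrightarrow> 0"
    "(\<lambda>n::nat. (v2 (Y n))\<^sup>2 + \<bar>Y n\<bar> * (v1 (Y n))\<^sup>2) \<longlonglongrightarrow> 0"
    using square_integrable_vanishing_sequence[OF der(2,3) int lower] by blast
  have B_lim: "(\<lambda>n. B (z n)) \<longlonglongrightarrow> 0"
    if z: "filterlim (\<lambda>n. \<bar>z n\<bar>) at_top sequentially"
      "(\<lambda>n. (v2 (z n))\<^sup>2 + \<bar>z n\<bar> * (v1 (z n))\<^sup>2) \<longlonglongrightarrow> 0" for z :: "nat \<Rightarrow> real"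
  proof -
    have zero_by: "g \<longlonglongrightarrow> 0" if "\<forall>\<^sub>F n in sequentially. norm (g n) \<le> h n" "h \<longlonglongrightarrow> 0" for g h :: "nat \<Rightarrow> real"
      by (rule Lim_null_comparison[OF that])
    have z1: "\<forall>\<^sub>F n in sequentially. 1 \<le> \<bar>z n\<bar>" using z(1) by (simp add: filterlim_at_top)
    have t2: "(\<lambda>n. (v2 (z n))\<^sup>2) \<longlonglongrightarrow> 0"
      by (rule zero_by[OF always_eventually z(2)]) auto
    have tx1: "(\<lambda>n. \<bar>z n\<bar> * (v1 (z n))\<^sup>2) \<longlonglongrightarrow> 0"
      by (rule zero_by[OF always_eventually z(2)]) auto
    have tx: "(\<lambda>n. z n * (v1 (z n))\<^sup>2) \<longlonglongrightarrow> 0"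
      by (rule zero_by[OF always_eventually tx1]) (auto simp: abs_mult)
    have t1: "(\<lambda>n. (v1 (z n))\<^sup>2) \<longlonglongrightarrow> 0"
    proof (rule zero_by[OF _ tx1])
      show "\<forall>\<^sub>F n in sequentially. norm ((v1 (z n))\<^sup>2) \<le> \<bar>z n\<bar> * (v1 (z n))\<^sup>2"
        using z1 by eventually_elim (use mult_right_mono in fastforce)
    qed
    have l1: "(\<lambda>n. v1 (z n)) \<longlonglongrightarrow> 0" and l2: "(\<lambda>n. v2 (z n)) \<longlonglongrightarrow> 0"
      using tendsto_real_sqrt[OF t1] tendsto_real_sqrt[OF t2] by (simp_all add: tendsto_rabs_zero_iff)
    have lv: "(\<lambda>n. v (z n)) \<longlonglongrightarrow> 0"
    proof (rule zero_by[OF always_eventually])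
      show "\<forall>n. norm (v (z n)) \<le> C * (1 + a * \<bar>z n\<bar>) powr (- 2 / p)"
        using v_le pos by (auto simp: abs_of_pos)
      have "((\<lambda>t. C * (1 + a * t) powr (- 2 / p)) \<longlongrightarrow> 0) at_top" using a p by real_asymp
      from filterlim_compose[OF this z(1)]
      show "(\<lambda>n. C * (1 + a * \<bar>z n\<bar>) powr (- 2 / p)) \<longlonglongrightarrow> 0" .
    qed
    have lxE: "(\<lambda>n. z n * (w (z n) * (v (z n))\<^sup>2)) \<longlonglongrightarrow> 0"
    proof (rule zero_by[OF always_eventually])
      show "\<forall>n. norm (z n * (w (z n) * (v (z n))\<^sup>2)) \<le> \<bar>z n\<bar> * (C powr (p + 2) * (1 / (1 + a * \<bar>z n\<bar>)\<^sup>2))"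
      proof
        fix n
        have "norm (z n * (w (z n) * (v (z n))\<^sup>2)) = \<bar>z n\<bar> * (w (z n) * (v (z n))\<^sup>2)"
          using w[of "z n"] by (simp add: abs_mult)
        also have "\<dots> \<le> \<bar>z n\<bar> * (C powr (p + 2) * (1 / (1 + a * \<bar>z n\<bar>)\<^sup>2))"
          by (intro mult_left_mono E_le) simp
        finally show "norm (z n * (w (z n) * (v (z n))\<^sup>2)) \<le> \<bar>z n\<bar> * (C powr (p + 2) * (1 / (1 + a * \<bar>z n\<bar>)\<^sup>2))" .
      qed
      have "((\<lambda>t. t * (C powr (p + 2) * (1 / (1 + a * t)\<^sup>2))) \<longlongrightarrow> 0) at_top" using a by real_asymp
      from filterlim_compose[OF this z(1)]
      show "(\<lambda>n. \<bar>z n\<bar> * (C powr (p + 2) * (1 / (1 + a * \<bar>z n\<bar>)\<^sup>2))) \<longlonglongrightarrow> 0" .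
    qed
    have lwv: "(\<lambda>n. w (z n) * v (z n)) \<longlonglongrightarrow> 0"
    proof (rule zero_by[OF always_eventually])
      show "\<forall>n. norm (w (z n) * v (z n)) \<le> C powr p * v (z n)"
        using w_le w pos by (auto simp: abs_mult abs_of_pos intro!: mult_right_mono less_imp_le)
      show "(\<lambda>n. C powr p * v (z n)) \<longlonglongrightarrow> 0" using tendsto_mult[OF tendsto_const lv] by simp
    qed
    have lE: "(\<lambda>n. w (z n) * (v (z n))\<^sup>2) \<longlonglongrightarrow> 0"
      using tendsto_mult[OF lwv lv] by (simp add: power2_eq_square mult.assoc)
    have "(\<lambda>n. B (z n)) \<longlonglongrightarrow> a * (- (2 / p) * (0 * 0) - 1 / 2 * 0 - 1 / (p + 2) * 0)
        + 1 / 2 * (0 + 0)\<^sup>2 - 1 / 2 * 0 - 1 / (p + 2) * 0"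
      unfolding B_def by (intro tendsto_intros lv l1 l2 tx lxE lwv t1 lE)
    then show ?thesis by simp
  qed
  have "filterlim (\<lambda>n. \<bar>X n\<bar>) at_top sequentially" "filterlim (\<lambda>n. \<bar>Y n\<bar>) at_top sequentially"
  proof -
    show "filterlim (\<lambda>n. \<bar>X n\<bar>) at_top sequentially"
      by (rule filterlim_at_top_mono[OF XY(1)]) (auto intro!: always_eventually)
    have "filterlim (\<lambda>n. - Y n) at_top sequentially"
      using XY(2) by (simp add: filterlim_uminus_at_bot)
    then show "filterlim (\<lambda>n. \<bar>Y n\<bar>) at_top sequentially"
      by (rule filterlim_at_top_mono) (auto intro!: always_eventually)
  qed
  then have "(\<lambda>n. B (X n)) \<longlonglongrightarrow> 0" "(\<lambda>n. B (Y n)) \<longlonglongrightarrow> 0"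
    using B_lim XY(3,4) by auto
  then have "(\<lambda>n. B (X n) - B (Y n)) \<longlonglongrightarrow> 0" using tendsto_diff by fastforce
  moreover have "(\<lambda>n. B (X n) - B (Y n)) \<longlonglongrightarrow> (LINT x|lborel. - (a * (p + 4) / p) * e x)"
  proof (rule antiderivative_tendsto_integral[OF _ _ B_der XY(1,2)])
    show "integrable lborel (\<lambda>x. - (a * (p + 4) / p) * e x)" by (intro integrable_mult_right int_e)
    show "isCont (\<lambda>x. - (a * (p + 4) / p) * e x) x" for x
      unfolding e_def by (intro continuous_intros cont cont_w)
  qed
  ultimately have "(LINT x|lborel. - (a * (p + 4) / p) * e x) = 0" by (rule LIMSEQ_unique[symmetric])
  then have "(LINT x|lborel. e x) = 0" using a p by (simp only: integral_mult_right_zero) auto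
  with int_e have "has_bochner_integral lborel e 0" by (simp add: has_bochner_integral_iff)
  then show ?thesis by (simp add: e_def[abs_def] E_eq)
qed

section \<open>The branch of zero-energy profiles\<close>

locale profile_branch =
  fixes q \<epsilon>0 :: real and u :: "real \<Rightarrow> real \<Rightarrow> real \<Rightarrow> real \<Rightarrow> real"
  assumes q: "q > 4" and eps0: "\<epsilon>0 > 0" and fam: "profile_family q \<epsilon>0 u"
begin

abbreviation "\<Omega> \<equiv> family_dom q \<epsilon>0"
abbreviation "\<D> \<equiv> param_dom q \<epsilon>0"

definition U :: "real \<times> real \<times> real \<times> real \<Rightarrow> real" where
  "U = (\<lambda>(a, \<gamma>, p, x). u a \<gamma> p x)"

text \<open>
  The k-th derivative in x, as a function on the whole domain, so that its smoothness in the
  parameters is at hand.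
\<close>

definition Ux :: "nat \<Rightarrow> real \<times> real \<times> real \<times> real \<Rightarrow> real" where
  "Ux k = (dir_deriv \<Omega> (0, 0, 0, 1) ^^ k) U"

lemma U_apply [simp]: "U (a, \<gamma>, p, x) = u a \<gamma> p x" by (simp add: U_def)
lemma Ux_0: "Ux 0 = U" by (simp add: Ux_def)
lemma Ux_Suc: "Ux (Suc k) = dir_deriv \<Omega> (0, 0, 0, 1) (Ux k)" by (simp add: Ux_def)

lemma Omega_iff: "(a, \<gamma>, p, x) \<in> \<Omega> \<longleftrightarrow> (a, \<gamma>, p) \<in> \<D>"
  by (simp add: family_dom_def)

lemma Omega_eq: "\<Omega> = {0..<\<epsilon>0} \<times> ({- 1 / 2 - \<epsilon>0<..<- 1 / 2 + \<epsilon>0} \<times> ({3..q} \<times> UNIV))"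
  by (auto simp: family_dom_def param_dom_def abs_less_iff)

lemma thick_Omega: "axis_thick \<Omega>"
  unfolding Omega_eq using q
  by (intro axis_thick_Times axis_thick_half_open axis_thick_open axis_thick_real_interval[of _ 3 4])
     (auto simp: is_interval_1)

lemma smooth_U: "smooth_on \<Omega> U"
  using fam by (simp add: profile_family_def U_def)

lemma smooth_Ux: "smooth_on \<Omega> (Ux k)"
  by (induction k) (auto simp: Ux_0 Ux_Suc smooth_U smooth_on_dir_deriv)

lemma param_pos: "(a, \<gamma>, p) \<in> \<D> \<Longrightarrow> p > 0" "(a, \<gamma>, p) \<in> \<D> \<Longrightarrow> 0 \<le> a"
  by (auto simp: param_dom_def)

lemma u_pos: "(a, \<gamma>, p) \<in> \<D> \<Longrightarrow> u a \<gamma> p x > 0"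
  using fam by (auto simp: profile_family_def)

lemma DERIV_Ux:
  assumes "(a, \<gamma>, p) \<in> \<D>"
  shows "((\<lambda>x. Ux k (a, \<gamma>, p, x)) has_real_derivative Ux (Suc k) (a, \<gamma>, p, x)) (at x)"
  using dir_deriv_partial[OF smooth_Ux, of "(a, \<gamma>, p, x)" UNIV x "(0, 0, 0, 1)" k] assms
  by (simp add: Omega_iff Ux_Suc has_real_derivative_iff_has_vector_derivative)

lemma DERIV_u:
  assumes "(a, \<gamma>, p) \<in> \<D>"
  shows "(u a \<gamma> p has_real_derivative Ux 1 (a, \<gamma>, p, x)) (at x)"
    "((\<lambda>x. Ux 1 (a, \<gamma>, p, x)) has_real_derivative Ux 2 (a, \<gamma>, p, x)) (at x)"
    "((\<lambda>x. Ux 2 (a, \<gamma>, p, x)) has_real_derivative Ux 3 (a, \<gamma>, p, x)) (at x)"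
  using DERIV_Ux[OF assms, of 0 x] DERIV_Ux[OF assms, of 1 x] DERIV_Ux[OF assms, of 2 x]
  by (simp_all add: Ux_0 numeral_2_eq_2 numeral_3_eq_3)

lemma deriv_u:
  assumes "(a, \<gamma>, p) \<in> \<D>"
  shows "deriv (u a \<gamma> p) = (\<lambda>x. Ux 1 (a, \<gamma>, p, x))" "(deriv ^^ 3) (u a \<gamma> p) = (\<lambda>x. Ux 3 (a, \<gamma>, p, x))"
proof -
  note D = DERIV_u[OF assms, THEN DERIV_imp_deriv]
  show 1: "deriv (u a \<gamma> p) = (\<lambda>x. Ux 1 (a, \<gamma>, p, x))" by (rule ext) (rule D(1))
  have "deriv (\<lambda>x. Ux 1 (a, \<gamma>, p, x)) = (\<lambda>x. Ux 2 (a, \<gamma>, p, x))" by (rule ext) (rule D(2))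
  moreover have "deriv (\<lambda>x. Ux 2 (a, \<gamma>, p, x)) = (\<lambda>x. Ux 3 (a, \<gamma>, p, x))" by (rule ext) (rule D(3))
  ultimately show "(deriv ^^ 3) (u a \<gamma> p) = (\<lambda>x. Ux 3 (a, \<gamma>, p, x))"
    by (simp add: numeral_3_eq_3 1)
qed

lemma deriv_nonlinearity:
  assumes "(a, \<gamma>, p) \<in> \<D>"
  shows "deriv (\<lambda>y. \<bar>u a \<gamma> p y\<bar> powr p * u a \<gamma> p y) x = (p + 1) * u a \<gamma> p x powr p * Ux 1 (a, \<gamma>, p, x)"
proof -
  have "\<bar>u a \<gamma> p y\<bar> = u a \<gamma> p y" for y using u_pos[OF assms] by (simp add: abs_of_pos)
  then show ?thesis
    using DERIV_imp_deriv[OF DERIV_powr_times(1)[OF DERIV_u(1)[OF assms] u_pos[OF assms]]] by simp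
qed

definition multiplier :: "real \<Rightarrow> real \<Rightarrow> real \<Rightarrow> real" where
  "multiplier a \<gamma> p = L2_inner (deriv (soliton p)) (u a \<gamma> p)"

lemma deriv2_soliton: "p > 0 \<Longrightarrow> (deriv ^^ 2) (soliton p) = soliton2 p"
  by (simp add: numeral_2_eq_2 deriv_soliton)

lemma forced_equation:
  assumes "(a, \<gamma>, p) \<in> \<D>"
  shows "a * ((1 + \<gamma>) * u a \<gamma> p x + x * Ux 1 (a, \<gamma>, p, x)) - Ux 3 (a, \<gamma>, p, x) + Ux 1 (a, \<gamma>, p, x)
    - (p + 1) * u a \<gamma> p x powr p * Ux 1 (a, \<gamma>, p, x) + multiplier a \<gamma> p * soliton2 p x = 0"
proof -
  have "solves_forced_eq a \<gamma> p (u a \<gamma> p)" using fam assms by (auto simp: profile_family_def)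
  then show ?thesis
    unfolding solves_forced_eq_def deriv_u[OF assms] deriv_nonlinearity[OF assms] deriv2_soliton[OF param_pos(1)[OF assms]]
    by (simp add: multiplier_def)
qed

text \<open>
  The value at x = 0 of the forcing term of the family (\<open>residual_multiplier\<close>). The power
  u^p is written with exp and ln so that it is visibly a composition of smooth functions.
\<close>

definition residual :: "real \<times> real \<Rightarrow> real" where
  "residual = (\<lambda>(a, p). let w = (a, 2 / p - 1, p, 0) in
     - (a * (2 / p) * U w - Ux 3 w + Ux 1 w - (p + 1) * exp (p * ln (U w)) * Ux 1 w))"

lemma residual_eq:
  assumes "(a, 2 / p - 1, p) \<in> \<D>"
  shows "residual (a, p) = - (a * (2 / p) * u a (2 / p - 1) p 0 - Ux 3 (a, 2 / p - 1, p, 0) + Ux 1 (a, 2 / p - 1, p, 0)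
    - (p + 1) * u a (2 / p - 1) p 0 powr p * Ux 1 (a, 2 / p - 1, p, 0))"
  using u_pos[OF assms, of 0] by (simp add: residual_def powr_def Let_def)

lemma residual_multiplier:
  assumes "(a, 2 / p - 1, p) \<in> \<D>"
  shows "residual (a, p) = multiplier a (2 / p - 1) p * soliton2 p 0"
  using forced_equation[OF assms, of 0] unfolding residual_eq[OF assms] by simp

lemma soliton2_0:
  assumes "p > 0"
  shows "soliton2 p 0 = - (p / 2) * ((p + 2) / 2) powr (1 / p)"
proof -
  have "soliton p 0 = ((p + 2) / 2) powr (1 / p)" by (simp add: soliton_def)
  moreover have "soliton p 0 powr p = (p + 2) / 2" by (simp add: soliton_powr[OF assms])
  ultimately show ?thesis by (simp add: soliton2_def algebra_simps add_divide_distrib)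
qed

lemma soliton2_0_neg: "p > 0 \<Longrightarrow> soliton2 p 0 < 0"
  by (simp add: soliton2_0 mult_neg_pos)

lemma residual_eq_0_iff:
  assumes "(a, 2 / p - 1, p) \<in> \<D>"
  shows "residual (a, p) = 0 \<longleftrightarrow> multiplier a (2 / p - 1) p = 0"
  using residual_multiplier[OF assms] soliton2_0_neg[OF param_pos(1)[OF assms]] by simp

lemma solves_profile_eq_iff:
  assumes "(a, 2 / p - 1, p) \<in> \<D>"
  shows "solves_profile_eq a p (u a (2 / p - 1) p) \<longleftrightarrow> residual (a, p) = 0"
proof
  assume "solves_profile_eq a p (u a (2 / p - 1) p)"
  then show "residual (a, p) = 0"
    unfolding solves_profile_eq_def deriv_u[OF assms] deriv_nonlinearity[OF assms] residual_eq[OF assms]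
    by (auto dest: spec[of _ 0])
next
  assume "residual (a, p) = 0"
  then have "multiplier a (2 / p - 1) p = 0" using residual_eq_0_iff[OF assms] by simp
  moreover have "Ck_on 3 UNIV (u a (2 / p - 1) p)"
    using fam assms by (auto simp: profile_family_def solves_forced_eq_def)
  ultimately show "solves_profile_eq a p (u a (2 / p - 1) p)"
    using forced_equation[OF assms]
    unfolding solves_profile_eq_def deriv_u[OF assms] deriv_nonlinearity[OF assms] by simp
qed

text \<open>
  This choice keeps p in [3, q], and |2/p - 1/2| = |4 - p| / (2 p) below \<epsilon>0.
\<close>

definition \<delta>0 :: real where "\<delta>0 = min (min 1 (q - 4)) \<epsilon>0"

abbreviation "J \<equiv> {4 - \<delta>0<..<4 + \<delta>0}"
abbreviation "\<T> \<equiv> {0..<\<epsilon>0} \<times> J"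

lemma delta0: "0 < \<delta>0" "\<delta>0 \<le> 1" "\<delta>0 \<le> q - 4" "\<delta>0 \<le> \<epsilon>0"
  using q eps0 by (auto simp: \<delta>0_def)

lemma in_param_dom:
  assumes a: "0 \<le> a" "a < \<epsilon>0" and p: "p \<in> J"
  shows "(a, 2 / p - 1, p) \<in> \<D>"
proof -
  have p3: "3 \<le> p" "p \<le> q" "\<bar>4 - p\<bar> < \<epsilon>0" using p delta0 by (auto simp: abs_less_iff)
  have "2 / p - 1 + 1 / 2 = (4 - p) / (2 * p)" using p3 by (simp add: field_simps)
  moreover have "\<bar>(4 - p) / (2 * p)\<bar> \<le> \<bar>4 - p\<bar>"
    using p3 by (simp add: abs_mult divide_le_eq mult_le_cancel_left1)
  ultimately have "\<bar>2 / p - 1 + 1 / 2\<bar> < \<epsilon>0" using p3(3) by linarith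
  then show ?thesis using a p3 by (simp add: param_dom_def)
qed

lemma thick_T: "axis_thick \<T>"
  by (intro axis_thick_Times axis_thick_half_open axis_thick_open) simp

lemma smooth_residual: "smooth_on \<T> residual"
  unfolding smooth_on_def
proof
  fix k
  note lin = Ck_on_linear[OF thick_T]
  have fst: "Ck_on k \<T> fst" and snd: "Ck_on k \<T> snd"
    by (intro lin bounded_linear_fst bounded_linear_snd)+
  have thick0: "axis_thick ({0<..} :: real set)" and thickU: "axis_thick (UNIV :: real set)"
    by (auto intro: axis_thick_open)
  have inv: "Ck_on k \<T> (\<lambda>z. inverse (snd z))"
    by (rule Ck_on_compose[OF thick0 thick_T Ck_on_inverse snd]) (use delta0 in auto)
  have h: "Ck_on k \<T> (\<lambda>z. (fst z, 2 * inverse (snd z) - 1, snd z, 0 :: real))"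
    by (intro Ck_on_Pair Ck_on_diff Ck_on_mult Ck_on_const fst snd inv thick_T)
  have sub: "(\<lambda>z. (fst z, 2 * inverse (snd z) - 1, snd z, 0 :: real)) ` \<T> \<subseteq> \<Omega>"
    using in_param_dom by (auto simp: Omega_iff divide_inverse)
  define w where "w z = (fst z, 2 * inverse (snd z) - 1, snd z, 0 :: real)" for z :: "real \<times> real"
  have comp: "Ck_on k \<T> (\<lambda>z. g (w z))" if "smooth_on \<Omega> g" for g :: "real \<times> real \<times> real \<times> real \<Rightarrow> real"
    unfolding w_def using that by (intro Ck_on_compose[OF thick_Omega thick_T _ h sub]) (auto simp: smooth_on_def)
  have ln: "Ck_on k \<T> (\<lambda>z. ln (U (w z)))"
  proof (rule Ck_on_compose[OF thick0 thick_T Ck_on_ln comp[OF smooth_U]])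
    show "(\<lambda>z. U (w z)) ` \<T> \<subseteq> {0<..}"
      using in_param_dom u_pos by (auto simp: w_def divide_inverse)
  qed
  have "Ck_on k \<T> (\<lambda>z. - 1 * (fst z * (2 * inverse (snd z)) * U (w z) - Ux 3 (w z) + Ux 1 (w z)
      - (snd z + 1) * exp (snd z * ln (U (w z))) * Ux 1 (w z)))"
    by (intro Ck_on_mult Ck_on_diff Ck_on_add Ck_on_const fst snd inv comp smooth_U smooth_Ux thick_T
        Ck_on_compose[OF thickU thick_T Ck_on_exp] ln) auto
  then show "Ck_on k \<T> residual"
    by (simp add: residual_def case_prod_unfold Let_def w_def divide_inverse)
qed

lemma u_0: "(0, \<gamma>, p) \<in> \<D> \<Longrightarrow> u 0 \<gamma> p = soliton p"
  using fam by (auto simp: profile_family_def)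

lemma Ux_at_0:
  assumes "(0, \<gamma>, p) \<in> \<D>"
  shows "Ux 1 (0, \<gamma>, p, x) = soliton1 p x" "Ux 2 (0, \<gamma>, p, x) = soliton2 p x" "Ux 3 (0, \<gamma>, p, x) = soliton3 p x"
proof -
  note D = DERIV_u[OF assms] and S = DERIV_soliton[OF param_pos(1)[OF assms]]
    DERIV_soliton1[OF param_pos(1)[OF assms]] DERIV_soliton2[OF param_pos(1)[OF assms]]
  have 1: "(\<lambda>x. Ux 1 (0, \<gamma>, p, x)) = soliton1 p"
    using D(1) S(1) unfolding u_0[OF assms] by (intro ext) (rule DERIV_unique)
  have 2: "(\<lambda>x. Ux 2 (0, \<gamma>, p, x)) = soliton2 p"
    using D(2) S(2) unfolding 1 by (intro ext) (rule DERIV_unique)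
  have 3: "(\<lambda>x. Ux 3 (0, \<gamma>, p, x)) = soliton3 p"
    using D(3) S(3) unfolding 2 by (intro ext) (rule DERIV_unique)
  show "Ux 1 (0, \<gamma>, p, x) = soliton1 p x" "Ux 2 (0, \<gamma>, p, x) = soliton2 p x" "Ux 3 (0, \<gamma>, p, x) = soliton3 p x"
    using 1 2 3 by (auto dest: fun_cong)
qed

lemma residual_0:
  assumes "p \<in> J"
  shows "residual (0, p) = 0"
proof -
  have d: "(0, 2 / p - 1, p) \<in> \<D>" using in_param_dom[OF _ eps0 assms] by simp
  show ?thesis
    unfolding residual_eq[OF d] u_0[OF d] Ux_at_0[OF d] by (simp add: soliton3_def soliton1_def)
qed

text \<open>
  The residual divided by a, smooth up to a = 0 (\<open>residual_F\<close>).
\<close>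

definition F :: "real \<times> real \<Rightarrow> real" where
  "F = ray_mean 0 (dir_deriv \<T> (1, 0) residual)"

lemma star_T: "(a, y) \<in> \<T> \<Longrightarrow> 0 \<le> t \<Longrightarrow> t \<le> 1 \<Longrightarrow> (t * a, y) \<in> \<T>" for a y t :: real
  using mult_left_le_one_le[of a t] by auto

lemma smooth_F: "smooth_on \<T> F"
  unfolding F_def
  by (intro smooth_on_ray_mean thick_T smooth_on_dir_deriv smooth_residual star_T convex_Times) (auto intro: convex_real_interval)

lemma residual_F:
  assumes "(a, p) \<in> \<T>"
  shows "residual (a, p) = a * F (a, p)"
  using ray_mean_factor[of a p \<T> residual, OF star_T[OF assms] smooth_residual] residual_0[of p] assms
  by (simp add: F_def)

lemma DERIV_a:
  assumes "smooth_on \<Omega> g" "(a, \<gamma>, p) \<in> \<D>"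
  shows "((\<lambda>a. g (a, \<gamma>, p, x)) has_real_derivative dir_deriv \<Omega> (1, 0, 0, 0) g (a, \<gamma>, p, x)) (at a within {0..<\<epsilon>0})"
proof -
  have "((\<lambda>t. g ((a, \<gamma>, p, x) + (t - a) *\<^sub>R (1, 0, 0, 0))) has_vector_derivative
      dir_deriv \<Omega> (1, 0, 0, 0) g (a, \<gamma>, p, x)) (at a within {0..<\<epsilon>0})"
    using assms by (intro dir_deriv_partial) (auto simp: family_dom_def param_dom_def)
  then show ?thesis by (simp add: has_real_derivative_iff_has_vector_derivative)
qed

lemma decay_bound: "\<exists>C. \<forall>a \<gamma> p x. (a, \<gamma>, p) \<in> \<D> \<longrightarrow> (1 + a * \<bar>x\<bar>) powr (1 + \<gamma>) * \<bar>u a \<gamma> p x\<bar> \<le> C"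
proof -
  have "bdd_above ((\<lambda>(a, \<gamma>, p, x). (1 + a * \<bar>x\<bar>) powr (1 + \<gamma>) * \<bar>u a \<gamma> p x\<bar>) ` \<Omega>)"
    using fam by (simp add: profile_family_def)
  then obtain C where C: "\<And>w. w \<in> \<Omega> \<Longrightarrow> (case w of (a, \<gamma>, p, x) \<Rightarrow> (1 + a * \<bar>x\<bar>) powr (1 + \<gamma>) * \<bar>u a \<gamma> p x\<bar>) \<le> C"
    unfolding bdd_above_def by blast
  have "(1 + a * \<bar>x\<bar>) powr (1 + \<gamma>) * \<bar>u a \<gamma> p x\<bar> \<le> C" if "(a, \<gamma>, p) \<in> \<D>" for a \<gamma> p x
    using C[of "(a, \<gamma>, p, x)"] that by (simp add: Omega_iff)
  then show ?thesis by blast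
qed

definition Ua :: "real \<times> real \<times> real \<times> real \<Rightarrow> real" where "Ua = dir_deriv \<Omega> (1, 0, 0, 0) U"
definition Uaa :: "real \<times> real \<times> real \<times> real \<Rightarrow> real" where "Uaa = dir_deriv \<Omega> (1, 0, 0, 0) Ua"

lemma smooth_Ua: "smooth_on \<Omega> Ua" unfolding Ua_def by (intro smooth_on_dir_deriv smooth_U)

lemma mixed_bound:
  assumes "k \<ge> 1"
  shows "\<exists>C. \<forall>w\<in>\<Omega>. (1 + max (snd (snd (snd w))) 0) powr (1 - real k) * \<bar>(dir_deriv \<Omega> (1, 0, 0, 0) ^^ k) U w\<bar> \<le> C"
proof -
  have "bdd_above ((\<lambda>(a, \<gamma>, p, x). (1 + max x 0) powr (1 - real k) *
            \<bar>mixed_deriv \<Omega> 0 0 k U (a, \<gamma>, p, x)\<bar>) ` \<Omega>)"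
    using fam[unfolded profile_family_def, THEN conjunct2, THEN conjunct2, THEN conjunct2, THEN conjunct1,
        rule_format, of k 0 0] assms by (simp add: U_def)
  then obtain C where C: "\<And>w. w \<in> \<Omega> \<Longrightarrow> (case w of (a, \<gamma>, p, x) \<Rightarrow> (1 + max x 0) powr (1 - real k) *
            \<bar>mixed_deriv \<Omega> 0 0 k U (a, \<gamma>, p, x)\<bar>) \<le> C"
    unfolding bdd_above_def by blast
  have "(1 + max (snd (snd (snd w))) 0) powr (1 - real k) * \<bar>(dir_deriv \<Omega> (1, 0, 0, 0) ^^ k) U w\<bar> \<le> C"
    if "w \<in> \<Omega>" for w
    using C[OF that] by (cases w) (simp add: mixed_deriv_def)
  then show ?thesis by blast
qed

lemma Ua_bound: "\<exists>C. \<forall>w\<in>\<Omega>. \<bar>Ua w\<bar> \<le> C"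
proof -
  have "(1 + max x 0) powr (1 - real 1) = 1" for x :: real by simp
  then show ?thesis using mixed_bound[of 1] by (simp add: Ua_def)
qed

lemma Uaa_bound: "\<exists>C. \<forall>a \<gamma> p x. (a, \<gamma>, p) \<in> \<D> \<longrightarrow> x \<le> 0 \<longrightarrow> \<bar>Uaa (a, \<gamma>, p, x)\<bar> \<le> C"
proof -
  obtain C where C: "\<And>w. w \<in> \<Omega> \<Longrightarrow> (1 + max (snd (snd (snd w))) 0) powr (1 - real 2) * \<bar>Uaa w\<bar> \<le> C"
    using mixed_bound[of 2] unfolding Uaa_def Ua_def by (auto simp: numeral_2_eq_2)
  have "\<bar>Uaa (a, \<gamma>, p, x)\<bar> \<le> C" if "(a, \<gamma>, p) \<in> \<D>" "x \<le> 0" for a \<gamma> p x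
    using C[of "(a, \<gamma>, p, x)"] that by (simp add: Omega_iff max_def)
  then show ?thesis by blast
qed

lemma param_segment: "(a, \<gamma>, p) \<in> \<D> \<Longrightarrow> t \<in> {0..<\<epsilon>0} \<Longrightarrow> (t, \<gamma>, p) \<in> \<D>"
  by (auto simp: param_dom_def)

text \<open>
  The mean value inequality in a. With V = 0 it turns the bound on the first a-derivative into
  u - Q = O(a); with V the a-derivative at 0 it is a second order Taylor estimate.
\<close>

lemma increment_in_a:
  assumes g: "smooth_on \<Omega> g" and d: "(a, \<gamma>, p) \<in> \<D>"
    and bound: "\<And>t. 0 \<le> t \<Longrightarrow> t \<le> a \<Longrightarrow> \<bar>dir_deriv \<Omega> (1, 0, 0, 0) g (t, \<gamma>, p, x) - V\<bar> \<le> C"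
  shows "\<bar>g (a, \<gamma>, p, x) - g (0, \<gamma>, p, x) - a * V\<bar> \<le> C * a"
proof -
  have a: "0 \<le> a" "a < \<epsilon>0" using d by (auto simp: param_dom_def)
  have "norm ((g (a, \<gamma>, p, x) - a * V) - (g (0, \<gamma>, p, x) - 0 * V)) \<le> C * norm (a - 0)"
  proof (rule field_differentiable_bound[where S = "{0..a}" and f = "\<lambda>t. g (t, \<gamma>, p, x) - t * V"
        and f' = "\<lambda>t. dir_deriv \<Omega> (1, 0, 0, 0) g (t, \<gamma>, p, x) - V"])
    fix t assume t: "t \<in> {0..a}"
    have "((\<lambda>a. g (a, \<gamma>, p, x)) has_real_derivative dir_deriv \<Omega> (1, 0, 0, 0) g (t, \<gamma>, p, x)) (at t within {0..a})"
      by (rule DERIV_subset[OF DERIV_a[OF g]]) (use param_segment[OF d, of t] t a in auto)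
    then show "((\<lambda>t. g (t, \<gamma>, p, x) - t * V) has_field_derivative dir_deriv \<Omega> (1, 0, 0, 0) g (t, \<gamma>, p, x) - V) (at t within {0..a})"
      by (auto intro!: derivative_eq_intros)
  qed (use bound a in auto)
  then show ?thesis using a by (simp add: algebra_simps)
qed

text \<open>
  As F is known to be smooth, its values and derivatives at a = 0 may be computed along any one
  sequence tending to 0.
\<close>

definition aseq :: "nat \<Rightarrow> real" where "aseq n = (\<epsilon>0 / 2) / (real n + 1) ^ 4"

lemma aseq: "0 < aseq n" "aseq n < \<epsilon>0" "aseq \<longlonglongrightarrow> 0"
proof -
  have "1 \<le> (real n + 1) ^ 4" by (rule one_le_power) simp
  then have "aseq n \<le> \<epsilon>0 / 2" using eps0 by (simp add: aseq_def divide_le_eq mult_le_cancel_left1)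
  then show "aseq n < \<epsilon>0" using eps0 by simp
  show "0 < aseq n" using eps0 by (simp add: aseq_def)
  show "aseq \<longlonglongrightarrow> 0" unfolding aseq_def[abs_def] by real_asymp
qed

lemma aseq_filterlim: "filterlim aseq (at 0 within {0..<\<epsilon>0}) sequentially"
  unfolding filterlim_at using aseq less_imp_le[OF aseq(1)]
  by (auto intro!: always_eventually simp: less_imp_neq[symmetric])

lemma difference_quotient_aseq:
  assumes "(f has_real_derivative d) (at 0 within {0..<\<epsilon>0})"
  shows "(\<lambda>n. (f (aseq n) - f 0) / aseq n) \<longlonglongrightarrow> d"
  using filterlim_compose[OF assms[unfolded has_field_derivative_iff] aseq_filterlim] by simp

lemma convergent_quotient_bound:
  fixes f :: "nat \<Rightarrow> real"
  assumes "(\<lambda>n. f n / aseq n) \<longlonglongrightarrow> l"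
  shows "\<exists>C. \<forall>n. \<bar>f n\<bar> \<le> C * aseq n"
proof -
  have "Bseq (\<lambda>n. f n / aseq n)" using assms by (intro convergent_imp_Bseq) (auto simp: convergent_def)
  then obtain C where C: "\<forall>n. norm (f n / aseq n) \<le> C" by (rule BseqE)
  have "\<bar>f n\<bar> \<le> C * aseq n" for n
    using C[rule_format, of n] aseq(1)[of n] by (simp add: divide_le_eq)
  then show ?thesis by blast
qed

lemma F_aseq:
  assumes p: "p \<in> J"
  shows "multiplier (aseq n) (2 / p - 1) p = aseq n * F (aseq n, p) / soliton2 p 0"
    "(\<lambda>n. F (aseq n, p)) \<longlonglongrightarrow> F (0, p)"
proof -
  have d: "(aseq n, 2 / p - 1, p) \<in> \<D>" by (intro in_param_dom p) (use aseq in \<open>auto simp: less_imp_le\<close>)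
  have "(aseq n, p) \<in> \<T>" using aseq(1)[of n] aseq(2)[of n] p by auto
  then show "multiplier (aseq n) (2 / p - 1) p = aseq n * F (aseq n, p) / soliton2 p 0"
    using residual_F residual_multiplier[OF d] soliton2_0_neg[OF param_pos(1)[OF d]] by (simp add: field_simps)
  show "(\<lambda>n. F (aseq n, p)) \<longlonglongrightarrow> F (0, p)"
  proof (rule continuous_on_tendsto_compose[OF smooth_on_continuous[OF smooth_F]])
    show "(\<lambda>n. (aseq n, p)) \<longlonglongrightarrow> (0, p)" by (intro tendsto_intros aseq)
  qed (use p eps0 aseq in \<open>auto intro!: always_eventually simp: less_imp_le\<close>)
qed

lemma soliton_perturbation_exists:
  assumes p: "p \<in> J"
  defines "\<gamma> \<equiv> 2 / p - 1"
  shows "\<exists>C. soliton_perturbation p \<gamma> (\<epsilon>0 / 2) C aseq (\<lambda>n. multiplier (aseq n) \<gamma> p) (\<lambda>n. u (aseq n) \<gamma> p)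
     (\<lambda>n x. Ux 1 (aseq n, \<gamma>, p, x)) (\<lambda>n x. Ux 2 (aseq n, \<gamma>, p, x)) (\<lambda>n x. Ux 3 (aseq n, \<gamma>, p, x))"
proof -
  have d: "(aseq n, \<gamma>, p) \<in> \<D>" for n unfolding \<gamma>_def by (intro in_param_dom p) (use aseq in \<open>auto simp: less_imp_le\<close>)
  have d0: "(0, \<gamma>, p) \<in> \<D>" unfolding \<gamma>_def by (intro in_param_dom p eps0) simp
  have pp: "p > 0" by (rule param_pos(1)[OF d0])
  obtain C1 where C1: "\<And>w. w \<in> \<Omega> \<Longrightarrow> \<bar>Ua w\<bar> \<le> C1" using Ua_bound by blast
  have close: "\<bar>u (aseq n) \<gamma> p x - soliton p x\<bar> \<le> C1 * aseq n" for n x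
  proof -
    have "\<bar>U (aseq n, \<gamma>, p, x) - U (0, \<gamma>, p, x) - aseq n * 0\<bar> \<le> C1 * aseq n"
    proof (rule increment_in_a[OF smooth_U d])
      fix t assume "0 \<le> t" "t \<le> aseq n"
      then have "(t, \<gamma>, p) \<in> \<D>" using aseq(2)[of n] by (intro param_segment[OF d0]) auto
      then show "\<bar>dir_deriv \<Omega> (1, 0, 0, 0) U (t, \<gamma>, p, x) - 0\<bar> \<le> C1"
        using C1[of "(t, \<gamma>, p, x)"] by (simp add: Ua_def Omega_iff)
    qed
    then show ?thesis by (simp add: u_0[OF d0])
  qed
  obtain C2 where C2: "\<And>n. \<bar>Ux 2 (aseq n, \<gamma>, p, 0) - soliton2 p 0\<bar> \<le> C2 * aseq n"
    using convergent_quotient_bound[OF difference_quotient_aseq[OF DERIV_a[OF smooth_Ux d0, of 2 0], unfolded Ux_at_0[OF d0]]]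
    by blast
  have "(\<lambda>n. F (aseq n, p) / soliton2 p 0) \<longlonglongrightarrow> F (0, p) / soliton2 p 0"
    using soliton2_0_neg[OF pp] by (intro tendsto_divide F_aseq p tendsto_const) auto
  then have "(\<lambda>n. multiplier (aseq n) \<gamma> p / aseq n) \<longlonglongrightarrow> F (0, p) / soliton2 p 0"
    unfolding \<gamma>_def F_aseq(1)[OF p] using aseq(1) by (simp add: less_imp_neq[symmetric])
  then obtain C3 where C3: "\<And>n. \<bar>multiplier (aseq n) \<gamma> p\<bar> \<le> C3 * aseq n"
    using convergent_quotient_bound[of "\<lambda>n. multiplier (aseq n) \<gamma> p" "F (0, p) / soliton2 p 0"] by blast
  define C where "C = max C1 (max C2 C3)"
  have Cs: "C1 \<le> C" "C2 \<le> C" "C3 \<le> C" by (simp_all add: C_def le_max_iff_disj)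
  have le: "t * aseq n \<le> C * aseq n" if "t \<le> C" for t n
    using that aseq(1)[of n] by (intro mult_right_mono) auto
  have "soliton_perturbation p \<gamma> (\<epsilon>0 / 2) C aseq (\<lambda>n. multiplier (aseq n) \<gamma> p) (\<lambda>n. u (aseq n) \<gamma> p)
     (\<lambda>n x. Ux 1 (aseq n, \<gamma>, p, x)) (\<lambda>n x. Ux 2 (aseq n, \<gamma>, p, x)) (\<lambda>n x. Ux 3 (aseq n, \<gamma>, p, x))"
  proof
    show "\<bar>u (aseq n) \<gamma> p x - soliton p x\<bar> \<le> C * aseq n" for n x
      using close[of n x] le[OF Cs(1), of n] by linarith
    show "\<bar>Ux 2 (aseq n, \<gamma>, p, 0) - soliton2 p 0\<bar> \<le> C * aseq n" for n
      using C2[of n] le[OF Cs(2), of n] by linarith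
    show "\<bar>multiplier (aseq n) \<gamma> p\<bar> \<le> C * aseq n" for n
      using C3[of n] le[OF Cs(3), of n] by linarith
    show "aseq n * ((1 + \<gamma>) * u (aseq n) \<gamma> p x + x * Ux 1 (aseq n, \<gamma>, p, x)) - Ux 3 (aseq n, \<gamma>, p, x)
        + Ux 1 (aseq n, \<gamma>, p, x) - (p + 1) * u (aseq n) \<gamma> p x powr p * Ux 1 (aseq n, \<gamma>, p, x)
        + multiplier (aseq n) \<gamma> p * soliton2 p x = 0" for n x
      by (rule forced_equation[OF d])
    show "aseq n = \<epsilon>0 / 2 / (real n + 1) ^ 4" for n by (rule aseq_def)
  qed (use pp eps0 d DERIV_u u_pos in auto)
  then show ?thesis by blast
qed

text \<open>
  Read off from \<open>multiplier_first_order\<close>, with the ratio of the norms from \<open>soliton_virial\<close>.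
\<close>

lemma F_at_0:
  assumes pJ: "p \<in> J"
  shows "F (0, p) = soliton2 p 0 * ((2 / p - 1 / 2) * ((p + 4) / p))"
proof -
  have pp: "p > 0" using pJ delta0 by auto
  obtain C where "soliton_perturbation p (2 / p - 1) (\<epsilon>0 / 2) C aseq (\<lambda>n. multiplier (aseq n) (2 / p - 1) p) (\<lambda>n. u (aseq n) (2 / p - 1) p)
     (\<lambda>n x. Ux 1 (aseq n, (2 / p - 1), p, x)) (\<lambda>n x. Ux 2 (aseq n, (2 / p - 1), p, x)) (\<lambda>n x. Ux 3 (aseq n, (2 / p - 1), p, x))"
    using soliton_perturbation_exists[OF pJ] by blast
  then interpret soliton_perturbation p "2 / p - 1" "\<epsilon>0 / 2" C aseq "\<lambda>n. multiplier (aseq n) (2 / p - 1) p" "\<lambda>n. u (aseq n) (2 / p - 1) p"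
     "\<lambda>n x. Ux 1 (aseq n, (2 / p - 1), p, x)" "\<lambda>n x. Ux 2 (aseq n, (2 / p - 1), p, x)" "\<lambda>n x. Ux 3 (aseq n, (2 / p - 1), p, x)" .
  have "(\<lambda>n. multiplier (aseq n) (2 / p - 1) p / aseq n) \<longlonglongrightarrow> (2 / p - 1 + 1 / 2) * mass / grad"
    by (rule multiplier_first_order)
  then have "(\<lambda>n. F (aseq n, p) / soliton2 p 0) \<longlonglongrightarrow> (2 / p - 1 + 1 / 2) * mass / grad"
    unfolding F_aseq(1)[OF pJ] using aseq(1) by (simp add: less_imp_neq[symmetric])
  moreover have "(\<lambda>n. F (aseq n, p) / soliton2 p 0) \<longlonglongrightarrow> F (0, p) / soliton2 p 0"
    using soliton2_0_neg[OF pp] by (intro tendsto_divide F_aseq pJ tendsto_const) auto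
  ultimately have "F (0, p) / soliton2 p 0 = (2 / p - 1 + 1 / 2) * mass / grad" by (metis LIMSEQ_unique)
  moreover have "mass / grad = (p + 4) / p" using soliton_virial[OF pp] grad_pos pp by (simp add: field_simps)
  ultimately have "F (0, p) / soliton2 p 0 = (2 / p - 1 + 1 / 2) * ((p + 4) / p)"
    by (simp only: times_divide_eq_right[symmetric])
  then have "F (0, p) / soliton2 p 0 = (2 / p - 1 / 2) * ((p + 4) / p)" by simp
  then show ?thesis using soliton2_0_neg[OF pp] by (simp add: field_simps)
qed

text \<open>
  By \<open>F_at_0\<close>, F (0, p) = K p (2/p - 1/2) with K differentiable. The second factor vanishes at
  p = 4, so only its derivative - 1/8 enters.
\<close>

lemma DERIV_F_p: "((\<lambda>p. F (0, p)) has_real_derivative 3 powr (1 / 4) / 2) (at 4)"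
proof -
  define K where "K p = - (1 / 2) * ((p + 2) / 2) powr (1 / p) * (p + 4)" for p :: real
  obtain K' where K': "(K has_real_derivative K') (at 4)"
  proof -
    have base: "((\<lambda>p::real. (p + 2) / 2) has_real_derivative 1 / 2) (at 4)"
      and expo: "((\<lambda>p::real. 1 / p) has_real_derivative - 1 / 16) (at 4)"
      by (auto intro!: derivative_eq_intros simp: power2_eq_square)
    obtain D where D: "((\<lambda>p::real. ((p + 2) / 2) powr (1 / p)) has_real_derivative D) (at 4)"
      using DERIV_powr[OF base _ expo] by auto
    show ?thesis
      by (rule that, unfold K_def)
         (rule DERIV_mult[OF DERIV_cmult[OF D] DERIV_add[OF DERIV_ident DERIV_const]])
  qed
  have "((\<lambda>p. K p * (2 / p - 1 / 2)) has_real_derivative K' * (2 / 4 - 1 / 2) + - 2 / 4\<^sup>2 * K 4) (at 4)"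
    by (rule DERIV_mult[OF K']) (auto intro!: derivative_eq_intros simp: power2_eq_square)
  moreover have "K' * (2 / 4 - 1 / 2) + - 2 / 4\<^sup>2 * K 4 = 3 powr (1 / 4) / 2" by (simp add: K_def)
  ultimately have "((\<lambda>p. K p * (2 / p - 1 / 2)) has_real_derivative 3 powr (1 / 4) / 2) (at 4)"
    by (simp only:)
  moreover have "eventually (\<lambda>p. F (0, p) = K p * (2 / p - 1 / 2)) (nhds 4)"
  proof -
    have "eventually (\<lambda>p. p \<in> J) (nhds 4)" using delta0 by (intro eventually_nhds_in_open) auto
    then show ?thesis
    proof eventually_elim
      case (elim p)
      then have "p > 0" using delta0 by auto
      then show ?case unfolding F_at_0[OF elim] soliton2_0[OF \<open>p > 0\<close>] K_def by (simp add: field_simps)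
    qed
  qed
  ultimately show ?thesis
    using DERIV_cong_ev[OF refl, of "\<lambda>p. F (0, p)" "\<lambda>p. K p * (2 / p - 1 / 2)" 4] by blast
qed

text \<open>
  Let V be the a-derivative of u at a = 0. On the half line x \<le> 0 the second a-derivative is bounded,
  so (u - Q) / a = V + O(a) uniformly there. For fixed a > 0 both u and Q tend to 0 as x \<rightarrow> -\<infinity>;
  hence, for every a > 0, |V| is eventually at most a fixed constant times a. So V tends to 0 as
  x \<rightarrow> -\<infinity>, and so does (u - Q) / a along a \<rightarrow> 0, x \<rightarrow> -\<infinity>.
\<close>

lemma left_tail:
  "(\<lambda>n. (u (aseq n) (- 1 / 2) 4 (- (real n + 1)) - soliton 4 (- (real n + 1))) / aseq n) \<longlonglongrightarrow> 0"
proof -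
  have four: "4 \<in> J" using delta0 by auto
  have d: "(t, - 1 / 2, 4) \<in> \<D>" if "0 \<le> t" "t < \<epsilon>0" for t using in_param_dom[OF that four] by simp
  have dn: "(aseq n, - 1 / 2, 4) \<in> \<D>" for n using aseq by (intro d) (auto simp: less_imp_le)
  have d0: "(0, - 1 / 2, 4) \<in> \<D>" using eps0 by (intro d) auto
  define V where "V x = Ua (0, - 1 / 2, 4, x)" for x
  define r where "r n x = (u (aseq n) (- 1 / 2) 4 x - soliton 4 x) / aseq n" for n x
  obtain C where C: "\<And>a \<gamma> p x. (a, \<gamma>, p) \<in> \<D> \<Longrightarrow> x \<le> 0 \<Longrightarrow> \<bar>Uaa (a, \<gamma>, p, x)\<bar> \<le> C"
    using Uaa_bound by blast
  have C0: "0 \<le> C" using C[OF d0, of 0] by simp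
  have r_V: "\<bar>r n x - V x\<bar> \<le> C * aseq n" if x: "x \<le> 0" for n x
  proof -
    have "\<bar>U (aseq n, - 1 / 2, 4, x) - U (0, - 1 / 2, 4, x) - aseq n * V x\<bar> \<le> (C * aseq n) * aseq n"
    proof (rule increment_in_a[OF smooth_U dn])
      fix t assume t: "0 \<le> t" "t \<le> aseq n"
      then have dt: "(t, - 1 / 2, 4) \<in> \<D>" using aseq(2)[of n] by (intro d) auto
      have "\<bar>Ua (t, - 1 / 2, 4, x) - Ua (0, - 1 / 2, 4, x) - t * 0\<bar> \<le> C * t"
      proof (rule increment_in_a[OF smooth_Ua dt])
        fix s assume "0 \<le> s" "s \<le> t"
        then have "(s, - 1 / 2, 4) \<in> \<D>" using t aseq(2)[of n] by (intro d) auto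
        then show "\<bar>dir_deriv \<Omega> (1, 0, 0, 0) Ua (s, - 1 / 2, 4, x) - 0\<bar> \<le> C"
          using C[of s "- 1 / 2" 4 x] x by (simp add: Uaa_def)
      qed
      also have "C * t \<le> C * aseq n" using t C0 by (intro mult_left_mono)
      finally show "\<bar>dir_deriv \<Omega> (1, 0, 0, 0) U (t, - 1 / 2, 4, x) - V x\<bar> \<le> C * aseq n"
        by (simp add: V_def Ua_def)
    qed
    moreover have "U (aseq n, - 1 / 2, 4, x) - U (0, - 1 / 2, 4, x) - aseq n * V x = aseq n * (r n x - V x)"
    proof -
      have "aseq n * r n x = u (aseq n) (- 1 / 2) 4 x - soliton 4 x" using aseq(1)[of n] by (simp add: r_def)
      then show ?thesis by (simp only: U_apply u_0[OF d0] right_diff_distrib)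
    qed
    ultimately have "\<bar>aseq n * (r n x - V x)\<bar> \<le> (C * aseq n) * aseq n" by (simp only:)
    then show ?thesis using aseq(1)[of n] by (simp add: abs_mult)
  qed
  obtain D where D: "\<And>a \<gamma> p x. (a, \<gamma>, p) \<in> \<D> \<Longrightarrow> (1 + a * \<bar>x\<bar>) powr (1 + \<gamma>) * \<bar>u a \<gamma> p x\<bar> \<le> D"
    using decay_bound by blast
  have r_lim: "(r n \<longlongrightarrow> 0) at_bot" for n
  proof -
    have "(u (aseq n) (- 1 / 2) 4 \<longlongrightarrow> 0) at_bot"
    proof (rule Lim_null_comparison)
      show "((\<lambda>x. D * (1 + aseq n * \<bar>x\<bar>) powr (- (1 / 2))) \<longlongrightarrow> 0) at_bot"
        using aseq(1)[of n] by real_asymp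
      have "norm (u (aseq n) (- 1 / 2) 4 x) \<le> D * (1 + aseq n * \<bar>x\<bar>) powr (- (1 / 2))" for x
      proof -
        have "1 + aseq n * \<bar>x\<bar> > 0" using aseq(1)[of n] by (simp add: add_pos_nonneg)
        then show ?thesis using D[OF dn, of n x] by (simp add: powr_minus field_simps)
      qed
      then show "\<forall>\<^sub>F x in at_bot. norm (u (aseq n) (- 1 / 2) 4 x) \<le> D * (1 + aseq n * \<bar>x\<bar>) powr (- (1 / 2))"
        by (intro always_eventually) blast
    qed
    from tendsto_divide[OF tendsto_diff[OF this soliton_tendsto(2)[of 4]] tendsto_const[of "aseq n"]]
    show ?thesis using aseq(1)[of n] by (simp add: r_def[abs_def])
  qed
  have V_lim: "(V \<longlongrightarrow> 0) at_bot"
  proof (rule tendstoI)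
    fix e :: real assume e: "e > 0"
    have "(\<lambda>n. C * aseq n) \<longlonglongrightarrow> 0" using tendsto_mult[OF tendsto_const aseq(3), of C] by simp
    then have "\<forall>\<^sub>F n in sequentially. C * aseq n < e / 2" using e by (intro order_tendstoD(2)) auto
    then obtain n where n: "C * aseq n < e / 2" by (auto simp: eventually_sequentially)
    have "\<forall>\<^sub>F x in at_bot. dist (r n x) 0 < e / 2" by (rule tendstoD[OF r_lim]) (use e in simp)
    moreover have "\<forall>\<^sub>F x in at_bot. x \<le> (0 :: real)" by (rule eventually_le_at_bot)
    ultimately show "\<forall>\<^sub>F x in at_bot. dist (V x) 0 < e"
    proof eventually_elim
      case (elim x)
      then show ?case using r_V[of x n] n by (simp add: dist_real_def)
    qed
  qed
  have lim: "(\<lambda>n. \<bar>V (- (real n + 1))\<bar> + C * aseq n) \<longlonglongrightarrow> \<bar>0\<bar> + C * 0"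
  proof (intro tendsto_intros aseq)
    have "filterlim (\<lambda>n. - (real n + 1)) at_bot sequentially" by real_asymp
    then show "(\<lambda>n. V (- (real n + 1))) \<longlonglongrightarrow> 0" by (rule filterlim_compose[OF V_lim])
  qed
  have "(\<lambda>n. r n (- (real n + 1))) \<longlonglongrightarrow> 0"
  proof (rule Lim_null_comparison)
    show "(\<lambda>n. \<bar>V (- (real n + 1))\<bar> + C * aseq n) \<longlonglongrightarrow> 0" using lim by simp
    have "norm (r n (- (real n + 1))) \<le> \<bar>V (- (real n + 1))\<bar> + C * aseq n" for n
      using r_V[of "- (real n + 1)" n] by simp
    then show "\<forall>\<^sub>F n in sequentially. norm (r n (- (real n + 1))) \<le> \<bar>V (- (real n + 1))\<bar> + C * aseq n"
      by (intro always_eventually) blast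
  qed
  then show ?thesis by (simp add: r_def)
qed

lemma DERIV_F_a:
  "((\<lambda>a. F (a, 4)) has_real_derivative - (3 powr (1 / 4) / 2 * ((L1_norm (soliton 4))\<^sup>2 / (L2_norm (soliton 4))\<^sup>2)))
     (at 0 within {0..<\<epsilon>0})"
proof -
  have four: "4 \<in> J" using delta0 by auto
  have g: "2 / 4 - 1 = - 1 / (2 :: real)" by simp
  obtain C where "soliton_perturbation 4 (- 1 / 2) (\<epsilon>0 / 2) C aseq (\<lambda>n. multiplier (aseq n) (- 1 / 2) 4) (\<lambda>n. u (aseq n) (- 1 / 2) 4)
     (\<lambda>n x. Ux 1 (aseq n, - 1 / 2, 4, x)) (\<lambda>n x. Ux 2 (aseq n, - 1 / 2, 4, x)) (\<lambda>n x. Ux 3 (aseq n, - 1 / 2, 4, x))"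
    using soliton_perturbation_exists[OF four] unfolding g by blast
  then interpret soliton_perturbation 4 "- 1 / 2" "\<epsilon>0 / 2" C aseq "\<lambda>n. multiplier (aseq n) (- 1 / 2) 4" "\<lambda>n. u (aseq n) (- 1 / 2) 4"
     "\<lambda>n x. Ux 1 (aseq n, - 1 / 2, 4, x)" "\<lambda>n x. Ux 2 (aseq n, - 1 / 2, 4, x)" "\<lambda>n x. Ux 3 (aseq n, - 1 / 2, 4, x)" .
  let ?q = "LINT x|lborel. soliton 4 x"
  have lim: "(\<lambda>n. multiplier (aseq n) (- 1 / 2) 4 / (aseq n)\<^sup>2) \<longlonglongrightarrow> ?q\<^sup>2 / (8 * grad)"
  proof (rule multiplier_second_order)
    show "(\<lambda>n. r n (- X n)) \<longlonglongrightarrow> 0" unfolding r_def X_def by (rule left_tail)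
  qed simp
  have F0: "F (0, 4) = 0" unfolding F_at_0[OF four] by simp
  have "(0, 4) \<in> \<T>" using eps0 delta0 by auto
  then have dF: "((\<lambda>a. F (a, 4)) has_real_derivative dir_deriv \<T> (1, 0) F (0, 4)) (at 0 within {0..<\<epsilon>0})"
    by (intro has_real_derivative_fst[OF smooth_F]) auto
  have "(\<lambda>n. F (aseq n, 4) / aseq n) \<longlonglongrightarrow> dir_deriv \<T> (1, 0) F (0, 4)"
    using difference_quotient_aseq[OF dF] by (simp add: F0)
  then have "(\<lambda>n. F (aseq n, 4) / aseq n / soliton2 4 0) \<longlonglongrightarrow> dir_deriv \<T> (1, 0) F (0, 4) / soliton2 4 0"
    using soliton2_0_neg[of 4] by (intro tendsto_divide tendsto_const) auto
  moreover have "multiplier (aseq n) (- 1 / 2) 4 / (aseq n)\<^sup>2 = F (aseq n, 4) / aseq n / soliton2 4 0" for n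
    using F_aseq(1)[OF four, of n, unfolded g] aseq(1)[of n] by (simp add: power2_eq_square)
  ultimately have "dir_deriv \<T> (1, 0) F (0, 4) / soliton2 4 0 = ?q\<^sup>2 / (8 * grad)"
    using lim by (metis (no_types, lifting) LIMSEQ_unique tendsto_cong_limit filterlim_cong ext)
  then have 1: "dir_deriv \<T> (1, 0) F (0, 4) = ?q\<^sup>2 / (8 * grad) * soliton2 4 0"
    using soliton2_0_neg[of 4] by (simp add: field_simps)
  have grad_mass: "grad = mass / 2" using soliton_virial[of 4] by simp
  have "L1_norm (soliton 4) = ?q"
    unfolding L1_norm_def using soliton_pos[of 4] by (intro Bochner_Integration.integral_cong) (auto simp: abs_of_pos)
  moreover have "(L2_norm (soliton 4))\<^sup>2 = mass" unfolding L2_norm_def by simp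
  moreover have "soliton2 4 0 = - 2 * 3 powr (1 / 4)" by (simp add: soliton2_0)
  ultimately have "dir_deriv \<T> (1, 0) F (0, 4) = - (3 powr (1 / 4) / 2 * ((L1_norm (soliton 4))\<^sup>2 / (L2_norm (soliton 4))\<^sup>2))"
  proof -
    assume L1: "L1_norm (soliton 4) = ?q" and L2: "(L2_norm (soliton 4))\<^sup>2 = mass"
      and s2: "soliton2 4 0 = - 2 * 3 powr (1 / 4)"
    have "s / (8 * (m / 2)) * (- 2 * w) = - (w / 2 * (s / m))" if "m > 0" for s m w :: real
      using that by (simp add: field_simps)
    from this[OF mass_pos] show ?thesis unfolding 1 grad_mass L1 L2 s2 .
  qed
  with dF show ?thesis by simp
qed

text \<open>
  The virial argument divides by a, so the soliton at a = 0 is treated separately.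
\<close>

lemma zero_energy_of_residual:
  assumes a: "0 \<le> a" "a < \<epsilon>0" and p: "p \<in> J" and zero: "residual (a, p) = 0" and p0: "a = 0 \<Longrightarrow> p = 4"
  shows "has_bochner_integral lborel (energy_density p (u a (2 / p - 1) p)) 0"
proof (cases "a = 0")
  case True
  then have "(0, 2 / p - 1, p) \<in> \<D>" using in_param_dom[OF _ eps0 p] by simp
  then have "u a (2 / p - 1) p = soliton p" using True u_0 by simp
  then show ?thesis using soliton_energy p0[OF True] by simp
next
  case False
  let ?\<gamma> = "2 / p - 1"
  have d: "(a, ?\<gamma>, p) \<in> \<D>" by (rule in_param_dom[OF a p])
  have pp: "p > 0" by (rule param_pos(1)[OF d])
  obtain C where C: "\<And>a \<gamma> p x. (a, \<gamma>, p) \<in> \<D> \<Longrightarrow> (1 + a * \<bar>x\<bar>) powr (1 + \<gamma>) * \<bar>u a \<gamma> p x\<bar> \<le> C"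
    using decay_bound by blast
  have "has_bochner_integral lborel (\<lambda>x. 1 / 2 * (Ux 1 (a, ?\<gamma>, p, x))\<^sup>2 - 1 / (p + 2) * u a ?\<gamma> p x powr (p + 2)) 0"
  proof (rule profile_zero_energy[OF _ pp DERIV_u[OF d] u_pos[OF d]])
    show "a > 0" using a False by simp
    show "(1 + a * \<bar>x\<bar>) powr (2 / p) * u a ?\<gamma> p x \<le> C" for x
      using C[OF d, of x] u_pos[OF d, of x] by simp
    have "in_L2 (deriv (u a ?\<gamma> p))" using fam d by (auto simp: profile_family_def)
    then show "integrable lborel (\<lambda>x. (Ux 1 (a, ?\<gamma>, p, x))\<^sup>2)" by (simp add: in_L2_def deriv_u[OF d])
    show "a * (2 / p * u a ?\<gamma> p x + x * Ux 1 (a, ?\<gamma>, p, x)) - Ux 3 (a, ?\<gamma>, p, x) + Ux 1 (a, ?\<gamma>, p, x)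
        - (p + 1) * u a ?\<gamma> p x powr p * Ux 1 (a, ?\<gamma>, p, x) = 0" for x
      using forced_equation[OF d, of x] zero residual_eq_0_iff[OF d] by simp
  qed
  then show ?thesis
    using u_pos[OF d] by (simp add: energy_density_def[abs_def] deriv_u[OF d] abs_of_pos)
qed

theorem zero_energy_branch:
  "\<exists>\<epsilon>>0. \<exists>p :: real \<Rightarrow> real. zero_energy_curve q \<epsilon>0 u \<epsilon> p \<and>
     (\<forall>p'. zero_energy_curve q \<epsilon>0 u \<epsilon> p' \<longrightarrow> (\<forall>a\<in>{0..<\<epsilon>}. p' a = p a))"
proof -
  let ?s = "(L1_norm (soliton 4))\<^sup>2 / (L2_norm (soliton 4))\<^sup>2"
  have F04: "F (0, 4) = 0" using F_at_0[of 4] delta0 by simp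
  obtain \<epsilon> \<delta> y where \<epsilon>: "0 < \<epsilon>" "\<epsilon> \<le> \<epsilon>0" and \<delta>: "0 < \<delta>" "\<delta> \<le> \<delta>0"
    and y: "smooth_on {0..<\<epsilon>} y" "y 0 = 4"
      "(y has_real_derivative - (- (3 powr (1 / 4) / 2 * ?s)) / (3 powr (1 / 4) / 2)) (at 0 within {0..<\<epsilon>})"
    and y_in: "\<And>a. a \<in> {0..<\<epsilon>} \<Longrightarrow> y a \<in> {4 - \<delta><..<4 + \<delta>}"
    and y_iff: "\<And>a z. a \<in> {0..<\<epsilon>} \<Longrightarrow> z \<in> {4 - \<delta><..<4 + \<delta>} \<Longrightarrow> F (a, z) = 0 \<longleftrightarrow> z = y a"
    using smooth_implicit_function_at_boundary[OF eps0 delta0(1) smooth_F F04 DERIV_F_a DERIV_F_p] by (auto simp: zero_less_divide_iff)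
  have y_J: "y a \<in> J" if "a \<in> {0..<\<epsilon>}" for a using y_in[OF that] \<delta> by auto
  have dom: "(a, 2 / y a - 1, y a) \<in> \<D>" if "a \<in> {0..<\<epsilon>}" for a
    using that \<epsilon> by (intro in_param_dom y_J) auto
  have zero: "residual (a, y a) = 0" if "a \<in> {0..<\<epsilon>}" for a
    using residual_F[of a "y a"] y_iff[OF that y_in[OF that]] y_J[OF that] that \<epsilon> by auto
  obtain C where C: "\<And>a \<gamma> p x. (a, \<gamma>, p) \<in> \<D> \<Longrightarrow> (1 + a * \<bar>x\<bar>) powr (1 + \<gamma>) * \<bar>u a \<gamma> p x\<bar> \<le> C"
    using decay_bound by blast
  have "zero_energy_curve q \<epsilon>0 u \<epsilon> y"
    unfolding zero_energy_curve_def
  proof (intro conjI ballI)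
    show "(y has_real_derivative ?s) (at 0 within {0..<\<epsilon>})" using y(3) by simp
    show "bdd_above ((\<lambda>(a, x). (1 + a * \<bar>x\<bar>) powr (2 / y a) * \<bar>u a (2 / y a - 1) (y a) x\<bar>) ` ({0..<\<epsilon>} \<times> UNIV))"
    proof (rule bdd_aboveI2[of _ _ C])
      fix w :: "real \<times> real" assume "w \<in> {0..<\<epsilon>} \<times> UNIV"
      then show "(case w of (a, x) \<Rightarrow> (1 + a * \<bar>x\<bar>) powr (2 / y a) * \<bar>u a (2 / y a - 1) (y a) x\<bar>) \<le> C"
        using C[OF dom, of "fst w" "snd w"] by (auto simp: case_prod_unfold)
    qed
    fix a assume a: "a \<in> {0..<\<epsilon>}"
    show "(a, 2 / y a - 1, y a) \<in> \<D>" by (rule dom[OF a])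
    show "solves_profile_eq a (y a) (u a (2 / y a - 1) (y a))"
      using solves_profile_eq_iff[OF dom[OF a]] zero[OF a] by simp
    show "in_L2 (deriv (u a (2 / y a - 1) (y a)))" using fam dom[OF a] by (auto simp: profile_family_def)
    show "has_bochner_integral lborel (energy_density (y a) (u a (2 / y a - 1) (y a))) 0"
      using a \<epsilon> y(2) by (intro zero_energy_of_residual y_J zero) auto
  qed (use y in auto)
  moreover have "p' b = y b" if p': "zero_energy_curve q \<epsilon>0 u \<epsilon> p'" and b: "b \<in> {0..<\<epsilon>}" for p' b
  proof -
    have p'_cont: "continuous_on {0..<\<epsilon>} p'" and p'_0: "p' 0 = 4"
      using p' by (auto simp: zero_energy_curve_def smooth_on_continuous)
    have y_cont: "continuous_on {0..<\<epsilon>} y" by (rule smooth_on_continuous[OF y(1)])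
    \<comment> \<open>a competitor that is close to 4 is a zero of F, hence lies on the constructed curve\<close>
    have eq_if: "p' a = y a" if a: "a \<in> {0..<\<epsilon>}" and near: "p' a \<in> {4 - \<delta><..<4 + \<delta>}" for a
    proof (cases "a = 0")
      case False
      have "(a, 2 / p' a - 1, p' a) \<in> \<D>" "solves_profile_eq a (p' a) (u a (2 / p' a - 1) (p' a))"
        using p' a by (auto simp: zero_energy_curve_def)
      then have "residual (a, p' a) = 0" using solves_profile_eq_iff by blast
      moreover have "(a, p' a) \<in> \<T>" using a near \<epsilon> \<delta> by auto
      ultimately have "F (a, p' a) = 0" using residual_F False by simp
      then show ?thesis using y_iff[OF a near] by simp
    qed (simp add: p'_0 y(2))
    define A where "A = {a \<in> {0..<\<epsilon>}. p' a = y a}"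
    have "p' a = y a \<longleftrightarrow> p' a \<in> {4 - \<delta><..<4 + \<delta>}" if "a \<in> {0..<\<epsilon>}" for a
    proof
      assume "p' a = y a"
      then show "p' a \<in> {4 - \<delta><..<4 + \<delta>}" using y_in[OF that] by (simp only:)
    qed (rule eq_if[OF that])
    then have eq: "A = {a \<in> {0..<\<epsilon>}. p' a \<in> {4 - \<delta><..<4 + \<delta>}}" unfolding A_def by blast
    have "openin (top_of_set {0..<\<epsilon>}) ({0..<\<epsilon>} \<inter> p' -` {4 - \<delta><..<4 + \<delta>})"
      by (rule continuous_openin_preimage_gen[OF p'_cont]) simp
    moreover have "{0..<\<epsilon>} \<inter> p' -` {4 - \<delta><..<4 + \<delta>} = A" unfolding eq by auto
    ultimately have "openin (top_of_set {0..<\<epsilon>}) A" by simp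
    moreover have "closedin (top_of_set {0..<\<epsilon>}) A"
    proof -
      have "A = {a \<in> {0..<\<epsilon>}. p' a - y a = 0}" by (simp add: A_def)
      then show ?thesis
        using continuous_closedin_preimage_constant[OF continuous_on_diff[OF p'_cont y_cont], of 0] by simp
    qed
    moreover have "connected {0..<\<epsilon>}" by (rule connected_Ico)
    moreover have "0 \<in> A" using \<epsilon> p'_0 y(2) by (simp add: A_def)
    ultimately have "A = {0..<\<epsilon>}" unfolding connected_clopen by blast
    then have "b \<in> A" using b by (simp only:)
    then show "p' b = y b" unfolding A_def by blast
  qed
  ultimately show ?thesis using \<epsilon>(1) by blast
qed

end

theorem theorem2:
  fixes q \<epsilon>0 :: real
    and u :: "real \<Rightarrow> real \<Rightarrow> real \<Rightarrow> real \<Rightarrow> real"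
  assumes "q > 4"
    and "\<epsilon>0 > 0"
    and "profile_family q \<epsilon>0 u"
  shows "(\<exists>\<epsilon>>0. \<exists>p :: real \<Rightarrow> real. zero_energy_curve q \<epsilon>0 u \<epsilon> p \<and>
            (\<forall>p'. zero_energy_curve q \<epsilon>0 u \<epsilon> p' \<longrightarrow> (\<forall>a\<in>{0..<\<epsilon>}. p' a = p a)))
       \<and> (L1_norm (soliton 4))\<^sup>2 / (L2_norm (soliton 4))\<^sup>2 = Gamma (1/4) ^ 4 / (4 * pi\<^sup>2)"
proof -
  interpret profile_branch q \<epsilon>0 u using assms by unfold_locales
  show ?thesis using zero_energy_branch soliton4_norm_ratio by blast
qed

end
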